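(* Let $\mathcal{L}=\sum_{\alpha\cdot\gamma=\ell}A_\alpha\partial^\alpha$ be a semielliptic operator on $\mathbb{R}^n$, and let $F$ be the matrix function defined in the context. Assume $\|\gamma\|>\ell$, and let $f$ be an $m\times1$ complex vector function in the space $C_0^\infty(\mathbb{R}^n)$. Then the integral $$\mathcal{S}f(x)=F*f(x)=\int_{\mathbb{R}^n}F(x-y)\,f(y)\,dy$$ converges absolutely for all $x\in\mathbb{R}^n$, and $\mathcal{S}f\in C^\infty(\mathbb{R}^n)$ with $$\mathcal{L}(\mathcal{S}f)=f .$$
   Context: Semielliptic operator: Let $m,n$ be positive integers, $\underline{\ell}=(\ell_1,\dots,\ell_n)$ a vector of positive integers, $\ell$ a positive integer, and $\gamma=(\gamma_1,\dots,\gamma_n)=(\ell/\ell_1,\dots,\ell/\ell_n)$. For a multi-index $\alpha$ (vector of nonnegative integers), $\alpha\cdot\gamma=\sum_k\alpha_k\gamma_k$, $|\alpha|=\sum_k\alpha_k$, $\partial^\alpha=\partial^{|\alpha|}/\partial x_1^{\alpha_1}\cdots\partial x_n^{\alpha_n}$. Put $\|\gamma\|=\sum_{k=1}^n\gamma_k$. The operator $\mathcal{L}u=\sum_{\alpha\cdot\gamma=\ell}A_\alpha\partial^\alpha u$ has constant real or complex $m\times m$ matrix coefficients $A_\alpha$, has order $\ell=\max\{|\alpha|:A_\alpha\neq0\}$, and is semielliptic, i.e. its symbol $L(x)=\sum_{\alpha\cdot\gamma=\ell}A_\alpha(ix)^\alpha$ is an invertible matrix for every nonzero $x\in\mathbb{R}^n$.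 (It follows that $\max_k\ell_k=\ell$.) Fundamental solution: with $\sigma(z)=\sum_{k=1}^n z_k^{2\ell_k}$, $F$ is the $m\times m$ matrix function given for $x\neq0$ by the iterated integral (inner integral over $z$ first, then over $t$) $$F(x)=(2\pi)^{-n}\int_0^\infty\int_{\mathbb{R}^n}e^{ix\cdot z}\sigma(z)e^{-t\sigma(z)}L(z)^{-1}\,dz\,dt ,$$ which is well defined for every $x\ne0$ when $\|\gamma\|>\ell$. *)

theory Defs
  imports "HOL-Analysis.Analysis"
begin

subsection \<open>Smooth functions and multi-index derivatives\<close>

definition partial :: "'n::finite \<Rightarrow> (real ^ 'n \<Rightarrow> 'a::real_normed_vector) \<Rightarrow> real ^ 'n \<Rightarrow> 'a" where
  "partial k u x = vector_derivative (\<lambda>t. u (x + t *\<^sub>R axis k 1)) (at 0)"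

definition partials :: "'n::finite list \<Rightarrow> (real ^ 'n \<Rightarrow> 'a::real_normed_vector) \<Rightarrow> real ^ 'n \<Rightarrow> 'a" where
  "partials ks u = foldr partial ks u"

text \<open>The existence of each partial derivative is required explicitly, because
  \<^const>\<open>vector_derivative\<close> is a total function.\<close>

definition smooth :: "(real ^ 'n::finite \<Rightarrow> 'a::real_normed_vector) \<Rightarrow> bool" where
  "smooth u \<longleftrightarrow>
    (\<forall>ks. continuous_on UNIV (partials ks u) \<and>
          (\<forall>k x. (\<lambda>t. partials ks u (x + t *\<^sub>R axis k 1)) differentiable (at 0)))"

definition smooth_compact_support :: "(real ^ 'n::finite \<Rightarrow> 'a::real_normed_vector) \<Rightarrow> bool" where
  "smooth_compact_support f \<longleftrightarrow> smooth f \<and> compact (closure {x. f x \<noteq> 0})"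

text \<open>The index type carries no order, so the order in which the \<open>|\<alpha>|\<close> derivatives are taken
  is an arbitrary fixed one; by the symmetry of mixed partial derivatives it is immaterial on
  smooth functions.\<close>

definition multi_deriv ::
    "('n::finite \<Rightarrow> nat) \<Rightarrow> (real ^ 'n \<Rightarrow> 'a::real_normed_vector) \<Rightarrow> real ^ 'n \<Rightarrow> 'a" where
  "multi_deriv \<alpha> u = partials (SOME ks. \<forall>k. count_list ks k = \<alpha> k) u"

lemma ex_list_of_multi_index:
  fixes \<alpha> :: "'n::finite \<Rightarrow> nat"
  shows "\<exists>ks. \<forall>k. count_list ks k = \<alpha> k"
proof -
  obtain ks where "mset ks = Abs_multiset \<alpha>"
    using ex_mset by blast
  then have "count_list ks k = \<alpha> k" for k
    by (simp flip: count_mset add: count_Abs_multiset)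
  then show ?thesis by blast
qed

subsection \<open>Semielliptic operators\<close>

definition weight :: "nat \<Rightarrow> ('n::finite \<Rightarrow> nat) \<Rightarrow> 'n \<Rightarrow> real" where
  "weight l ls k = real l / real (ls k)"

definition indices :: "nat \<Rightarrow> ('n::finite \<Rightarrow> nat) \<Rightarrow> ('n \<Rightarrow> nat) set" where
  "indices l ls = {\<alpha>. (\<Sum>k\<in>UNIV. real (\<alpha> k) * weight l ls k) = real l}"

lemma finite_indices:
  assumes "0 < l" and pos: "\<And>k. 0 < ls k"
  shows "finite (indices l ls)"
proof (rule finite_subset)
  show "indices l ls \<subseteq> (\<Pi>\<^sub>E k\<in>UNIV. {..ls k})"
  proof
    fix \<alpha> assume "\<alpha> \<in> indices l ls"
    then have *: "(\<Sum>k\<in>UNIV. real (\<alpha> k) * weight l ls k) = real l"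
      by (simp add: indices_def)
    have "\<alpha> k \<le> ls k" for k
    proof -
      have "real (\<alpha> k) * weight l ls k \<le> real l"
        unfolding *[symmetric] by (rule member_le_sum) (auto simp: weight_def)
      with assms show ?thesis
        by (simp add: weight_def field_simps)
    qed
    then show "\<alpha> \<in> (\<Pi>\<^sub>E k\<in>UNIV. {..ls k})" by auto
  qed
qed (auto intro: finite_PiE)

definition cscale :: "complex \<Rightarrow> complex ^ 'm ^ 'm \<Rightarrow> complex ^ 'm ^ 'm" where
  "cscale c M = (\<chi> i j. c * M $ i $ j)"

definition operator ::
    "nat \<Rightarrow> ('n::finite \<Rightarrow> nat) \<Rightarrow> (('n \<Rightarrow> nat) \<Rightarrow> complex ^ 'm ^ 'm)
      \<Rightarrow> (real ^ 'n \<Rightarrow> complex ^ 'm) \<Rightarrow> real ^ 'n \<Rightarrow> complex ^ 'm::finite" where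
  "operator l ls A u x = (\<Sum>\<alpha>\<in>indices l ls. A \<alpha> *v multi_deriv \<alpha> u x)"

definition symbol ::
    "nat \<Rightarrow> ('n::finite \<Rightarrow> nat) \<Rightarrow> (('n \<Rightarrow> nat) \<Rightarrow> complex ^ 'm ^ 'm)
      \<Rightarrow> real ^ 'n \<Rightarrow> complex ^ 'm ^ 'm::finite" where
  "symbol l ls A x =
    (\<Sum>\<alpha>\<in>indices l ls. cscale (\<Prod>k\<in>UNIV. (\<i> * complex_of_real (x $ k)) ^ \<alpha> k) (A \<alpha>))"

definition semielliptic ::
    "nat \<Rightarrow> ('n::finite \<Rightarrow> nat) \<Rightarrow> (('n \<Rightarrow> nat) \<Rightarrow> complex ^ 'm ^ 'm::finite) \<Rightarrow> bool" where
  "semielliptic l ls A \<longleftrightarrow>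
    0 < l \<and> (\<forall>k. 0 < ls k) \<and>
    l = Max {\<Sum>k\<in>UNIV. \<alpha> k | \<alpha>. \<alpha> \<in> indices l ls \<and> A \<alpha> \<noteq> 0} \<and>
    (\<forall>x. x \<noteq> 0 \<longrightarrow> invertible (symbol l ls A x))"

subsection \<open>The fundamental solution and its potential\<close>

definition sigma :: "('n::finite \<Rightarrow> nat) \<Rightarrow> real ^ 'n \<Rightarrow> real" where
  "sigma ls z = (\<Sum>k\<in>UNIV. (z $ k) ^ (2 * ls k))"

text \<open>Only the values at \<open>x \<noteq> 0\<close> are meaningful. In the inner integral, the value of
  \<^const>\<open>matrix_inv\<close> at the null set \<open>{0}\<close>, where the symbol vanishes, is irrelevant.\<close>

definition fundamental_solution ::
    "nat \<Rightarrow> ('n::finite \<Rightarrow> nat) \<Rightarrow> (('n \<Rightarrow> nat) \<Rightarrow> complex ^ 'm ^ 'm)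
      \<Rightarrow> real ^ 'n \<Rightarrow> complex ^ 'm ^ 'm::finite" where
  "fundamental_solution l ls A x =
    (1 / (2 * pi) ^ CARD('n)) *\<^sub>R
      (LINT t:{0<..}|lborel. LINT z|lborel.
        cscale (exp (\<i> * complex_of_real (x \<bullet> z)) *
                complex_of_real (sigma ls z * exp (- t * sigma ls z)))
          (matrix_inv (symbol l ls A z)))"

definition potential ::
    "nat \<Rightarrow> ('n::finite \<Rightarrow> nat) \<Rightarrow> (('n \<Rightarrow> nat) \<Rightarrow> complex ^ 'm ^ 'm)
      \<Rightarrow> (real ^ 'n \<Rightarrow> complex ^ 'm) \<Rightarrow> real ^ 'n \<Rightarrow> complex ^ 'm::finite" where
  "potential l ls A f x = (LINT y|lborel. fundamental_solution l ls A (x - y) *v f y)"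

end

theory Submission
  imports Defs "HOL-Probability.Characteristic_Functions" "HOL-Probability.Sinc_Integral"
begin

text \<open>
  Write \<open>L\<close> for the symbol, \<open>\<sigma>\<close> for the gauge \<open>sigma ls\<close>, and
  \<open>N = (\<Sum>k. 1 / ls k)\<close>; the hypothesis on the weights says \<open>N > 1\<close>.  For \<open>t > 0\<close> let
  \<open>G t x = (\<integral> exp (i x\<bullet>z) \<sigma>(z) exp (- t \<sigma>(z)) inverse (L z) dz)\<close>, so that the fundamental solution \<open>F\<close> is
  \<open>(2 \<pi>)^(- n)\<close> times \<open>(\<integral>\<^sub>0\<^sup>\<infinity> G t x dt)\<close>.  Everything rests on one estimate: the double integral of
  \<open>norm (G t x)\<close> over \<open>t > 0\<close> and \<open>x\<close> in a ball is finite (\<open>heat_deriv_locally_integrable\<close>).  It makes \<open>F\<close> locally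
  integrable, hence the potential absolutely convergent and, since all derivatives can be moved to
  \<open>f\<close>, smooth (\<open>smooth_convolve\<close>); and it licenses the exchanges of integrals in the proof of the equation.

  For the estimate use the dilations \<open>\<delta> c z = (c powr (1 / ls k) * z k)\<close>, under which \<open>\<sigma>\<close> is
  homogeneous of degree 2 and \<open>L\<close> of degree 1.  Scaling expresses \<open>G t\<close> through \<open>G 1\<close> and gives
  \<open>\<integral> norm (G t x) dx = t powr (-1/2) * (\<integral> norm (G 1 x) dx)\<close> and
  \<open>norm (G t x) \<le> C * t powr (- (N + 1) / 2)\<close>.  The first bound is integrable for \<open>t \<le> 1\<close>, the second,
  because \<open>N > 1\<close>, for \<open>t \<ge> 1\<close>.  It remains to see that \<open>G 1\<close> is integrable over the whole space.
  Its symbol \<open>\<sigma> exp (- \<sigma>) inverse L\<close> decays fast at infinity but is in general only finitely smooth at the origin, so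
  integration by parts yields only limited decay of \<open>G 1\<close>.  Differentiating \<open>k\<close> times in time
  multiplies the symbol by \<open>\<sigma> ^ k\<close>, up to sign, and this makes it as smooth at the origin as desired: the
  \<open>k\<close>-th time derivative is integrable for large \<open>k\<close> (\<open>fourier_quot_integrable\<close>).  Integrating
  back in time from infinity preserves integrability, because the derivative of order \<open>k + 1\<close> at time \<open>s\<close> has an
  \<open>L\<^sup>1\<close> norm proportional to \<open>s powr (- k - 3/2)\<close> (\<open>heat_deriv_integrable_step\<close>); a
  downward induction on \<open>k\<close> reaches \<open>G 1\<close>.  Differentiation of \<open>inverse L\<close> is made elementary by
  Cramer's rule: its entries are quotients \<open>P / D\<close> of polynomials, \<open>D = det L\<close> being homogeneous and
  zero only at the origin.

  For the equation, let \<open>g\<close> be a derivative of \<open>f\<close>, with Fourier transform \<open>g^\<close>.  Fubini turns the potential of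
  \<open>g\<close> into the integral over \<open>t\<close> of \<open>\<integral> exp (i x\<bullet>z) \<sigma> exp (- t \<sigma>) inverse L g^ dz\<close>
  (\<open>potential_formula\<close>).  Applying the operator produces \<open>L\<close> as a factor on the left of \<open>inverse L\<close>,
  which leaves the transform of \<open>f\<close> itself.  As \<open>\<integral>\<^sub>0\<^sup>\<infinity> \<sigma> exp (- t \<sigma>) dt = 1\<close>, the result is the
  Fourier inversion integral of \<open>f\<close> (\<open>fourier_inversion\<close>).
\<close>

section \<open>Lebesgue integrals over real n-space\<close>

lemma Basis_vec_eq_range_axis: "(Basis :: (real ^ 'n) set) = range (\<lambda>k. axis k 1)"
  by (auto simp: Basis_vec_def)

lemma inj_axis_one: "inj (\<lambda>k. axis k (1::real) :: real ^ 'n)"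
  by (auto simp: inj_on_def axis_eq_axis)

lemma prod_Basis_vec: "(\<Prod>b\<in>Basis. g b) = (\<Prod>k\<in>UNIV. g (axis k 1 :: real ^ 'n))"
  unfolding Basis_vec_eq_range_axis by (subst prod.reindex[OF inj_axis_one]) simp

lemma sum_Basis_vec: "(\<Sum>b\<in>Basis. g b) = (\<Sum>k\<in>UNIV. g (axis k 1 :: real ^ 'n))"
  unfolding Basis_vec_eq_range_axis by (subst sum.reindex[OF inj_axis_one]) simp

lemma axis_nth': "axis k (c::real) $ i = (if i = k then c else 0)"
  by (simp add: axis_def)

text \<open>The library indexes products over a Euclidean space by basis vectors; this inverse of
  \<open>\<lambda>k. axis k 1\<close> translates them to the coordinate type.\<close>

definition basis_index :: "real ^ 'n \<Rightarrow> 'n" where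
  "basis_index b = (THE k. b = axis k 1)"

lemma basis_index_axis [simp]: "basis_index (axis k 1) = k"
  unfolding basis_index_def by (rule the_equality) (auto simp: axis_eq_axis)

text \<open>Lebesgue measure on the space is the image of the product measure indexed by the basis, so Fubini for
  finite products applies after reindexing.\<close>

lemma lborel_integral_prod_vec:
  fixes f :: "'n::finite \<Rightarrow> real \<Rightarrow> 'b::{real_normed_field, banach, second_countable_topology}"
  assumes int: "\<And>k. integrable lborel (f k)"
  shows "integrable lborel (\<lambda>x :: real ^ 'n. \<Prod>k\<in>UNIV. f k (x $ k))"
    and "(LINT x|lborel. (\<Prod>k\<in>UNIV. f k ((x :: real ^ 'n) $ k))) = (\<Prod>k\<in>UNIV. (LINT x|lborel. f k x))"
proof -
  interpret product_sigma_finite "\<lambda>_ :: real ^ 'n. lborel :: real measure" ..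
  have m[measurable]: "f k \<in> borel_measurable borel" for k
    using int[of k] by simp
  have comp: "(\<Sum>b\<in>Basis. g b *\<^sub>R b) $ k = g (axis k 1)" for g :: "real ^ 'n \<Rightarrow> real" and k
    by (simp add: sum_Basis_vec sum_component axis_def if_distrib cong: if_cong)
  have eq: "(\<Prod>k\<in>UNIV. f k ((\<Sum>b\<in>Basis. g b *\<^sub>R b) $ k)) = (\<Prod>b\<in>Basis. f (basis_index b) (g b))"
    for g :: "real ^ 'n \<Rightarrow> real"
    by (simp only: prod_Basis_vec comp basis_index_axis)
  have T: "(\<lambda>g. \<Sum>b\<in>Basis. g b *\<^sub>R b) \<in> (\<Pi>\<^sub>M b\<in>(Basis :: (real ^ 'n) set). lborel) \<rightarrow>\<^sub>M (borel :: (real ^ 'n) measure)"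
    by measurable
  show "integrable lborel (\<lambda>x :: real ^ 'n. \<Prod>k\<in>UNIV. f k (x $ k))"
    apply (subst lborel_eq, subst integrable_distr_eq[OF T], measurable)
    unfolding eq by (rule product_integrable_prod) (auto simp: int)
  show "(LINT x|lborel. (\<Prod>k\<in>UNIV. f k ((x :: real ^ 'n) $ k))) = (\<Prod>k\<in>UNIV. (LINT x|lborel. f k x))"
    apply (subst lborel_eq, subst integral_distr[OF T], measurable)
    unfolding eq by (subst product_integral_prod) (auto simp: int prod_Basis_vec)
qed

lemma distr_lborel_diff: "distr lborel borel (\<lambda>x. a - x) = (lborel :: 'a::euclidean_space measure)"
  using lborel_affine[of "-1" a] by (simp add: density_1)

lemma integrable_translate:
  fixes a :: "'a::euclidean_space" and f :: "'a \<Rightarrow> 'b::{banach, second_countable_topology}"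
  assumes "integrable lborel f"
  shows "integrable lborel (\<lambda>x. f (a + x))"
proof -
  have [measurable]: "f \<in> borel_measurable borel" using assms by simp
  show ?thesis using assms
    by (subst (asm) lborel_distr_plus[symmetric, of a]) (simp add: integrable_distr_eq)
qed

lemma integral_translate:
  fixes a :: "'a::euclidean_space" and f :: "'a \<Rightarrow> 'b::{banach, second_countable_topology}"
  assumes [measurable]: "f \<in> borel_measurable borel"
  shows "(LINT x|lborel. f (a + x)) = (LINT x|lborel. f x)"
  by (subst (2) lborel_distr_plus[symmetric, of a]) (simp add: integral_distr)

lemma nn_integral_reflect:
  fixes a :: "'a::euclidean_space"
  assumes [measurable]: "f \<in> borel_measurable borel"
  shows "(\<integral>\<^sup>+x. f (a - x) \<partial>lborel) = (\<integral>\<^sup>+x. f x \<partial>lborel)"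
  by (subst (2) distr_lborel_diff[symmetric, of a]) (simp add: nn_integral_distr)

lemma integrable_reflect:
  fixes a :: "'a::euclidean_space" and f :: "'a \<Rightarrow> 'b::{banach, second_countable_topology}"
  assumes "integrable lborel f"
  shows "integrable lborel (\<lambda>x. f (a - x))"
proof -
  have [measurable]: "f \<in> borel_measurable borel" using assms by simp
  show ?thesis using assms
    by (subst (asm) distr_lborel_diff[symmetric, of a]) (simp add: integrable_distr_eq)
qed

lemma integral_reflect:
  fixes a :: "'a::euclidean_space" and f :: "'a \<Rightarrow> 'b::{banach, second_countable_topology}"
  assumes [measurable]: "f \<in> borel_measurable borel"
  shows "(LINT x|lborel. f (a - x)) = (LINT x|lborel. f x)"
  by (subst (2) distr_lborel_diff[symmetric, of a]) (simp add: integral_distr)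

definition stretch :: "('n \<Rightarrow> real) \<Rightarrow> real ^ 'n \<Rightarrow> real ^ 'n" where
  "stretch d z = (\<chi> k. d k * z $ k)"

lemma stretch_nth [simp]: "stretch d z $ k = d k * z $ k"
  by (simp add: stretch_def)

lemma measurable_stretch [measurable]: "stretch d \<in> borel_measurable borel"
  unfolding stretch_def by (intro borel_measurable_continuous_onI continuous_intros)

lemma lborel_stretch:
  fixes d :: "'n::finite \<Rightarrow> real"
  assumes "\<And>k. d k > 0"
  shows "lborel = density (distr lborel borel (stretch d)) (\<lambda>_. ennreal (\<Prod>k\<in>UNIV. d k))"
proof -
  have T: "(\<lambda>x :: real ^ 'n. 0 + (\<Sum>j\<in>Basis. (d (basis_index j) * (x \<bullet> j)) *\<^sub>R j)) = stretch d"
    by (auto simp: fun_eq_iff vec_eq_iff sum_Basis_vec sum_component inner_axis axis_nth' if_distrib cong: if_cong)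
  have "d (basis_index j) \<noteq> 0" for j using assms[of "basis_index j"] by simp
  from lborel_affine_euclidean[where c="\<lambda>j :: real ^ 'n. d (basis_index j)" and t=0, OF this]
  show ?thesis unfolding T using assms by (simp add: prod_Basis_vec abs_of_pos)
qed

lemma nn_integral_stretch:
  fixes d :: "'n::finite \<Rightarrow> real"
  assumes [measurable]: "f \<in> borel_measurable borel" and "\<And>k. d k > 0"
  shows "(\<integral>\<^sup>+x. f x \<partial>lborel) = ennreal (\<Prod>k\<in>UNIV. d k) * (\<integral>\<^sup>+x. f (stretch d x) \<partial>lborel)"
  by (subst lborel_stretch[of d, OF assms(2)]) (simp add: nn_integral_density nn_integral_distr nn_integral_cmult)

lemma integral_stretch:
  fixes d :: "'n::finite \<Rightarrow> real" and f :: "real ^ 'n \<Rightarrow> 'b::{banach, second_countable_topology}"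
  assumes [measurable]: "f \<in> borel_measurable borel" and "\<And>k. d k > 0"
  shows "(LINT x|lborel. f x) = (\<Prod>k\<in>UNIV. d k) *\<^sub>R (LINT x|lborel. f (stretch d x))"
  using assms(2)
  by (subst lborel_stretch[of d, OF assms(2)])
     (simp add: integral_density integral_distr prod_nonneg less_imp_le)

lemma integrable_prod_inverse_square:
  "integrable lborel (\<lambda>z :: real ^ 'n::finite. \<Prod>k\<in>UNIV. inverse (1 + (z $ k)\<^sup>2))"
  using integrable_inverse_1_plus_square
  by (intro lborel_integral_prod_vec) (simp add: set_integrable_def)

lemma prod_one_plus_square_le:
  fixes z :: "real ^ 'n::finite"
  shows "(\<Prod>k\<in>UNIV. 1 + (z $ k)\<^sup>2) \<le> (1 + (norm z)\<^sup>2) ^ CARD('n)"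
proof -
  have "(\<Prod>k\<in>UNIV. 1 + (z $ k)\<^sup>2) \<le> (\<Prod>k\<in>(UNIV::'n set). 1 + (norm z)\<^sup>2)"
  proof (rule prod_mono)
    fix k
    have "(z $ k)\<^sup>2 \<le> (norm z)\<^sup>2"
      using component_le_norm_cart[of z k] by (metis abs_ge_zero power2_abs power_mono)
    then show "0 \<le> 1 + (z $ k)\<^sup>2 \<and> 1 + (z $ k)\<^sup>2 \<le> 1 + (norm z)\<^sup>2" by simp
  qed
  then show ?thesis by simp
qed

text \<open>The hypothesis makes a multiple of \<open>\<Prod>k. 1 / (1 + (z k)\<^sup>2)\<close> a majorant, and this product is integrable
  because each factor is.\<close>

lemma integrable_polynomial_decay:
  fixes h :: "real ^ 'n::finite \<Rightarrow> 'b::{banach, second_countable_topology}"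
  assumes [measurable]: "h \<in> borel_measurable borel"
    and bound: "\<And>z. norm (h z) * (1 + (norm z)\<^sup>2) ^ CARD('n) \<le> C"
  shows "integrable lborel h"
proof (rule Bochner_Integration.integrable_bound)
  show "integrable lborel (\<lambda>z :: real ^ 'n::finite. C * (\<Prod>k\<in>UNIV. inverse (1 + (z $ k)\<^sup>2)))"
    by (intro integrable_mult_right integrable_prod_inverse_square)
  show "AE z in lborel. norm (h z) \<le> norm (C * (\<Prod>k\<in>UNIV. inverse (1 + (z $ k)\<^sup>2)))"
  proof (rule AE_I2)
    fix z :: "real ^ 'n"
    let ?P = "\<Prod>k\<in>UNIV. 1 + (z $ k)\<^sup>2"
    have P: "?P > 0" by (intro prod_pos) (auto intro: add_pos_nonneg)
    have "norm (h z) * ?P \<le> C"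
      by (rule order_trans[OF mult_left_mono[OF prod_one_plus_square_le] bound]) simp
    then have "norm (h z) \<le> C * inverse ?P" using P by (simp add: field_simps)
    also have "inverse ?P = (\<Prod>k\<in>UNIV. inverse (1 + (z $ k)\<^sup>2))"
      by (rule prod_inversef[symmetric, unfolded o_def])
    finally show "norm (h z) \<le> norm (C * (\<Prod>k\<in>UNIV. inverse (1 + (z $ k)\<^sup>2)))" by simp
  qed
qed simp

section \<open>Fourier transforms and integration by parts\<close>

lemma has_vector_derivative_along_line:
  fixes H :: "'a::real_normed_vector \<Rightarrow> 'b::real_normed_vector"
  assumes "((\<lambda>t. H (z + s *\<^sub>R e + t *\<^sub>R e)) has_vector_derivative d) (at 0)"
  shows "((\<lambda>t. H (z + t *\<^sub>R e)) has_vector_derivative d) (at s)"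
proof -
  have "((\<lambda>t. H (z + s *\<^sub>R e + t *\<^sub>R e)) has_vector_derivative d) (at (s - s))"
    using assms by simp
  moreover have "((\<lambda>u. u - s) has_vector_derivative 1) (at s)"
    by (auto intro!: derivative_eq_intros)
  ultimately have "((\<lambda>t. H (z + s *\<^sub>R e + t *\<^sub>R e)) \<circ> (\<lambda>u. u - s) has_vector_derivative 1 *\<^sub>R d) (at s)"
    by (intro vector_diff_chain_at)
  then show ?thesis by (simp add: o_def algebra_simps)
qed

text \<open>By translation invariance the integral of \<open>H (z + e) - H z\<close> vanishes, where \<open>e\<close> is the \<open>k\<close>-th unit
  vector.  This difference is the integral of \<open>H'\<close> along a unit segment, and by Fubini and translation
  invariance its integral over \<open>z\<close> is that of \<open>H'\<close>.  No boundary terms appear, and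
  a single bad point is harmless since a line meets it at most once.\<close>

lemma integral_partial_eq_0:
  fixes H :: "real ^ 'n::finite \<Rightarrow> complex"
  assumes cont: "continuous_on UNIV H" and int: "integrable lborel H" and int': "integrable lborel H'"
    and der: "\<And>z. z \<noteq> 0 \<Longrightarrow> ((\<lambda>t. H (z + t *\<^sub>R axis k 1)) has_vector_derivative H' z) (at 0)"
  shows "(LINT z|lborel. H' z) = 0"
proof -
  let ?e = "axis k 1 :: real ^ 'n"
  have [measurable]: "H \<in> borel_measurable borel" "H' \<in> borel_measurable borel"
    using int int' by auto
  have tr: "integrable lborel (\<lambda>z. H' (z + s *\<^sub>R ?e))" for s
    using integrable_translate[OF int', of "s *\<^sub>R ?e"] by (simp add: add.commute)
  have norm_tr: "(LINT z|lborel. norm (H' (z + s *\<^sub>R ?e))) = (LINT z|lborel. norm (H' z))" for s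
    using integral_translate[of "\<lambda>z. norm (H' z)" "s *\<^sub>R ?e"] by (simp add: add.commute)
  let ?G = "\<lambda>s z. indicator {0..1} s *\<^sub>R H' (z + s *\<^sub>R ?e)"
  have joint: "integrable (lborel \<Otimes>\<^sub>M lborel) (case_prod ?G)"
  proof (rule lborel_pair.Fubini_integrable)
    show "case_prod ?G \<in> borel_measurable (lborel \<Otimes>\<^sub>M lborel)" by measurable
    show "AE s in lborel. integrable lborel (\<lambda>z. case (s, z) of (s, z) \<Rightarrow> ?G s z)"
      using tr by simp
    have "(\<lambda>s. LINT z|lborel. norm (case (s, z) of (s, z) \<Rightarrow> ?G s z))
        = (\<lambda>s. indicator {0..1::real} s *\<^sub>R (LINT z|lborel. norm (H' z)))"
      by (auto simp: norm_tr)
    then show "integrable lborel (\<lambda>s. LINT z|lborel. norm (case (s, z) of (s, z) \<Rightarrow> ?G s z))"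
      by simp
  qed
  have ftc: "AE z in lborel. (LINT s|lborel. ?G s z) = H (?e + z) - H z"
    using lborel_pair.AE_integrable_snd[OF joint]
  proof eventually_elim
    fix z assume i: "integrable lborel (\<lambda>s. ?G s z)"
    have "((\<lambda>s. H' (z + s *\<^sub>R ?e)) has_integral (H (z + 1 *\<^sub>R ?e) - H (z + 0 *\<^sub>R ?e))) {0..1}"
    proof (rule fundamental_theorem_of_calculus_strong)
      have "{s. z + s *\<^sub>R ?e = 0} \<subseteq> {- (z $ k)}"
        by (auto simp: vec_eq_iff axis_nth' dest: spec[of _ k])
      then show "finite {s. z + s *\<^sub>R ?e = 0}" using finite_subset by blast
      show "continuous_on {0..1} (\<lambda>s. H (z + s *\<^sub>R ?e))"
        by (intro continuous_on_compose2[OF cont] continuous_intros) auto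
      fix s :: real assume "s \<in> {0..1} - {s. z + s *\<^sub>R ?e = 0}"
      then have "((\<lambda>t. H (z + s *\<^sub>R ?e + t *\<^sub>R ?e)) has_vector_derivative H' (z + s *\<^sub>R ?e)) (at 0)"
        by (intro der) auto
      then show "((\<lambda>s. H (z + s *\<^sub>R ?e)) has_vector_derivative H' (z + s *\<^sub>R ?e)) (at s)"
        by (rule has_vector_derivative_along_line)
    qed simp
    moreover have "set_integrable lborel {0..1} (\<lambda>s. H' (z + s *\<^sub>R ?e))"
      using i by (simp add: set_integrable_def)
    ultimately show "(LINT s|lborel. ?G s z) = H (?e + z) - H z"
      using set_borel_integral_eq_integral(2)[of "{0..1}" "\<lambda>s. H' (z + s *\<^sub>R ?e)"]
      by (simp add: set_lebesgue_integral_def integral_unique add.commute)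
  qed
  have "(LINT z|lborel. LINT s|lborel. ?G s z) = (LINT z|lborel. H (?e + z) - H z)"
    by (rule integral_cong_AE) (use ftc in auto)
  also have "\<dots> = (LINT z|lborel. H (?e + z)) - (LINT z|lborel. H z)"
    by (intro Bochner_Integration.integral_diff int integrable_translate)
  also have "\<dots> = 0" by (simp add: integral_translate)
  finally have "0 = (LINT z|lborel. LINT s|lborel. ?G s z)" by simp
  also have "\<dots> = (LINT s|lborel. LINT z|lborel. ?G s z)"
    by (rule lborel_pair.Fubini_integral[OF joint])
  also have "\<dots> = (LINT s|lborel. indicator {0..1::real} s *\<^sub>R (LINT z|lborel. H' z))"
  proof -
    have "(LINT z|lborel. ?G s z) = indicator {0..1::real} s *\<^sub>R (LINT z|lborel. H' z)" for s
      using integral_translate[of H' "s *\<^sub>R ?e"] by (simp add: add.commute)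
    then show ?thesis by (simp only:)
  qed
  also have "\<dots> = (LINT z|lborel. H' z)" by simp
  finally show ?thesis by simp
qed

text \<open>Unnormalised, with the positive sign in the exponent.  The forward transform with kernel
  \<open>exp (- i z\<bullet>y)\<close> is therefore \<open>fourier h (- z)\<close>.\<close>

definition fourier :: "(real ^ 'n::finite \<Rightarrow> complex) \<Rightarrow> real ^ 'n \<Rightarrow> complex" where
  "fourier h y = (LINT z|lborel. exp (\<i> * complex_of_real (y \<bullet> z)) * h z)"

lemma norm_exp_i [simp]: "norm (exp (\<i> * complex_of_real t)) = 1"
  by (simp add: norm_exp_eq_Re)

lemma integrable_fourier_integrand:
  assumes "integrable lborel h"
  shows "integrable lborel (\<lambda>z. exp (\<i> * complex_of_real (y \<bullet> z)) * h z)"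
proof (rule Bochner_Integration.integrable_bound[OF assms])
  have [measurable]: "h \<in> borel_measurable borel" using assms by simp
  show "(\<lambda>z. exp (\<i> * complex_of_real (y \<bullet> z)) * h z) \<in> borel_measurable lborel" by measurable
qed (simp add: norm_mult)

lemma measurable_fourier [measurable]:
  assumes [measurable]: "h \<in> borel_measurable borel"
  shows "fourier h \<in> borel_measurable borel"
proof -
  have "(\<lambda>y. LINT z|lborel. exp (\<i> * complex_of_real (y \<bullet> z)) * h z) \<in> borel_measurable borel"
    by measurable
  then show ?thesis by (simp add: fourier_def[abs_def])
qed

lemma norm_fourier_le:
  assumes "integrable lborel h"
  shows "norm (fourier h y) \<le> (LINT z|lborel. norm (h z))"
  unfolding fourier_def
  using integral_norm_bound[of lborel "\<lambda>z. exp (\<i> * complex_of_real (y \<bullet> z)) * h z"]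
  by (simp add: norm_mult)

lemma has_vector_derivative_exp:
  fixes f :: "real \<Rightarrow> complex"
  assumes "(f has_vector_derivative f') (at x)"
  shows "((\<lambda>t. exp (f t)) has_vector_derivative f' * exp (f x)) (at x)"
  using field_vector_diff_chain_at[OF assms DERIV_exp] by (simp add: o_def)

text \<open>Integration by parts: the integral of the derivative of \<open>exp (i y\<bullet>z) * h z\<close> is zero.  The origin is
  excepted because the symbols below are quotients with denominators vanishing there.\<close>

lemma fourier_partial:
  fixes h :: "real ^ 'n::finite \<Rightarrow> complex"
  assumes cont: "continuous_on UNIV h" and int: "integrable lborel h" and int': "integrable lborel h'"
    and der: "\<And>z. z \<noteq> 0 \<Longrightarrow> ((\<lambda>t. h (z + t *\<^sub>R axis k 1)) has_vector_derivative h' z) (at 0)"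
  shows "fourier h' y = - (\<i> * complex_of_real (y $ k) * fourier h y)"
proof -
  let ?E = "\<lambda>z. exp (\<i> * complex_of_real (y \<bullet> z))"
  let ?H' = "\<lambda>z. \<i> * complex_of_real (y $ k) * (?E z * h z) + ?E z * h' z"
  have i: "integrable lborel (\<lambda>z. ?E z * h z)" "integrable lborel (\<lambda>z. ?E z * h' z)"
    using int int' by (auto intro: integrable_fourier_integrand)
  have "(LINT z|lborel. ?H' z) = 0"
  proof (rule integral_partial_eq_0[where H="\<lambda>z. ?E z * h z" and k=k])
    show "continuous_on UNIV (\<lambda>z. ?E z * h z)" by (intro continuous_intros cont)
    show "integrable lborel (\<lambda>z. ?E z * h z)" by fact
    show "integrable lborel ?H'" using i by (intro Bochner_Integration.integrable_add integrable_mult_right)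
    fix z :: "real ^ 'n" assume "z \<noteq> 0"
    note d = der[OF this]
    have "((\<lambda>t. ?E (z + t *\<^sub>R axis k 1)) has_vector_derivative \<i> * complex_of_real (y $ k) * ?E z) (at 0)"
    proof -
      have eq: "(\<lambda>t. ?E (z + t *\<^sub>R axis k 1)) = (\<lambda>t. exp (\<i> * complex_of_real (y \<bullet> z) + t *\<^sub>R (\<i> * complex_of_real (y $ k))))"
      proof
        fix t :: real
        have "y \<bullet> (z + t *\<^sub>R axis k 1) = y \<bullet> z + t * y $ k"
          by (simp add: inner_add_right inner_axis)
        then show "?E (z + t *\<^sub>R axis k 1) = exp (\<i> * complex_of_real (y \<bullet> z) + t *\<^sub>R (\<i> * complex_of_real (y $ k)))"
          by (simp add: scaleR_conv_of_real[where 'a=complex] distrib_left mult.left_commute)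
      qed
      have "((\<lambda>t. \<i> * complex_of_real (y \<bullet> z) + t *\<^sub>R (\<i> * complex_of_real (y $ k)))
          has_vector_derivative \<i> * complex_of_real (y $ k)) (at 0)"
        unfolding has_vector_derivative_def by (auto intro!: derivative_eq_intros)
      from has_vector_derivative_exp[OF this] show ?thesis unfolding eq by simp
    qed
    from has_vector_derivative_mult[OF this d]
    show "((\<lambda>t. ?E (z + t *\<^sub>R axis k 1) * h (z + t *\<^sub>R axis k 1)) has_vector_derivative ?H' z) (at 0)"
      by (simp add: mult.assoc add.commute)
  qed
  moreover have "(LINT z|lborel. ?H' z) = \<i> * complex_of_real (y $ k) * fourier h y + fourier h' y"
    unfolding fourier_def using i by (subst Bochner_Integration.integral_add) auto
  ultimately show ?thesis by (simp add: eq_neg_iff_add_eq_0 add.commute)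
qed

text \<open>Pure powers of single coordinates suffice: at each point the largest coordinate controls the norm.\<close>

lemma integrable_coordinate_decay:
  fixes g :: "real ^ 'n::finite \<Rightarrow> 'b::{banach, second_countable_topology}"
  assumes [measurable]: "g \<in> borel_measurable borel"
    and bd: "\<And>y. norm (g y) \<le> C0"
    and decay: "\<And>j. \<exists>C. \<forall>y. \<bar>y $ j\<bar> ^ (2 * CARD('n)) * norm (g y) \<le> C"
  shows "integrable lborel g"
proof -
  obtain C where C: "\<And>j y. \<bar>y $ j\<bar> ^ (2 * CARD('n)) * norm (g y) \<le> C j"
    using decay by metis
  let ?n = "CARD('n)"
  let ?c = "real ?n ^ (2 * ?n)"
  have C0: "0 \<le> C0" using bd[of 0] norm_ge_zero order_trans by blast
  have Cj: "0 \<le> C j" for j using C[where y=0 and j=j] by (auto intro: order_trans[rotated])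
  show ?thesis
  proof (rule integrable_polynomial_decay)
    fix y :: "real ^ 'n"
    obtain j where j: "\<And>k. \<bar>y $ k\<bar> \<le> \<bar>y $ j\<bar>"
    proof -
      have "Max (range (\<lambda>k. \<bar>y $ k\<bar>)) \<in> range (\<lambda>k. \<bar>y $ k\<bar>)" by (intro Max_in) auto
      then obtain j where "Max (range (\<lambda>k. \<bar>y $ k\<bar>)) = \<bar>y $ j\<bar>" by (rule imageE)
      moreover have "\<bar>y $ k\<bar> \<le> Max (range (\<lambda>k. \<bar>y $ k\<bar>))" for k by (intro Max_ge) auto
      ultimately show ?thesis using that by metis
    qed
    have "norm y \<le> (\<Sum>k\<in>UNIV. \<bar>y $ k\<bar>)" by (rule norm_le_l1_cart)
    also have "\<dots> \<le> real ?n * \<bar>y $ j\<bar>" using sum_bounded_above[of UNIV "\<lambda>k. \<bar>y $ k\<bar>", OF j] by simp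
    finally have ny: "norm y \<le> real ?n * \<bar>y $ j\<bar>" .
    have two: "(1 + x) ^ k \<le> 2 ^ k * (1 + x ^ k)" if "0 \<le> x" for x :: real and k
    proof (cases "x \<le> 1")
      case True
      then have "(1 + x) ^ k \<le> 2 ^ k" using that by (intro power_mono) auto
      also have "\<dots> \<le> 2 ^ k * (1 + x ^ k)" using that by simp
      finally show ?thesis .
    next
      case False
      then have "(1 + x) ^ k \<le> (2 * x) ^ k" by (intro power_mono) auto
      also have "\<dots> \<le> 2 ^ k * (1 + x ^ k)" by (simp add: power_mult_distrib)
      finally show ?thesis .
    qed
    have "(1 + (norm y)\<^sup>2) ^ ?n \<le> 2 ^ ?n * (1 + (norm y) ^ (2 * ?n))"
      using two[of "(norm y)\<^sup>2" ?n] by (simp add: power_mult)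
    also have "\<dots> \<le> 2 ^ ?n * (1 + ?c * \<bar>y $ j\<bar> ^ (2 * ?n))"
      using power_mono[OF ny, of "2 * ?n"] by (simp add: power_mult_distrib)
    finally have "norm (g y) * (1 + (norm y)\<^sup>2) ^ ?n \<le> norm (g y) * (2 ^ ?n * (1 + ?c * \<bar>y $ j\<bar> ^ (2 * ?n)))"
      by (intro mult_left_mono) auto
    also have "\<dots> = 2 ^ ?n * (norm (g y) + ?c * (\<bar>y $ j\<bar> ^ (2 * ?n) * norm (g y)))"
      by (simp add: algebra_simps)
    also have "\<dots> \<le> 2 ^ ?n * (C0 + ?c * C j)"
      by (intro mult_left_mono add_mono bd C) auto
    also have "\<dots> \<le> 2 ^ ?n * (C0 + ?c * (\<Sum>j\<in>UNIV. C j))"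
      by (intro mult_left_mono add_mono member_le_sum) (auto simp: Cj)
    finally show "norm (g y) * (1 + (norm y)\<^sup>2) ^ ?n \<le> 2 ^ ?n * (C0 + ?c * (\<Sum>j\<in>UNIV. C j))" .
  qed simp
qed

lemma sqrt_le_one_plus: "0 \<le> x \<Longrightarrow> sqrt x \<le> 1 + x" for x :: real
  by (rule real_le_lsqrt) (auto simp: power2_eq_square algebra_simps)

text \<open>The complex polynomials in the real coordinates, as the least class of functions with the closure
  properties used below: continuity, growth and differentiability all follow by rule induction.\<close>

inductive cpoly :: "(real ^ 'n::finite \<Rightarrow> complex) \<Rightarrow> bool" where
  cpoly_coord: "cpoly (\<lambda>z. complex_of_real (z $ k))"
| cpoly_const: "cpoly (\<lambda>_. c)"
| cpoly_add: "cpoly p \<Longrightarrow> cpoly q \<Longrightarrow> cpoly (\<lambda>z. p z + q z)"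
| cpoly_mult: "cpoly p \<Longrightarrow> cpoly q \<Longrightarrow> cpoly (\<lambda>z. p z * q z)"

lemma cpoly_minus: "cpoly p \<Longrightarrow> cpoly q \<Longrightarrow> cpoly (\<lambda>z. p z - q z)"
  using cpoly_add[OF _ cpoly_mult[OF cpoly_const[of "-1"]], of p q] by simp

lemma cpoly_power: "cpoly p \<Longrightarrow> cpoly (\<lambda>z. p z ^ n)"
  by (induction n) (auto intro: cpoly.intros)

lemma cpoly_sum: "(\<And>i. i \<in> I \<Longrightarrow> cpoly (p i)) \<Longrightarrow> cpoly (\<lambda>z. \<Sum>i\<in>I. p i z)"
  by (induction I rule: infinite_finite_induct) (auto intro: cpoly.intros)

lemma cpoly_prod: "(\<And>i. i \<in> I \<Longrightarrow> cpoly (p i)) \<Longrightarrow> cpoly (\<lambda>z. \<Prod>i\<in>I. p i z)"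
  by (induction I rule: infinite_finite_induct) (auto intro: cpoly.intros)

lemmas cpoly_intros = cpoly_coord cpoly_const cpoly_add cpoly_mult cpoly_minus cpoly_power cpoly_sum cpoly_prod

lemma cpoly_continuous: "cpoly p \<Longrightarrow> continuous_on S p"
  by (induction rule: cpoly.induct) (auto intro!: continuous_intros)

lemma cpoly_measurable: "cpoly p \<Longrightarrow> p \<in> borel_measurable borel"
  by (intro borel_measurable_continuous_onI cpoly_continuous)

lemma cpoly_growth: "cpoly p \<Longrightarrow> \<exists>C d. 0 \<le> C \<and> (\<forall>z. norm (p z) \<le> C * (1 + (norm z)\<^sup>2) ^ d)"
proof (induction rule: cpoly.induct)
  case (cpoly_coord k)
  have "norm (complex_of_real (z $ k)) \<le> 1 * (1 + (norm z)\<^sup>2) ^ 1" for z :: "real ^ 'a"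
    using component_le_norm_cart[of z k] sqrt_le_one_plus[of "(norm z)\<^sup>2"] by simp
  then show ?case by (metis zero_le_one)
next
  case (cpoly_const c)
  show ?case by (rule exI[of _ "norm c"], rule exI[of _ 0]) simp
next
  case (cpoly_add p q)
  then obtain C d C' d' where 1: "0 \<le> C" "\<And>z. norm (p z) \<le> C * (1 + (norm z)\<^sup>2) ^ d"
    and 2: "0 \<le> C'" "\<And>z. norm (q z) \<le> C' * (1 + (norm z)\<^sup>2) ^ d'" by blast
  have "norm (p z + q z) \<le> (C + C') * (1 + (norm z)\<^sup>2) ^ (max d d')" for z
  proof -
    have "norm (p z + q z) \<le> norm (p z) + norm (q z)" by (rule norm_triangle_ineq)
    also have "\<dots> \<le> C * (1 + (norm z)\<^sup>2) ^ (max d d') + C' * (1 + (norm z)\<^sup>2) ^ (max d d')"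
      by (intro add_mono order_trans[OF 1(2)] order_trans[OF 2(2)] mult_left_mono power_increasing 1 2) auto
    finally show ?thesis by (simp add: algebra_simps)
  qed
  then show ?case using 1 2 by (metis add_nonneg_nonneg)
next
  case (cpoly_mult p q)
  then obtain C d C' d' where 1: "0 \<le> C" "\<And>z. norm (p z) \<le> C * (1 + (norm z)\<^sup>2) ^ d"
    and 2: "0 \<le> C'" "\<And>z. norm (q z) \<le> C' * (1 + (norm z)\<^sup>2) ^ d'" by blast
  have "norm (p z * q z) \<le> (C * C') * (1 + (norm z)\<^sup>2) ^ (d + d')" for z
    using mult_mono[OF 1(2)[of z] 2(2)[of z]] 1(1)
    by (simp add: norm_mult power_add algebra_simps)
  then show ?case using 1 2 by (metis mult_nonneg_nonneg)
qed

lemma cpoly_partial: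
  "cpoly p \<Longrightarrow> \<exists>p'. cpoly p' \<and> (\<forall>z. ((\<lambda>t. p (z + t *\<^sub>R axis k 1)) has_vector_derivative p' z) (at 0))"
proof (induction rule: cpoly.induct)
  case (cpoly_coord j)
  have "((\<lambda>t. complex_of_real ((z + t *\<^sub>R axis k 1) $ j)) has_vector_derivative (if j = k then 1 else 0)) (at 0)"
    for z :: "real ^ 'a"
  proof -
    have eq: "(\<lambda>t. complex_of_real ((z + t *\<^sub>R axis k 1) $ j)) =
        (\<lambda>t. complex_of_real (z $ j) + t *\<^sub>R (if j = k then 1 else 0))"
      by (rule ext) (simp add: axis_nth' scaleR_conv_of_real[where 'a=complex])
    have "((\<lambda>t. a + t *\<^sub>R c) has_vector_derivative c) (at 0)" for a c :: complex
      unfolding has_vector_derivative_def by (auto intro!: derivative_eq_intros)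
    then show ?thesis unfolding eq .
  qed
  then show ?case by (intro exI[of _ "\<lambda>_. if j = k then 1 else 0"] conjI allI cpoly.cpoly_const)
next
  case (cpoly_const c)
  have "((\<lambda>t. c) has_vector_derivative 0) (at 0)" by simp
  then show ?case by (intro exI[of _ "\<lambda>_. 0"] conjI allI cpoly.cpoly_const)
next
  case (cpoly_add p q)
  then obtain p' q' where "cpoly p'" "cpoly q'"
    and d: "\<And>z. ((\<lambda>t. p (z + t *\<^sub>R axis k 1)) has_vector_derivative p' z) (at 0)"
      "\<And>z. ((\<lambda>t. q (z + t *\<^sub>R axis k 1)) has_vector_derivative q' z) (at 0)" by blast
  then have "cpoly (\<lambda>z. p' z + q' z)" by (intro cpoly.intros)
  then show ?case
    by (intro exI[of _ "\<lambda>z. p' z + q' z"] conjI allI has_vector_derivative_add d)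
next
  case (cpoly_mult p q)
  then obtain p' q' where c: "cpoly p'" "cpoly q'"
    and d: "\<And>z. ((\<lambda>t. p (z + t *\<^sub>R axis k 1)) has_vector_derivative p' z) (at 0)"
      "\<And>z. ((\<lambda>t. q (z + t *\<^sub>R axis k 1)) has_vector_derivative q' z) (at 0)" by blast
  have "cpoly (\<lambda>z. p z * q' z + p' z * q z)"
    using c cpoly_mult.hyps by (intro cpoly.intros)
  moreover have "((\<lambda>t. p (z + t *\<^sub>R axis k 1) * q (z + t *\<^sub>R axis k 1)) has_vector_derivative p z * q' z + p' z * q z) (at 0)" for z
    using has_vector_derivative_mult[OF d, of z z] by simp
  ultimately show ?case by (intro exI[of _ "\<lambda>z. p z * q' z + p' z * q z"]) simp
qed

section \<open>The gauge and its anisotropic dilations\<close>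

text \<open>The one-parameter group for which \<^const>\<open>sigma\<close> is homogeneous of degree 2 and the symbol of the
  operator is homogeneous of degree 1.\<close>

definition dilate :: "('n::finite \<Rightarrow> nat) \<Rightarrow> real \<Rightarrow> real ^ 'n \<Rightarrow> real ^ 'n" where
  "dilate ls c = stretch (\<lambda>k. c powr (1 / real (ls k)))"

lemma dilate_nth: "dilate ls c z $ k = c powr (1 / real (ls k)) * z $ k"
  by (simp add: dilate_def)

lemma measurable_dilate [measurable]: "dilate ls c \<in> borel_measurable borel"
  by (simp add: dilate_def)

lemma dilate_eq_0_iff: "c > 0 \<Longrightarrow> dilate ls c z = 0 \<longleftrightarrow> z = 0"
  by (simp add: vec_eq_iff dilate_nth)

lemma dilate_dilate_inverse: "c > 0 \<Longrightarrow> dilate ls c (dilate ls (1 / c) z) = z"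
  by (simp add: vec_eq_iff dilate_nth powr_divide)

lemma inner_dilate: "y \<bullet> dilate ls c z = dilate ls c y \<bullet> z"
  by (simp add: inner_vec_def dilate_nth algebra_simps)

lemma prod_dilate_factors:
  "c > 0 \<Longrightarrow> (\<Prod>k\<in>UNIV. c powr (1 / real (ls k))) = c powr (\<Sum>k\<in>UNIV. 1 / real (ls k))"
  by (simp add: powr_sum)

lemma integral_dilate:
  fixes f :: "real ^ 'n::finite \<Rightarrow> 'b::{banach, second_countable_topology}"
  assumes "f \<in> borel_measurable borel" and "c > 0"
  shows "(LINT x|lborel. f x) = c powr (\<Sum>k\<in>UNIV. 1 / real (ls k)) *\<^sub>R (LINT x|lborel. f (dilate ls c x))"
  unfolding dilate_def prod_dilate_factors[OF assms(2), symmetric]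
  by (rule integral_stretch) (use assms in auto)

lemma nn_integral_dilate:
  assumes "f \<in> borel_measurable borel" and "c > 0"
  shows "(\<integral>\<^sup>+x. f x \<partial>lborel) = ennreal (c powr (\<Sum>k\<in>UNIV. 1 / real (ls k))) * (\<integral>\<^sup>+x. f (dilate ls c x) \<partial>lborel)"
  unfolding dilate_def prod_dilate_factors[OF assms(2), symmetric]
  by (rule nn_integral_stretch) (use assms in auto)

lemma sigma_nonneg [simp]: "0 \<le> sigma ls z"
  unfolding sigma_def by (intro sum_nonneg) (simp add: zero_le_even_power)

lemma sigma_cpoly: "cpoly (\<lambda>z. complex_of_real (sigma ls z))"
  unfolding sigma_def of_real_sum of_real_power by (intro cpoly_intros)

lemma continuous_on_sigma [continuous_intros]: "continuous_on S (sigma ls)"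
  unfolding sigma_def[abs_def] by (intro continuous_intros)

lemma measurable_sigma [measurable]: "sigma ls \<in> borel_measurable borel"
  by (intro borel_measurable_continuous_onI continuous_on_sigma)

lemma sigma_0: "(\<And>k. 0 < ls k) \<Longrightarrow> sigma ls 0 = 0"
  unfolding sigma_def by (intro sum.neutral) auto

lemma sigma_pos:
  assumes "z \<noteq> 0"
  shows "0 < sigma ls z"
proof -
  obtain k where "z $ k \<noteq> 0" using assms by (auto simp: vec_eq_iff)
  then have "0 < (z $ k) ^ (2 * ls k)" by (simp add: zero_less_power_eq)
  also have "\<dots> \<le> sigma ls z"
    unfolding sigma_def by (rule member_le_sum) (auto simp: zero_le_even_power)
  finally show ?thesis .
qed

lemma sigma_dilate:
  assumes "\<And>k. 0 < ls k" and "c > 0"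
  shows "sigma ls (dilate ls c z) = c\<^sup>2 * sigma ls z"
proof -
  have "(c powr (1 / real (ls k))) ^ (2 * ls k) = c\<^sup>2" for k
  proof -
    have "(c powr (1 / real (ls k))) ^ (2 * ls k) = c powr (1 / real (ls k) * real (2 * ls k))"
      using assms(2) by (subst powr_realpow[symmetric]) (auto simp: powr_powr)
    also have "\<dots> = c powr 2" using assms(1)[of k] by simp
    finally show ?thesis using assms(2) by simp
  qed
  then show ?thesis by (simp add: sigma_def dilate_nth power_mult_distrib sum_distrib_left)
qed

text \<open>A coordinate of modulus at most 1 contributes at most 1 to the left side, and the square of a larger
  one is at most its even power in the gauge.\<close>

lemma norm_square_le_sigma:
  fixes z :: "real ^ 'n::finite"
  assumes "\<And>k. 0 < ls k"
  shows "(norm z)\<^sup>2 \<le> real CARD('n) + sigma ls z"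
proof -
  have "(z $ k)\<^sup>2 \<le> 1 + (z $ k) ^ (2 * ls k)" for k
  proof (cases "\<bar>z $ k\<bar> \<le> 1")
    case True
    then have "(z $ k)\<^sup>2 \<le> 1" by (simp add: abs_square_le_1)
    then show ?thesis by (simp add: add_increasing2 zero_le_even_power)
  next
    case False
    then have "\<bar>z $ k\<bar> ^ 2 \<le> \<bar>z $ k\<bar> ^ (2 * ls k)"
      using assms[of k] by (intro power_increasing) auto
    then show ?thesis by (simp add: power_even_abs)
  qed
  then have "(\<Sum>k\<in>UNIV. (z $ k)\<^sup>2) \<le> (\<Sum>k\<in>UNIV. 1 + (z $ k) ^ (2 * ls k))" by (intro sum_mono)
  also have "\<dots> = real CARD('n) + sigma ls z" by (simp add: sum.distrib sigma_def)
  finally show ?thesis by (simp add: norm_vec_def L2_set_def sum_nonneg)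
qed

text \<open>With \<open>u = 1 + (norm z)\<^sup>2\<close>, the inequality \<open>(t u / d) ^ d \<le> exp (t u)\<close> beats any power of \<open>u\<close>, and
  \<open>u\<close> exceeds the gauge by at most a constant.\<close>

lemma exp_sigma_decay:
  fixes ls :: "'n::finite \<Rightarrow> nat"
  assumes ls: "\<And>k. 0 < ls k" and t: "0 < t"
  shows "\<exists>C. \<forall>z :: real ^ 'n. (1 + (norm z)\<^sup>2) ^ d * exp (- t * sigma ls z) \<le> C"
proof (cases "d = 0")
  case True
  then show ?thesis using t by (intro exI[of _ 1]) auto
next
  case False
  let ?n = "real CARD('n)"
  let ?C = "(real d / t) ^ d * exp (t * (?n + 1))"
  have "(1 + (norm z)\<^sup>2) ^ d * exp (- t * sigma ls z) \<le> ?C" for z :: "real ^ 'n"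
  proof -
    let ?u = "1 + (norm z)\<^sup>2"
    have u: "?u \<le> ?n + 1 + sigma ls z" using norm_square_le_sigma[of ls z, OF ls] by simp
    have "(t * ?u / real d) ^ d \<le> (1 + t * ?u / real d) ^ d"
      using t by (intro power_mono) (auto intro!: divide_nonneg_nonneg mult_nonneg_nonneg add_nonneg_nonneg)
    also have "\<dots> \<le> exp (t * ?u)"
      using t False by (intro exp_ge_one_plus_x_over_n_power_n) (auto intro: order_trans[of _ 0])
    also have "\<dots> \<le> exp (t * (?n + 1 + sigma ls z))" using t u by simp
    also have "\<dots> = exp (t * (?n + 1)) * exp (t * sigma ls z)" by (simp add: distrib_left exp_add mult.assoc)
    finally have 1: "(t * ?u / real d) ^ d \<le> exp (t * (?n + 1)) * exp (t * sigma ls z)" .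
    have "?u ^ d = (real d / t) ^ d * (t * ?u / real d) ^ d"
      using t False by (simp add: power_mult_distrib[symmetric])
    also have "\<dots> \<le> (real d / t) ^ d * (exp (t * (?n + 1)) * exp (t * sigma ls z))"
      using t 1 by (intro mult_left_mono) auto
    finally have "?u ^ d * exp (- t * sigma ls z)
        \<le> (real d / t) ^ d * (exp (t * (?n + 1)) * exp (t * sigma ls z)) * exp (- t * sigma ls z)"
      by (intro mult_right_mono) auto
    also have "\<dots> = ?C" by (simp add: exp_minus)
    finally show ?thesis .
  qed
  then show ?thesis by blast
qed

lemma integrable_exp_sigma:
  fixes h :: "real ^ 'n::finite \<Rightarrow> 'b::{banach, second_countable_topology}"
  assumes ls: "\<And>k. 0 < ls k" and t: "0 < t"
    and [measurable]: "h \<in> borel_measurable borel"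
    and bd: "\<And>z. norm (h z) \<le> C * (1 + (norm z)\<^sup>2) ^ d * exp (- t * sigma ls z)" and "0 \<le> C"
  shows "integrable lborel h"
proof -
  obtain K where K: "\<And>z :: real ^ 'n. (1 + (norm z)\<^sup>2) ^ (d + CARD('n)) * exp (- t * sigma ls z) \<le> K"
    using exp_sigma_decay[of ls t, OF ls t, of "d + CARD('n)"] by blast
  show ?thesis
  proof (rule integrable_polynomial_decay)
    fix z :: "real ^ 'n"
    have "norm (h z) * (1 + (norm z)\<^sup>2) ^ CARD('n)
        \<le> (C * (1 + (norm z)\<^sup>2) ^ d * exp (- t * sigma ls z)) * (1 + (norm z)\<^sup>2) ^ CARD('n)"
      by (intro mult_right_mono bd) auto
    also have "\<dots> = C * ((1 + (norm z)\<^sup>2) ^ (d + CARD('n)) * exp (- t * sigma ls z))"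
      by (simp add: power_add algebra_simps)
    also have "\<dots> \<le> C * K" using K \<open>0 \<le> C\<close> by (intro mult_left_mono)
    finally show "norm (h z) * (1 + (norm z)\<^sup>2) ^ CARD('n) \<le> C * K" .
  qed simp
qed

text \<open>Anisotropic polar coordinates: homogeneity reduces estimates away from the origin to the compact
  unit sphere of the gauge.\<close>

lemma sphere_decomposition:
  fixes z :: "real ^ 'n::finite"
  assumes ls: "\<And>k. 0 < ls k" and "z \<noteq> 0"
  obtains w where "sigma ls w = 1" "z = dilate ls (sqrt (sigma ls z)) w" "w \<noteq> 0"
proof -
  let ?c = "sqrt (sigma ls z)"
  have c: "0 < ?c" using sigma_pos[OF assms(2)] by simp
  show ?thesis
  proof (rule that[of "dilate ls (1 / ?c) z"])
    have "sigma ls (dilate ls (1 / ?c) z) = (1 / ?c)\<^sup>2 * sigma ls z"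
      by (rule sigma_dilate[OF ls]) (use c in simp)
    then show "sigma ls (dilate ls (1 / ?c) z) = 1" using c by (simp add: power_divide)
    show "z = dilate ls ?c (dilate ls (1 / ?c) z)" using c by (simp add: dilate_dilate_inverse)
    show "dilate ls (1 / ?c) z \<noteq> 0" using c assms(2) by (simp add: dilate_eq_0_iff)
  qed
qed

lemma compact_sigma_sphere:
  fixes ls :: "'n::finite \<Rightarrow> nat"
  assumes ls: "\<And>k. 0 < ls k"
  shows "compact {w :: real ^ 'n. sigma ls w = 1}"
  unfolding compact_eq_bounded_closed
proof
  show "closed {w :: real ^ 'n. sigma ls w = 1}"
    by (intro closed_Collect_eq continuous_intros)
  have "norm w \<le> real CARD('n) + 1" if "sigma ls w = 1" for w :: "real ^ 'n"
  proof -
    have "(norm w)\<^sup>2 \<le> real CARD('n) + 1" using norm_square_le_sigma[of ls w, OF ls] that by simp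
    also have "\<dots> \<le> (real CARD('n) + 1)\<^sup>2" by (simp add: power2_eq_square)
    finally show ?thesis by (rule power2_le_imp_le) simp
  qed
  then show "bounded {w :: real ^ 'n. sigma ls w = 1}" by (auto simp: bounded_iff)
qed

text \<open>The model is \<open>D = det L\<close> for the symbol \<open>L\<close> of an \<open>m\<close> by \<open>m\<close> semielliptic system: each row of the
  matrix contributes one to the degree of homogeneity.\<close>

locale quasihomogeneous =
  fixes ls :: "'n::finite \<Rightarrow> nat" and D :: "real ^ 'n \<Rightarrow> complex" and m :: nat
  assumes ls_pos: "\<And>k. 0 < ls k"
    and cpoly_D: "cpoly D"
    and D_nonzero: "\<And>z. z \<noteq> 0 \<Longrightarrow> D z \<noteq> 0"
    and D_dilate: "\<And>c z. c > 0 \<Longrightarrow> D (dilate ls c z) = of_real (c ^ m) * D z"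
begin

lemma D_lower_bound: "\<exists>c0>0. \<forall>z. z \<noteq> 0 \<longrightarrow> c0 * sqrt (sigma ls z) ^ m \<le> norm (D z)"
proof -
  let ?S = "{w :: real ^ 'n. sigma ls w = 1}"
  have "axis undefined 1 \<noteq> (0 :: real ^ 'n)" by simp
  then obtain w1 :: "real ^ 'n" where "sigma ls w1 = 1"
    "axis undefined 1 = dilate ls (sqrt (sigma ls (axis undefined 1))) w1" "w1 \<noteq> 0"
    by (rule sphere_decomposition[OF ls_pos])
  then have "?S \<noteq> {}" by auto
  moreover have "continuous_on ?S (\<lambda>w. norm (D w))"
    by (intro continuous_intros cpoly_continuous cpoly_D)
  ultimately have "\<exists>w0\<in>?S. \<forall>w\<in>?S. norm (D w0) \<le> norm (D w)"
    by (intro continuous_attains_inf compact_sigma_sphere ls_pos)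
  then obtain w0 where w0: "w0 \<in> ?S" "\<And>w. w \<in> ?S \<Longrightarrow> norm (D w0) \<le> norm (D w)" by blast
  show ?thesis
  proof (intro exI[of _ "norm (D w0)"] conjI allI impI)
    have "w0 \<noteq> 0" using w0(1) sigma_0[of ls] ls_pos by auto
    then show "0 < norm (D w0)" using D_nonzero by simp
    fix z :: "real ^ 'n" assume z: "z \<noteq> 0"
    obtain w where w: "sigma ls w = 1" "z = dilate ls (sqrt (sigma ls z)) w" "w \<noteq> 0"
      by (rule sphere_decomposition[OF ls_pos z])
    have "norm (D z) = sqrt (sigma ls z) ^ m * norm (D w)"
      using sigma_pos[OF z, of ls] by (subst w(2), subst D_dilate) (auto simp: norm_mult norm_power)
    then show "norm (D w0) * sqrt (sigma ls z) ^ m \<le> norm (D z)"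
      using w0(2)[of w] w(1) by (simp add: mult.commute[of "sqrt _ ^ m"] mult_right_mono)
  qed
qed

text \<open>Away from the origin this class of functions is closed under partial differentiation, see \<open>quot_partial\<close>.\<close>

definition quot :: "(real ^ 'n \<Rightarrow> complex) \<Rightarrow> nat \<Rightarrow> nat \<Rightarrow> real ^ 'n \<Rightarrow> complex" where
  "quot P a b z = P z * of_real (sigma ls z) ^ a * exp (- of_real (sigma ls z)) / D z ^ b"

text \<open>In terms of \<open>s = sqrt \<sigma>\<close> the lower bound for \<open>D\<close> gives a factor \<open>s ^ (2 a - m b)\<close>.  One factor \<open>s\<close> is
  kept to show vanishing at the origin; the others are absorbed in the polynomial growth.\<close>

lemma quot_bound:
  assumes P: "cpoly P" and ab: "m * b + 1 \<le> 2 * a"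
  shows "\<exists>C d. 0 \<le> C \<and> (\<forall>z. norm (quot P a b z) \<le> C * (1 + (norm z)\<^sup>2) ^ d * exp (- sigma ls z) * sqrt (sigma ls z))"
proof -
  obtain c0 where c0: "c0 > 0" "\<And>z. z \<noteq> 0 \<Longrightarrow> c0 * sqrt (sigma ls z) ^ m \<le> norm (D z)"
    using D_lower_bound by blast
  \<comment> \<open>The excess of the order of vanishing over the one factor \<open>s\<close> that is kept.\<close>
  define r where "r = 2 * a - m * b - 1"
  have r: "2 * a = m * b + Suc r" using ab by (simp add: r_def)
  have "cpoly (\<lambda>z. P z * (1 + complex_of_real (sigma ls z)) ^ r)"
    by (intro cpoly_intros P sigma_cpoly)
  from cpoly_growth[OF this] obtain C d where C: "0 \<le> C"
    "\<And>z. norm (P z * (1 + complex_of_real (sigma ls z)) ^ r) \<le> C * (1 + (norm z)\<^sup>2) ^ d" by blast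
  have "norm (quot P a b z) \<le> C / c0 ^ b * (1 + (norm z)\<^sup>2) ^ d * exp (- sigma ls z) * sqrt (sigma ls z)" for z
  proof (cases "z = 0")
    case True
    have "a \<noteq> 0" using ab by auto
    then show ?thesis using True sigma_0[of ls] ls_pos by (simp add: quot_def)
  next
    case False
    define s where "s = sqrt (sigma ls z)"
    have s: "0 < s" "sigma ls z = s\<^sup>2" using sigma_pos[OF False, of ls] by (simp_all add: s_def)
    have "s \<le> 1 + s\<^sup>2" using sqrt_le_one_plus[of "s\<^sup>2"] s(1) by simp
    then have sr: "s ^ r \<le> (1 + s\<^sup>2) ^ r" using s by (intro power_mono) auto
    have nP: "norm (P z) * (1 + s\<^sup>2) ^ r \<le> C * (1 + (norm z)\<^sup>2) ^ d"
    proof -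
      have "norm (1 + complex_of_real (sigma ls z)) = 1 + s\<^sup>2"
        unfolding s(2) by (metis abs_of_nonneg add_nonneg_nonneg norm_of_real of_real_1 of_real_add zero_le_one zero_le_power2)
      then show ?thesis using C(2)[of z] by (simp add: norm_mult norm_power)
    qed
    have "norm (quot P a b z) = norm (P z) * s ^ (2 * a) * exp (- sigma ls z) / norm (D z) ^ b"
      by (simp add: quot_def norm_mult norm_divide norm_power s(2) power_mult)
    also have "\<dots> \<le> norm (P z) * s ^ (2 * a) * exp (- sigma ls z) / (c0 * s ^ m) ^ b"
      using c0(2)[OF False] c0(1) s(1)
      by (intro divide_left_mono power_mono mult_pos_pos) (auto simp: s_def[symmetric] D_nonzero False)
    also have "\<dots> = norm (P z) * s ^ r * exp (- sigma ls z) * s / c0 ^ b"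
      unfolding r using s(1) c0(1) by (simp add: power_add power_mult power_mult_distrib)
    also have "\<dots> \<le> norm (P z) * (1 + s\<^sup>2) ^ r * exp (- sigma ls z) * s / c0 ^ b"
      using sr s(1) c0(1) by (intro divide_right_mono mult_right_mono mult_left_mono) auto
    also have "\<dots> \<le> C * (1 + (norm z)\<^sup>2) ^ d * exp (- sigma ls z) * s / c0 ^ b"
      using nP s(1) c0(1) by (intro divide_right_mono mult_right_mono) auto
    finally show ?thesis by (simp add: s_def)
  qed
  then show ?thesis using C(1) c0(1) by (intro exI[of _ "C / c0 ^ b"] exI[of _ d]) auto
qed

lemma quot_measurable: "cpoly P \<Longrightarrow> quot P a b \<in> borel_measurable borel"
proof -
  assume "cpoly P"
  then have [measurable]: "P \<in> borel_measurable borel" "D \<in> borel_measurable borel"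
    using cpoly_D by (auto intro: cpoly_measurable)
  show ?thesis unfolding quot_def[abs_def] by measurable
qed

lemma quot_integrable:
  assumes P: "cpoly P" and ab: "m * b + 1 \<le> 2 * a"
  shows "integrable lborel (quot P a b)"
proof -
  obtain C d where C: "0 \<le> C"
    "\<And>z. norm (quot P a b z) \<le> C * (1 + (norm z)\<^sup>2) ^ d * exp (- sigma ls z) * sqrt (sigma ls z)"
    using quot_bound[OF P ab] by blast
  obtain C' d' where C': "0 \<le> C'"
    "\<And>z. norm (1 + complex_of_real (sigma ls z)) \<le> C' * (1 + (norm z)\<^sup>2) ^ d'"
    using cpoly_growth[OF cpoly_add[OF cpoly_const sigma_cpoly]] by blast
  show ?thesis
  proof (rule integrable_exp_sigma[OF ls_pos zero_less_one quot_measurable[OF P]])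
    fix z :: "real ^ 'n"
    have "sqrt (sigma ls z) \<le> 1 + sigma ls z" by (rule sqrt_le_one_plus) simp
    also have "\<dots> = norm (1 + complex_of_real (sigma ls z))"
      by (metis abs_of_nonneg add_nonneg_nonneg norm_of_real of_real_1 of_real_add zero_le_one sigma_nonneg)
    also have "\<dots> \<le> C' * (1 + (norm z)\<^sup>2) ^ d'" by (rule C')
    finally have "C * (1 + (norm z)\<^sup>2) ^ d * exp (- sigma ls z) * sqrt (sigma ls z)
        \<le> C * (1 + (norm z)\<^sup>2) ^ d * exp (- sigma ls z) * (C' * (1 + (norm z)\<^sup>2) ^ d')"
      using C(1) by (intro mult_left_mono) auto
    then show "norm (quot P a b z) \<le> (C * C') * (1 + (norm z)\<^sup>2) ^ (d + d') * exp (- 1 * sigma ls z)"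
      using C(2)[of z] by (simp add: power_add algebra_simps)
  qed (use C C' in simp)
qed

lemma quot_continuous:
  assumes P: "cpoly P" and ab: "m * b + 1 \<le> 2 * a"
  shows "continuous_on UNIV (quot P a b)"
proof (rule continuous_at_imp_continuous_on, rule ballI)
  fix z :: "real ^ 'n"
  show "isCont (quot P a b) z"
  proof (cases "z = 0")
    case False
    have *: "continuous_on (- {0}) (quot P a b)"
      unfolding quot_def[abs_def]
      by (intro continuous_intros cpoly_continuous cpoly_D P sigma_cpoly) (auto simp: D_nonzero)
    show ?thesis
      using continuous_on_eq_continuous_at[of "- {0}" "quot P a b"] * False by (simp add: open_Compl)
  next
    case True
    obtain C d where C: "0 \<le> C"
      "\<And>z. norm (quot P a b z) \<le> C * (1 + (norm z)\<^sup>2) ^ d * exp (- sigma ls z) * sqrt (sigma ls z)"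
      using quot_bound[OF P ab] by blast
    let ?B = "\<lambda>z :: real ^ 'n. C * (1 + (norm z)\<^sup>2) ^ d * exp (- sigma ls z) * sqrt (sigma ls z)"
    have "continuous_on UNIV ?B" by (intro continuous_intros)
    then have "isCont ?B 0" by (rule continuous_on_interior) simp
    then have "(?B \<longlongrightarrow> ?B 0) (at 0)" by (simp add: isCont_def)
    then have "(?B \<longlongrightarrow> 0) (at 0)" using sigma_0[of ls] ls_pos by simp
    then have "(quot P a b \<longlongrightarrow> 0) (at 0)"
      by (rule Lim_null_comparison[rotated]) (simp add: C)
    moreover have "quot P a b 0 = 0" using C(2)[of 0] sigma_0[of ls] ls_pos by simp
    ultimately show ?thesis using True by (simp add: isCont_def)
  qed
qed

text \<open>Every derivative of \<open>\<sigma> ^ a\<close> or \<open>1 / D ^ b\<close> costs at most one power of \<open>\<sigma>\<close> in the numerator and one more of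
  \<open>D\<close> in the denominator; all remaining factors are polynomials.\<close>

lemma quot_partial:
  assumes P: "cpoly P"
  obtains P' where "cpoly P'"
    "\<And>z. z \<noteq> 0 \<Longrightarrow> ((\<lambda>t. quot P (Suc a) b (z + t *\<^sub>R axis k 1)) has_vector_derivative quot P' a (Suc b) z) (at 0)"
proof -
  obtain S' where S': "cpoly S'" "\<And>z. ((\<lambda>t. complex_of_real (sigma ls (z + t *\<^sub>R axis k 1))) has_vector_derivative S' z) (at 0)"
    using cpoly_partial[OF sigma_cpoly] by blast
  obtain D' where D': "cpoly D'" "\<And>z. ((\<lambda>t. D (z + t *\<^sub>R axis k 1)) has_vector_derivative D' z) (at 0)"
    using cpoly_partial[OF cpoly_D] by blast
  obtain Q where Q: "cpoly Q" "\<And>z. ((\<lambda>t. P (z + t *\<^sub>R axis k 1)) has_vector_derivative Q z) (at 0)"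
    using cpoly_partial[OF P] by blast
  let ?S = "\<lambda>z. complex_of_real (sigma ls z)"
  define P' where "P' = (\<lambda>z. (Q z * ?S z + of_nat (Suc a) * P z * S' z - P z * S' z * ?S z) * D z
      - of_nat b * P z * ?S z * D' z)"
  have "cpoly P'" unfolding P'_def by (intro cpoly_intros P S' D' Q sigma_cpoly cpoly_D)
  moreover have "((\<lambda>t. quot P (Suc a) b (z + t *\<^sub>R axis k 1)) has_vector_derivative quot P' a (Suc b) z) (at 0)"
    if z: "z \<noteq> 0" for z
  proof -
    let ?z = "\<lambda>t. z + t *\<^sub>R axis k 1"
    have pow: "((\<lambda>t. f t ^ j) has_vector_derivative (of_nat j * f' * f x ^ (j - 1))) (at x)"
      if "(f has_vector_derivative f') (at x)" for f :: "real \<Rightarrow> complex" and f' x j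
    proof -
      have "((\<lambda>w. w ^ j) has_field_derivative of_nat j * f x ^ (j - 1)) (at (f x))"
        using DERIV_power[OF DERIV_ident[of "at (f x)"], of j] by simp
      from field_vector_diff_chain_at[OF that this] show ?thesis by (simp add: o_def mult_ac)
    qed
    have Dz: "D z \<noteq> 0" by (rule D_nonzero[OF z])
    have inv: "((\<lambda>t. inverse (D (?z t))) has_vector_derivative - D' z / (D z)\<^sup>2) (at 0)"
    proof -
      have "(inverse has_field_derivative - (inverse (D z) ^ 2)) (at (D (z + 0 *\<^sub>R axis k 1)))"
        using DERIV_inverse[OF Dz] by (simp add: numeral_2_eq_2)
      from field_vector_diff_chain_at[OF D'(2)[of z] this] show ?thesis
        by (simp add: o_def field_simps)
    qed
    have e: "((\<lambda>t. exp (- ?S (?z t))) has_vector_derivative - S' z * exp (- ?S z)) (at 0)"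
      using has_vector_derivative_exp[OF has_vector_derivative_minus[OF S'(2)[of z]]] by simp
    note d = has_vector_derivative_mult[OF has_vector_derivative_mult[OF has_vector_derivative_mult[OF
      Q(2)[of z] pow[OF S'(2)[of z], of "Suc a"]] e] pow[OF inv, of b]]
    have "quot P (Suc a) b (?z t) = P (?z t) * ?S (?z t) ^ Suc a * exp (- ?S (?z t)) * inverse (D (?z t)) ^ b" for t
      by (simp add: quot_def field_simps)
    moreover have "quot P' a (Suc b) z = P (?z 0) * ?S (?z 0) ^ Suc a * exp (- ?S (?z 0)) *
          (of_nat b * (- D' z / (D z)\<^sup>2) * inverse (D (?z 0)) ^ (b - 1)) +
        (P (?z 0) * ?S (?z 0) ^ Suc a * (- S' z * exp (- ?S z)) +
         (P (?z 0) * (of_nat (Suc a) * S' z * ?S (?z 0) ^ (Suc a - 1)) + Q z * ?S (?z 0) ^ Suc a) * exp (- ?S (?z 0))) *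
        inverse (D (?z 0)) ^ b"
      using Dz by (cases b) (simp_all add: quot_def P'_def field_simps power2_eq_square)
    ultimately show ?thesis using d by simp
  qed
  ultimately show ?thesis by (rule that)
qed

text \<open>Each integration by parts lowers \<open>2 a - m b\<close>, the order of vanishing at the origin, by \<open>m + 2\<close>; the
  hypothesis leaves at least 1 after \<open>r\<close> steps, which continuity and integrability require.\<close>

lemma quot_fourier_decay:
  assumes "cpoly P" and "m * b + 1 + r * (m + 2) \<le> 2 * a"
  shows "\<exists>C. \<forall>y. \<bar>y $ k\<bar> ^ r * norm (fourier (quot P a b) y) \<le> C"
  using assms
proof (induction r arbitrary: P a b)
  case 0
  then have "integrable lborel (quot P a b)" by (intro quot_integrable) auto
  then show ?case using norm_fourier_le by fastforce
next
  case (Suc r)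
  then obtain a' where a: "a = Suc a'" by (cases a) auto
  obtain P' where P': "cpoly P'"
    "\<And>z. z \<noteq> 0 \<Longrightarrow> ((\<lambda>t. quot P (Suc a') b (z + t *\<^sub>R axis k 1)) has_vector_derivative quot P' a' (Suc b) z) (at 0)"
    using quot_partial[OF Suc.prems(1)] by metis
  have le: "m * Suc b + 1 + r * (m + 2) \<le> 2 * a'" "m * b + 1 \<le> 2 * Suc a'" "m * Suc b + 1 \<le> 2 * a'"
    using Suc.prems(2) a by (auto simp: algebra_simps)
  obtain C where C: "\<And>y. \<bar>y $ k\<bar> ^ r * norm (fourier (quot P' a' (Suc b)) y) \<le> C"
    using Suc.IH[OF P'(1) le(1)] by blast
  have "fourier (quot P' a' (Suc b)) y = - (\<i> * complex_of_real (y $ k) * fourier (quot P (Suc a') b) y)" for y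
    using Suc.prems(1) P' le
    by (intro fourier_partial quot_continuous quot_integrable) auto
  then have "\<bar>y $ k\<bar> ^ Suc r * norm (fourier (quot P a b) y) \<le> C" for y
    using C[of y] by (simp add: a norm_mult mult_ac)
  then show ?case by blast
qed

lemma fourier_quot_integrable:
  assumes P: "cpoly P" and "m * b + 1 + 2 * CARD('n) * (m + 2) \<le> 2 * a"
  shows "integrable lborel (fourier (quot P a b))"
proof (rule integrable_coordinate_decay)
  show "fourier (quot P a b) \<in> borel_measurable borel"
    using quot_measurable[OF P] by (rule measurable_fourier)
  show "norm (fourier (quot P a b) y) \<le> (LINT z|lborel. norm (quot P a b z))" for y
    using assms by (intro norm_fourier_le quot_integrable) auto
  show "\<exists>C. \<forall>y. \<bar>y $ j\<bar> ^ (2 * CARD('n)) * norm (fourier (quot P a b) y) \<le> C" for j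
    by (rule quot_fourier_decay[OF assms])
qed

end

section \<open>Integrability of the heat kernels\<close>

text \<open>Used with \<open>r = \<sigma>(z)\<close> to integrate in time, for \<open>a = 1\<close> and \<open>a = 0\<close>.\<close>

lemma has_bochner_integral_exp_tail:
  assumes "0 < r"
  shows "has_bochner_integral lborel (\<lambda>s::real. indicator {a..} s * exp (- s * r)) (exp (- a * r) / r)"
proof (rule has_bochner_integral_nn_integral)
  have "((\<lambda>s. exp (- r * s)) has_integral exp (- r * a) / r) {a..}"
    by (rule has_integral_exp_minus_to_infinity[OF assms])
  from nn_integral_has_integral_lebesgue[OF _ this]
  show "(\<integral>\<^sup>+s. ennreal (indicator {a..} s * exp (- s * r)) \<partial>lborel) = ennreal (exp (- a * r) / r)"
    by (simp add: mult.commute)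
qed (use assms in auto)

lemma norm_integral_le_nn_integral:
  fixes f :: "'a \<Rightarrow> 'b::{banach, second_countable_topology}"
  shows "ennreal (norm (LINT x|M. f x)) \<le> (\<integral>\<^sup>+x. ennreal (norm (f x)) \<partial>M)"
  by (cases "integrable M f") (auto intro: integral_norm_bound_ennreal simp: not_integrable_integral_eq)

lemma power2_power_Suc: "(x\<^sup>2) ^ Suc k = x * x ^ (2 * k + 1)" for x :: "'a::comm_monoid_mult"
proof -
  have "(x\<^sup>2) ^ Suc k = x ^ (2 * Suc k)" by (simp only: power_mult)
  also have "2 * Suc k = Suc (2 * k + 1)" by simp
  finally show ?thesis by (simp only: power_Suc)
qed

text \<open>The function \<open>q\<close> stands for an entry of the inverse of the symbol.  Its value at the origin is left
  open, as the inverse matrix has no meaning there.\<close>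

locale quasihomogeneous_quotient = quasihomogeneous ls D m
  for ls :: "'n::finite \<Rightarrow> nat" and D :: "real ^ 'n \<Rightarrow> complex" and m :: nat +
  fixes P q :: "real ^ 'n \<Rightarrow> complex"
  assumes cpoly_P: "cpoly P"
    and q_eq: "\<And>z. z \<noteq> 0 \<Longrightarrow> q z = P z / D z"
    and q_dilate: "\<And>c z. c > 0 \<Longrightarrow> z \<noteq> 0 \<Longrightarrow> q (dilate ls c z) = q z / of_real c"
begin

lemma measurable_q [measurable]: "q \<in> borel_measurable borel"
proof -
  have [measurable]: "P \<in> borel_measurable borel" "D \<in> borel_measurable borel"
    using cpoly_P cpoly_D by (auto intro: cpoly_measurable)
  have "q = (\<lambda>z. if z = 0 then q 0 else P z / D z)" by (auto simp: q_eq)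
  moreover have "\<dots> \<in> borel_measurable borel" by measurable
  ultimately show ?thesis by simp
qed

text \<open>By homogeneity of degree \<open>-1\<close> the left side equals its value on the compact unit sphere.\<close>

lemma q_bound: "\<exists>C\<ge>0. \<forall>z. z \<noteq> 0 \<longrightarrow> sqrt (sigma ls z) * norm (q z) \<le> C"
proof -
  let ?S = "{w :: real ^ 'n. sigma ls w = 1}"
  have S0: "w \<noteq> 0" if "w \<in> ?S" for w
    using that sigma_0[of ls] ls_pos by auto
  have "continuous_on ?S (\<lambda>w. P w / D w)"
    using S0 by (intro continuous_intros cpoly_continuous cpoly_D cpoly_P) (auto simp: D_nonzero)
  then have "bounded ((\<lambda>w. P w / D w) ` ?S)"
    by (intro compact_imp_bounded compact_continuous_image compact_sigma_sphere ls_pos)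
  then obtain C where C: "\<And>w. w \<in> ?S \<Longrightarrow> norm (P w / D w) \<le> C"
    unfolding bounded_iff by blast
  have "sqrt (sigma ls z) * norm (q z) \<le> max C 0" if z: "z \<noteq> 0" for z
  proof -
    obtain w where w: "sigma ls w = 1" "z = dilate ls (sqrt (sigma ls z)) w" "w \<noteq> 0"
      by (rule sphere_decomposition[OF ls_pos z])
    have s: "0 < sqrt (sigma ls z)" using sigma_pos[OF z, of ls] by simp
    have "q z = (P w / D w) / of_real (sqrt (sigma ls z))"
      using s w(3) by (subst w(2)) (simp add: q_dilate q_eq)
    then have "norm (q z) = norm (P w / D w) / sqrt (sigma ls z)"
      using s by (simp add: norm_divide norm_mult)
    then have "sqrt (sigma ls z) * norm (q z) = norm (P w / D w)" using s by simp
    also have "\<dots> \<le> max C 0" using C[of w] w(1) by simp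
    finally show ?thesis .
  qed
  then show ?thesis by (intro exI[of _ "max C 0"]) auto
qed

definition heat_symbol :: "nat \<Rightarrow> real \<Rightarrow> real ^ 'n \<Rightarrow> complex" where
  "heat_symbol k s z = of_real (sigma ls z ^ Suc k * exp (- s * sigma ls z)) * q z"

lemma heat_symbol_0 [simp]: "heat_symbol k s 0 = 0"
  using sigma_0[of ls] ls_pos by (simp add: heat_symbol_def)

lemma measurable_heat_symbol [measurable]: "heat_symbol k s \<in> borel_measurable borel"
  unfolding heat_symbol_def[abs_def] by measurable

lemma heat_symbol_integrable:
  assumes "0 < s"
  shows "integrable lborel (heat_symbol k s)"
proof -
  obtain C where C: "0 \<le> C" "\<And>z. z \<noteq> 0 \<Longrightarrow> sqrt (sigma ls z) * norm (q z) \<le> C"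
    using q_bound by blast
  have "cpoly (\<lambda>z :: real ^ 'n. (1 + complex_of_real (sigma ls z)) ^ (2 * k + 1))"
    by (intro cpoly_intros sigma_cpoly)
  from cpoly_growth[OF this] obtain C' d where C': "0 \<le> C'"
    "\<And>z :: real ^ 'n. norm ((1 + complex_of_real (sigma ls z)) ^ (2 * k + 1)) \<le> C' * (1 + (norm z)\<^sup>2) ^ d" by blast
  have "norm (heat_symbol k s z) \<le> C * C' * (1 + (norm z)\<^sup>2) ^ d * exp (- s * sigma ls z)" for z
  proof (cases "z = 0")
    case False
    define r where "r = sqrt (sigma ls z)"
    have r: "0 < r" "sigma ls z = r\<^sup>2" using sigma_pos[OF False, of ls] by (simp_all add: r_def)
    have "r \<le> 1 + sigma ls z" unfolding r_def by (intro sqrt_le_one_plus) simp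
    then have "r ^ (2 * k + 1) \<le> (1 + sigma ls z) ^ (2 * k + 1)" using r(1) by (intro power_mono) auto
    also have "\<dots> = norm ((1 + complex_of_real (sigma ls z)) ^ (2 * k + 1))"
      by (metis abs_of_nonneg add_nonneg_nonneg norm_of_real norm_power of_real_1 of_real_add zero_le_one sigma_nonneg)
    also have "\<dots> \<le> C' * (1 + (norm z)\<^sup>2) ^ d" by (rule C')
    finally have *: "r ^ (2 * k + 1) \<le> C' * (1 + (norm z)\<^sup>2) ^ d" .
    have "norm (heat_symbol k s z) = (r * norm (q z)) * r ^ (2 * k + 1) * exp (- s * sigma ls z)"
      unfolding heat_symbol_def r(2) power2_power_Suc using r(1) by (simp add: norm_mult norm_power mult_ac)
    also have "\<dots> \<le> C * (C' * (1 + (norm z)\<^sup>2) ^ d) * exp (- s * sigma ls z)"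
      using C(2)[OF False] * r(1) C(1) by (intro mult_right_mono mult_mono) (auto simp: r_def[symmetric])
    finally show ?thesis by (simp add: mult.assoc)
  qed (use C C' in simp)
  then show ?thesis
    by (rule integrable_exp_sigma[of ls s, OF ls_pos assms measurable_heat_symbol]) (use C C' in simp)
qed

text \<open>Up to the sign \<open>(- 1) ^ k\<close> this is the \<open>k\<close>-th derivative in the time \<open>s\<close> of the heat kernel, the case
  \<open>k = 0\<close>.\<close>

definition heat_deriv :: "nat \<Rightarrow> real \<Rightarrow> real ^ 'n \<Rightarrow> complex" where
  "heat_deriv k s = fourier (heat_symbol k s)"

abbreviation homdim :: real where
  "homdim \<equiv> \<Sum>k\<in>UNIV. 1 / real (ls k)"

lemma measurable_heat_deriv [measurable]: "(\<lambda>p. heat_deriv k (fst p) (snd p)) \<in> borel_measurable (borel \<Otimes>\<^sub>M borel)"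
  unfolding heat_deriv_def fourier_def heat_symbol_def by measurable

lemma measurable_heat_deriv' [measurable]: "heat_deriv k s \<in> borel_measurable borel"
  unfolding heat_deriv_def by measurable

lemma heat_symbol_dilate:
  assumes "0 < s"
  shows "heat_symbol k s (dilate ls (s powr (-1/2)) z) = of_real ((s powr (-1/2)) ^ (2 * k + 1)) * heat_symbol k 1 z"
proof (cases "z = 0")
  case True
  have "dilate ls (s powr (-1/2)) 0 = 0" using assms by (simp add: dilate_eq_0_iff)
  then show ?thesis using True by simp
next
  case False
  define c where "c = s powr (-1/2)"
  have c: "0 < c" using assms by (simp add: c_def)
  have "c\<^sup>2 = s powr (-1/2 * 2)" unfolding c_def using assms by (subst powr_powr[symmetric]) simp
  then have sc: "s * c\<^sup>2 = 1" using assms by (simp add: powr_minus_divide)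
  have "heat_symbol k s (dilate ls c z) = of_real ((c\<^sup>2 * sigma ls z) ^ Suc k * exp (- (s * c\<^sup>2) * sigma ls z)) * (q z / of_real c)"
    using c False by (simp add: heat_symbol_def q_dilate sigma_dilate[of ls, OF ls_pos] mult.assoc)
  also have "\<dots> = of_real (c ^ (2 * k + 1)) * heat_symbol k 1 z"
    unfolding sc heat_symbol_def power_mult_distrib power2_power_Suc using c by (simp add: field_simps)
  finally show ?thesis by (simp add: c_def)
qed

text \<open>Substitute \<open>z = \<delta> c w\<close> with \<open>s * c\<^sup>2 = 1\<close>: the volume factor is \<open>c powr homdim\<close>, and the symbol has degree
  \<open>2 (k + 1) - 1\<close> apart from the exponential.\<close>

lemma heat_deriv_dilate:
  assumes "0 < s"
  defines "c \<equiv> s powr (-1/2)"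
  shows "heat_deriv k s y = of_real (c powr homdim * c ^ (2 * k + 1)) * heat_deriv k 1 (dilate ls c y)"
proof -
  have c: "0 < c" using assms by simp
  let ?F = "\<lambda>z. exp (\<i> * complex_of_real (y \<bullet> z)) * heat_symbol k s z"
  have "heat_deriv k s y = c powr homdim *\<^sub>R (LINT z|lborel. ?F (dilate ls c z))"
    unfolding heat_deriv_def fourier_def by (rule integral_dilate[OF _ c]) measurable
  also have "(\<lambda>z. ?F (dilate ls c z)) =
      (\<lambda>z. of_real (c ^ (2 * k + 1)) * (exp (\<i> * complex_of_real (dilate ls c y \<bullet> z)) * heat_symbol k 1 z))"
    using heat_symbol_dilate[OF assms(1), of k] by (simp add: fun_eq_iff inner_dilate c_def)
  also have "(LINT z|lborel. of_real (c ^ (2 * k + 1)) * (exp (\<i> * complex_of_real (dilate ls c y \<bullet> z)) * heat_symbol k 1 z))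
      = of_real (c ^ (2 * k + 1)) * heat_deriv k 1 (dilate ls c y)"
    unfolding heat_deriv_def fourier_def by simp
  finally show ?thesis by (simp add: scaleR_conv_of_real)
qed

text \<open>The dilation of the space argument cancels the volume factor of the dual variable, so only the
  degree of the symbol remains.\<close>

lemma nn_integral_heat_deriv:
  assumes "0 < s"
  shows "(\<integral>\<^sup>+y. norm (heat_deriv k s y) \<partial>lborel)
    = ennreal ((s powr (-1/2)) ^ (2 * k + 1)) * (\<integral>\<^sup>+y. norm (heat_deriv k 1 y) \<partial>lborel)"
proof -
  define c where "c = s powr (-1/2)"
  have c: "0 < c" using assms by (simp add: c_def)
  have "(\<integral>\<^sup>+y. norm (heat_deriv k s y) \<partial>lborel)
      = (\<integral>\<^sup>+y. ennreal (c ^ (2 * k + 1)) * (ennreal (c powr homdim) * ennreal (norm (heat_deriv k 1 (dilate ls c y)))) \<partial>lborel)"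
    using heat_deriv_dilate[OF assms, of k, folded c_def] c
    by (intro nn_integral_cong) (simp add: norm_mult norm_power ennreal_mult[symmetric] mult_ac)
  also have "\<dots> = ennreal (c ^ (2 * k + 1)) * (ennreal (c powr homdim) * (\<integral>\<^sup>+y. norm (heat_deriv k 1 (dilate ls c y)) \<partial>lborel))"
    by (simp add: nn_integral_cmult)
  also have "\<dots> = ennreal (c ^ (2 * k + 1)) * (\<integral>\<^sup>+y. norm (heat_deriv k 1 y) \<partial>lborel)"
    by (subst nn_integral_dilate[OF _ c, of "\<lambda>y. ennreal (norm (heat_deriv k 1 y))"]) auto
  finally show ?thesis by (simp add: c_def)
qed

lemma norm_heat_symbol: "norm (heat_symbol k s z) = sigma ls z ^ Suc k * exp (- s * sigma ls z) * norm (q z)"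
  by (simp add: heat_symbol_def norm_mult norm_power abs_mult)

text \<open>Fundamental theorem of calculus in time, from 1 to infinity.  On the symbol side it is the identity
  \<open>\<integral>\<^sub>1\<^sup>\<infinity> \<sigma> exp (- s \<sigma>) ds = exp (- \<sigma>)\<close>.\<close>

lemma heat_deriv_eq_integral_Suc:
  "heat_deriv k 1 y = (LINT s|lborel. indicator {1..} s *\<^sub>R heat_deriv (Suc k) s y)"
proof -
  let ?E = "\<lambda>z. exp (\<i> * complex_of_real (y \<bullet> z))"
  let ?G = "\<lambda>z s. indicator {1..} s *\<^sub>R (?E z * heat_symbol (Suc k) s z)"
  have tail: "has_bochner_integral lborel (\<lambda>s::real. (indicator {1..} s * exp (- s * sigma ls z)) *\<^sub>R
       (of_real (sigma ls z ^ Suc (Suc k)) * v)) (of_real (sigma ls z ^ Suc k * exp (- sigma ls z)) * v)"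
    for z and v :: complex
  proof (cases "z = 0")
    case True
    then show ?thesis using sigma_0[of ls] ls_pos by (simp add: has_bochner_integral_zero)
  next
    case False
    note p = sigma_pos[OF False, of ls]
    from has_bochner_integral_scaleR_left[OF has_bochner_integral_exp_tail[OF p, of 1],
        of "of_real (sigma ls z ^ Suc (Suc k)) * v"]
    show ?thesis using p by (simp add: scaleR_conv_of_real field_simps)
  qed
  have G: "?G z s = (indicator {1..} s * exp (- s * sigma ls z)) *\<^sub>R (of_real (sigma ls z ^ Suc (Suc k)) * (?E z * q z))" for z s
    by (simp add: heat_symbol_def scaleR_conv_of_real mult_ac)
  have nG: "complex_of_real (norm (?G z s)) = (indicator {1..} s * exp (- s * sigma ls z)) *\<^sub>R (of_real (sigma ls z ^ Suc (Suc k)) * of_real (norm (q z)))" for z s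
    by (simp add: norm_mult norm_heat_symbol scaleR_conv_of_real mult_ac)
  have i1: "(LINT s|lborel. norm (?G z s)) = norm (heat_symbol k 1 z)" for z
  proof -
    have "complex_of_real (LINT s|lborel. norm (?G z s)) = (LINT s|lborel. complex_of_real (norm (?G z s)))"
      by (rule integral_complex_of_real[symmetric])
    also have "\<dots> = of_real (norm (heat_symbol k 1 z))"
      unfolding nG using has_bochner_integral_integral_eq[OF tail[of z "of_real (norm (q z))"]] by (simp add: norm_heat_symbol)
    finally show ?thesis using of_real_eq_iff by blast
  qed
  have i2: "(LINT s|lborel. ?G z s) = ?E z * heat_symbol k 1 z" for z
    unfolding G using has_bochner_integral_integral_eq[OF tail[of z "?E z * q z"]]
    by (simp add: heat_symbol_def mult_ac)
  have joint: "integrable (lborel \<Otimes>\<^sub>M lborel) (case_prod ?G)"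
  proof (rule lborel_pair.Fubini_integrable)
    show "case_prod ?G \<in> borel_measurable (lborel \<Otimes>\<^sub>M lborel)"
      unfolding heat_symbol_def by measurable
    show "integrable lborel (\<lambda>z. LINT s|lborel. norm (case (z, s) of (z, s) \<Rightarrow> ?G z s))"
      using heat_symbol_integrable[of 1 k] by (simp only: prod.case i1) simp
    show "AE z in lborel. integrable lborel (\<lambda>s. case (z, s) of (z, s) \<Rightarrow> ?G z s)"
      unfolding prod.case G using has_bochner_integral_iff tail by (intro AE_I2) blast
  qed
  have "heat_deriv k 1 y = (LINT z|lborel. LINT s|lborel. ?G z s)"
    unfolding i2 by (simp add: heat_deriv_def fourier_def)
  also have "\<dots> = (LINT s|lborel. LINT z|lborel. ?G z s)"
    by (rule lborel_pair.Fubini_integral[OF joint, symmetric])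
  also have "\<dots> = (LINT s|lborel. indicator {1..} s *\<^sub>R heat_deriv (Suc k) s y)"
    by (simp add: heat_deriv_def fourier_def)
  finally show ?thesis .
qed

lemma nn_integral_powr_Ici:
  fixes e :: real
  assumes "e < -1"
  shows "(\<integral>\<^sup>+x. ennreal (indicator {1..} x * x powr e) \<partial>lborel) < \<infinity>"
  using nn_integral_has_integral_lebesgue[OF _ has_integral_powr_to_inf[OF assms zero_less_one]] by simp

text \<open>Integrate the preceding formula over space.  The \<open>L\<^sup>1\<close> norm of the integrand at time \<open>s\<close> is
  proportional to \<open>s powr (- k - 3/2)\<close>, which is at most \<open>s powr (-3/2)\<close> for \<open>s \<ge> 1\<close>.\<close>

lemma heat_deriv_integrable_step:
  assumes fin: "(\<integral>\<^sup>+y. norm (heat_deriv (Suc k) 1 y) \<partial>lborel) < \<infinity>"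
  shows "(\<integral>\<^sup>+y. norm (heat_deriv k 1 y) \<partial>lborel) < \<infinity>"
proof -
  let ?Q = "\<integral>\<^sup>+y. norm (heat_deriv (Suc k) 1 y) \<partial>lborel"
  have "(\<integral>\<^sup>+y. norm (heat_deriv k 1 y) \<partial>lborel)
      \<le> (\<integral>\<^sup>+y. (\<integral>\<^sup>+s. norm (indicator {1..} s *\<^sub>R heat_deriv (Suc k) s y) \<partial>lborel) \<partial>lborel)"
    by (intro nn_integral_mono) (simp only: heat_deriv_eq_integral_Suc norm_integral_le_nn_integral)
  also have "\<dots> = (\<integral>\<^sup>+s. (\<integral>\<^sup>+y. norm (indicator {1..} s *\<^sub>R heat_deriv (Suc k) s y) \<partial>lborel) \<partial>lborel)"
    by (rule lborel_pair.Fubini') measurable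
  also have "\<dots> \<le> (\<integral>\<^sup>+s. ennreal (indicator {1..} s * s powr (-3/2)) * ?Q \<partial>lborel)"
  proof (rule nn_integral_mono)
    fix s :: real
    show "(\<integral>\<^sup>+y. norm (indicator {1..} s *\<^sub>R heat_deriv (Suc k) s y) \<partial>lborel) \<le> ennreal (indicator {1..} s * s powr (-3/2)) * ?Q"
    proof (cases "1 \<le> s")
      case True
      have "(s powr (-1/2)) ^ (2 * Suc k + 1) \<le> (s powr (-1/2)) ^ 3"
        using True powr_mono[of "-1/2" 0 s] by (intro power_decreasing) auto
      also have "\<dots> = s powr (-3/2)"
        using True by (simp add: powr_realpow[symmetric] powr_powr)
      finally show ?thesis
        using True nn_integral_heat_deriv[of s "Suc k"] by (simp add: mult_right_mono ennreal_leI)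
    qed simp
  qed
  also have "\<dots> = (\<integral>\<^sup>+s. ennreal (indicator {1..} s * s powr (-3/2)) \<partial>lborel) * ?Q"
    by (rule nn_integral_multc) measurable
  also have "\<dots> < \<infinity>"
    using nn_integral_powr_Ici[of "-3/2"] fin by (simp add: ennreal_mult_less_top)
  finally show ?thesis .
qed

text \<open>Start at an order \<open>K\<close> for which the symbol is smooth enough at the origin to integrate by parts
  twice as often as the dimension in each direction, then descend.\<close>

lemma heat_deriv_0_integrable: "(\<integral>\<^sup>+y. norm (heat_deriv 0 1 y) \<partial>lborel) < \<infinity>"
proof -
  \<comment> \<open>Large enough for \<open>fourier_quot_integrable\<close> with \<open>a = Suc K\<close> and \<open>b = 1\<close>.\<close>
  define K where "K = m + 2 * CARD('n) * (m + 2)"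
  have "heat_symbol K 1 = quot P (Suc K) 1"
  proof
    fix z show "heat_symbol K 1 z = quot P (Suc K) 1 z"
    proof (cases "z = 0")
      case True
      then show ?thesis using sigma_0[of ls] ls_pos by (simp add: quot_def)
    next
      case False
      then show ?thesis by (simp add: heat_symbol_def quot_def q_eq exp_of_real[symmetric])
    qed
  qed
  moreover have "integrable lborel (fourier (quot P (Suc K) 1))"
    by (rule fourier_quot_integrable[OF cpoly_P]) (simp add: K_def)
  ultimately have "integrable lborel (heat_deriv K 1)" by (simp add: heat_deriv_def)
  then have K: "(\<integral>\<^sup>+y. norm (heat_deriv K 1 y) \<partial>lborel) < \<infinity>"
    by (simp add: integrable_iff_bounded)
  have "(\<integral>\<^sup>+y. norm (heat_deriv (K - j) 1 y) \<partial>lborel) < \<infinity>" if "j \<le> K" for j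
    using that
  proof (induction j)
    case (Suc j)
    then have "Suc (K - Suc j) = K - j" by simp
    with Suc show ?case using heat_deriv_integrable_step[of "K - Suc j"] by simp
  qed (use K in simp)
  from this[of K] show ?thesis by simp
qed

text \<open>The \<open>L\<^sup>1\<close> bound \<open>t powr (-1/2)\<close> is used for times below 1 and the uniform bound
  \<open>t powr (- (homdim + 1) / 2)\<close>, times the volume of the ball, above 1.  This is the place where
  \<open>homdim > 1\<close> is essential.\<close>

lemma heat_deriv_locally_integrable:
  assumes "homdim > 1"
  shows "(\<integral>\<^sup>+t. (\<integral>\<^sup>+y. ennreal (indicator {0<..} t * indicator (cball 0 r) y * norm (heat_deriv 0 t y)) \<partial>lborel) \<partial>lborel) < \<infinity>"
proof -
  let ?B = "cball 0 r :: (real ^ 'n) set"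
  let ?Q = "\<integral>\<^sup>+y. norm (heat_deriv 0 1 y) \<partial>lborel"
  define M where "M = (LINT z|lborel. norm (heat_symbol 0 1 z))"
  have M: "norm (heat_deriv 0 1 y) \<le> M" for y
    unfolding M_def heat_deriv_def by (intro norm_fourier_le heat_symbol_integrable) simp
  have M0: "0 \<le> M" using order_trans[OF norm_ge_zero M] .
  let ?e = "- (homdim + 1) / 2"
  have B: "emeasure lborel ?B < \<infinity>" by (rule emeasure_bounded_finite) simp
  have "(\<integral>\<^sup>+t. (\<integral>\<^sup>+y. ennreal (indicator {0<..} t * indicator ?B y * norm (heat_deriv 0 t y)) \<partial>lborel) \<partial>lborel)
     \<le> (\<integral>\<^sup>+t. ennreal (indicator {0..1} t * t powr (-1/2)) * ?Q +
             ennreal (indicator {1..} t * t powr ?e) * (ennreal M * emeasure lborel ?B) \<partial>lborel)"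
  proof (rule nn_integral_mono)
    fix t :: real
    consider "t \<le> 0" | "0 < t" "t \<le> 1" | "1 < t" by linarith
    then show "(\<integral>\<^sup>+y. ennreal (indicator {0<..} t * indicator ?B y * norm (heat_deriv 0 t y)) \<partial>lborel)
      \<le> ennreal (indicator {0..1} t * t powr (-1/2)) * ?Q +
             ennreal (indicator {1..} t * t powr ?e) * (ennreal M * emeasure lborel ?B)"
    proof cases
      case 1
      then show ?thesis by simp
    next
      case 2
      have "(\<integral>\<^sup>+y. ennreal (indicator {0<..} t * indicator ?B y * norm (heat_deriv 0 t y)) \<partial>lborel)
          \<le> (\<integral>\<^sup>+y. norm (heat_deriv 0 t y) \<partial>lborel)"
        by (intro nn_integral_mono ennreal_leI) (auto simp: indicator_def)
      also have "\<dots> = ennreal (indicator {0..1} t * t powr (-1/2)) * ?Q"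
        using 2 nn_integral_heat_deriv[of t 0] by simp
      finally show ?thesis by (rule order_trans) simp
    next
      case 3
      have "norm (heat_deriv 0 t y) \<le> t powr ?e * M" for y
      proof -
        let ?c = "t powr (-1/2)"
        have "norm (heat_deriv 0 t y) = ?c powr homdim * ?c * norm (heat_deriv 0 1 (dilate ls ?c y))"
          using 3 heat_deriv_dilate[of t 0 y] by (simp add: norm_mult)
        also have "?c powr homdim * ?c = t powr ?e"
          using 3 by (simp add: powr_powr powr_add[symmetric] field_simps)
        finally show ?thesis using M by (simp add: mult_left_mono)
      qed
      then have "(\<integral>\<^sup>+y. ennreal (indicator {0<..} t * indicator ?B y * norm (heat_deriv 0 t y)) \<partial>lborel)
          \<le> (\<integral>\<^sup>+y. ennreal (t powr ?e * M) * indicator ?B y \<partial>lborel)"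
        by (intro nn_integral_mono) (auto simp: indicator_def intro!: ennreal_leI)
      also have "\<dots> = ennreal (t powr ?e) * (ennreal M * emeasure lborel ?B)"
        using M0 by (subst nn_integral_cmult_indicator) (auto simp: ennreal_mult mult.assoc)
      finally show ?thesis using 3 by simp
    qed
  qed
  also have "\<dots> = (\<integral>\<^sup>+t. ennreal (indicator {0..1} t * t powr (-1/2)) \<partial>lborel) * ?Q +
             (\<integral>\<^sup>+t. ennreal (indicator {1..} t * t powr ?e) \<partial>lborel) * (ennreal M * emeasure lborel ?B)"
    by (subst nn_integral_add) (auto simp: nn_integral_multc)
  also have "\<dots> < \<infinity>"
  proof -
    have "(\<integral>\<^sup>+t. ennreal (indicator {0..1} t * t powr (-1/2)) \<partial>lborel) < \<infinity>"
      using nn_integral_has_integral_lebesgue[OF _ has_integral_powr_from_0[of "-1/2" 1]] by simp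
    moreover have "(\<integral>\<^sup>+t. ennreal (indicator {1..} t * t powr ?e) \<partial>lborel) < \<infinity>"
      by (rule nn_integral_powr_Ici) (use assms in \<open>simp add: field_simps\<close>)
    ultimately show ?thesis using B heat_deriv_0_integrable by (simp add: ennreal_mult_less_top)
  qed
  finally show ?thesis .
qed

end

section \<open>Fourier inversion\<close>

text \<open>This is the characteristic function of the standard normal distribution.\<close>

lemma gaussian_fourier_1:
  shows "integrable lborel (\<lambda>x. exp (\<i> * complex_of_real (t * x)) * complex_of_real (exp (- x\<^sup>2 / 2)))"
    and "(LINT x|lborel. exp (\<i> * complex_of_real (t * x)) * complex_of_real (exp (- x\<^sup>2 / 2)))
      = complex_of_real (sqrt (2 * pi) * exp (- t\<^sup>2 / 2))"
proof -
  have eq: "exp (\<i> * complex_of_real (t * x)) * complex_of_real (exp (- x\<^sup>2 / 2))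
      = complex_of_real (sqrt (2 * pi)) * (std_normal_density x *\<^sub>R exp (\<i> * complex_of_real (t * x)))" for x
    by (simp add: std_normal_density_def scaleR_conv_of_real)
  have i: "integrable lborel (\<lambda>x. std_normal_density x *\<^sub>R exp (\<i> * complex_of_real (t * x)))"
  proof (rule Bochner_Integration.integrable_bound)
    show "integrable lborel std_normal_density" by simp
  qed auto
  show "integrable lborel (\<lambda>x. exp (\<i> * complex_of_real (t * x)) * complex_of_real (exp (- x\<^sup>2 / 2)))"
    unfolding eq using i by (rule integrable_mult_right)
  have "(LINT x|lborel. std_normal_density x *\<^sub>R exp (\<i> * complex_of_real (t * x))) = char std_normal_distribution t"
    unfolding char_def by (subst integral_density) auto
  also have "\<dots> = complex_of_real (exp (- t\<^sup>2 / 2))" by (simp add: char_std_normal_distribution)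
  finally have *: "(LINT x|lborel. std_normal_density x *\<^sub>R exp (\<i> * complex_of_real (t * x)))
      = complex_of_real (exp (- t\<^sup>2 / 2))" .
  show "(LINT x|lborel. exp (\<i> * complex_of_real (t * x)) * complex_of_real (exp (- x\<^sup>2 / 2)))
      = complex_of_real (sqrt (2 * pi) * exp (- t\<^sup>2 / 2))"
    unfolding eq by (simp only: integral_mult_right_zero *) (simp only: of_real_mult)
qed

definition gaussian :: "real ^ 'n::finite \<Rightarrow> real" where
  "gaussian z = exp (- (norm z)\<^sup>2 / 2)"

lemma gaussian_nonneg [simp]: "0 \<le> gaussian z" and gaussian_le_1: "gaussian z \<le> 1"
  by (simp_all add: gaussian_def)

lemma continuous_on_gaussian: "continuous_on S gaussian"
  unfolding gaussian_def[abs_def] by (intro continuous_intros) auto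

lemma measurable_gaussian [measurable]: "gaussian \<in> borel_measurable borel"
  by (intro borel_measurable_continuous_onI continuous_on_gaussian)

lemma fourier_gaussian:
  fixes y :: "real ^ 'n::finite"
  shows "integrable lborel (\<lambda>z. exp (\<i> * complex_of_real (y \<bullet> z)) * complex_of_real (gaussian z))"
    and "fourier (\<lambda>z. complex_of_real (gaussian z)) y = complex_of_real (sqrt (2 * pi) ^ CARD('n) * gaussian y)"
proof -
  have g: "complex_of_real (gaussian z) = (\<Prod>k\<in>UNIV. complex_of_real (exp (- (z $ k)\<^sup>2 / 2)))" for z :: "real ^ 'n"
    by (simp add: gaussian_def norm_vec_def L2_set_def sum_nonneg exp_sum[symmetric] sum_negf sum_divide_distrib
        flip: of_real_prod)
  have e: "exp (\<i> * complex_of_real (y \<bullet> z)) = (\<Prod>k\<in>UNIV. exp (\<i> * complex_of_real (y $ k * z $ k)))" for z :: "real ^ 'n"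
    by (simp add: inner_vec_def sum_distrib_left exp_sum)
  have eq: "exp (\<i> * complex_of_real (y \<bullet> z)) * complex_of_real (gaussian z) =
      (\<Prod>k\<in>UNIV. exp (\<i> * complex_of_real (y $ k * z $ k)) * complex_of_real (exp (- (z $ k)\<^sup>2 / 2)))" for z
    unfolding e g prod.distrib ..
  show "integrable lborel (\<lambda>z. exp (\<i> * complex_of_real (y \<bullet> z)) * complex_of_real (gaussian z))"
    unfolding eq by (rule lborel_integral_prod_vec(1)) (rule gaussian_fourier_1)
  have "fourier (\<lambda>z. complex_of_real (gaussian z)) y = (\<Prod>k\<in>UNIV. complex_of_real (sqrt (2 * pi) * exp (- (y $ k)\<^sup>2 / 2)))"
    unfolding fourier_def eq
    by (subst lborel_integral_prod_vec(2)) (simp_all only: gaussian_fourier_1)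
  also have "\<dots> = complex_of_real (sqrt (2 * pi) ^ CARD('n) * gaussian y)"
    by (simp only: of_real_mult prod.distrib g) simp
  finally show "fourier (\<lambda>z. complex_of_real (gaussian z)) y = complex_of_real (sqrt (2 * pi) ^ CARD('n) * gaussian y)" .
qed

lemma integrable_gaussian: "integrable lborel (gaussian :: real ^ 'n::finite \<Rightarrow> real)"
  using integrable_norm[OF fourier_gaussian(1)[of "0 :: real ^ 'n"]] by simp

lemma stretch_const: "stretch (\<lambda>_. c) z = c *\<^sub>R z"
  by (simp add: vec_eq_iff)

lemma integral_scaleR_arg:
  fixes f :: "real ^ 'n::finite \<Rightarrow> 'b::{banach, second_countable_topology}"
  assumes "f \<in> borel_measurable borel" and "0 < c"
  shows "(LINT x|lborel. f x) = c ^ CARD('n) *\<^sub>R (LINT x|lborel. f (c *\<^sub>R x))"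
  using integral_stretch[of f "\<lambda>_. c"] assms by (simp add: stretch_const)

text \<open>Inserting a Gaussian cutoff of width \<open>c\<close> in the inversion integral makes Fubini applicable and replaces
  \<open>g\<close> by its average against a Gaussian of width \<open>1 / c\<close>.\<close>

lemma fourier_gaussian_average:
  fixes g :: "real ^ 'n::finite \<Rightarrow> complex"
  assumes int: "integrable lborel g" and c: "0 < c"
  shows "(LINT z|lborel. exp (\<i> * complex_of_real (x \<bullet> z)) * (complex_of_real (gaussian (z /\<^sub>R c)) * fourier g (- z)))
    = of_real (sqrt (2 * pi) ^ CARD('n)) * (LINT v|lborel. complex_of_real (gaussian v) * g (x - v /\<^sub>R c))"
proof -
  have [measurable]: "g \<in> borel_measurable borel" using int by simp
  let ?G = "\<lambda>z y. exp (\<i> * complex_of_real ((x - y) \<bullet> z)) * complex_of_real (gaussian (z /\<^sub>R c)) * g y"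
  let ?p = "complex_of_real (sqrt (2 * pi) ^ CARD('n))"
  have gc: "integrable lborel (\<lambda>z :: real ^ 'n. gaussian (z /\<^sub>R c))"
  proof (rule integrableI_bounded)
    have "(\<integral>\<^sup>+z. ennreal (gaussian (z :: real ^ 'n)) \<partial>lborel) < \<infinity>"
      using integrable_gaussian[where 'n='n] by (simp add: integrable_iff_bounded)
    moreover have "(\<integral>\<^sup>+z. ennreal (gaussian ((z :: real ^ 'n) /\<^sub>R c)) \<partial>lborel)
        = ennreal (c ^ CARD('n)) * (\<integral>\<^sup>+z. ennreal (gaussian (z :: real ^ 'n)) \<partial>lborel)"
      using nn_integral_stretch[of "\<lambda>z :: real ^ 'n. ennreal (gaussian (z /\<^sub>R c))" "\<lambda>_. c"] c
      by (simp add: stretch_const)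
    ultimately show "(\<integral>\<^sup>+z. ennreal (norm (gaussian ((z :: real ^ 'n) /\<^sub>R c))) \<partial>lborel) < \<infinity>"
      by (simp add: ennreal_mult_less_top)
  qed simp
  have joint: "integrable (lborel \<Otimes>\<^sub>M lborel) (case_prod ?G)"
  proof (rule lborel_pair.Fubini_integrable)
    show "case_prod ?G \<in> borel_measurable (lborel \<Otimes>\<^sub>M lborel)" by measurable
    have "(LINT y|lborel. norm (?G z y)) = gaussian (z /\<^sub>R c) * (LINT y|lborel. norm (g y))" for z
      by (simp add: norm_mult)
    then show "integrable lborel (\<lambda>z. LINT y|lborel. norm (case (z, y) of (z, y) \<Rightarrow> ?G z y))"
      using gc by simp
    have "integrable lborel (\<lambda>y. ?G z y)" for z
      by (rule Bochner_Integration.integrable_bound[OF int])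
         (auto simp: norm_mult gaussian_le_1 mult_left_le_one_le)
    then show "AE z in lborel. integrable lborel (\<lambda>y. case (z, y) of (z, y) \<Rightarrow> ?G z y)" by simp
  qed
  have "exp (\<i> * complex_of_real (x \<bullet> z)) * (complex_of_real (gaussian (z /\<^sub>R c)) * fourier g (- z)) = (LINT y|lborel. ?G z y)" for z
  proof -
    have eq: "?G z y = exp (\<i> * complex_of_real (x \<bullet> z)) * complex_of_real (gaussian (z /\<^sub>R c)) * (exp (\<i> * complex_of_real ((- z) \<bullet> y)) * g y)" for y
      by (simp add: inner_diff_left inner_commute[of z] exp_diff exp_minus right_diff_distrib field_simps)
    show ?thesis unfolding eq fourier_def by (simp only: integral_mult_right_zero mult.assoc)
  qed
  then have "(LINT z|lborel. exp (\<i> * complex_of_real (x \<bullet> z)) * (complex_of_real (gaussian (z /\<^sub>R c)) * fourier g (- z)))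
      = (LINT z|lborel. LINT y|lborel. ?G z y)" by simp
  also have "\<dots> = (LINT y|lborel. LINT z|lborel. ?G z y)"
    by (rule lborel_pair.Fubini_integral[OF joint, symmetric])
  also have "\<dots> = (LINT y|lborel. c ^ CARD('n) *\<^sub>R (?p * of_real (gaussian (c *\<^sub>R (x - y)))) * g y)"
  proof (rule Bochner_Integration.integral_cong[OF refl])
    fix y :: "real ^ 'n"
    have "(LINT z|lborel. exp (\<i> * complex_of_real ((x - y) \<bullet> z)) * complex_of_real (gaussian (z /\<^sub>R c)))
        = c ^ CARD('n) *\<^sub>R (LINT z|lborel. exp (\<i> * complex_of_real ((x - y) \<bullet> (c *\<^sub>R z))) * complex_of_real (gaussian ((c *\<^sub>R z) /\<^sub>R c)))"
      by (rule integral_scaleR_arg[OF _ c]) measurable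
    also have "\<dots> = c ^ CARD('n) *\<^sub>R fourier (\<lambda>z. complex_of_real (gaussian z)) (c *\<^sub>R (x - y))"
      using c by (simp add: fourier_def)
    finally show "(LINT z|lborel. ?G z y) = c ^ CARD('n) *\<^sub>R (?p * of_real (gaussian (c *\<^sub>R (x - y)))) * g y"
      by (simp add: fourier_gaussian(2))
  qed
  also have "\<dots> = (LINT u|lborel. c ^ CARD('n) *\<^sub>R (?p * of_real (gaussian (c *\<^sub>R u))) * g (x - u))"
    by (subst integral_reflect[of _ x, symmetric]) auto
  also have "\<dots> = (1 / c) ^ CARD('n) *\<^sub>R (LINT v|lborel. c ^ CARD('n) *\<^sub>R (?p * of_real (gaussian (c *\<^sub>R ((1 / c) *\<^sub>R v)))) * g (x - (1 / c) *\<^sub>R v))"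
    by (rule integral_scaleR_arg) (use c in auto)
  also have "\<dots> = ?p * (LINT v|lborel. complex_of_real (gaussian v) * g (x - v /\<^sub>R c))"
  proof -
    have "c *\<^sub>R ((1 / c) *\<^sub>R v) = v" "(1 / c) *\<^sub>R v = v /\<^sub>R c" for v :: "real ^ 'n"
      using c by (simp_all add: divide_inverse)
    moreover have "(1 / c) ^ CARD('n) * c ^ CARD('n) = 1" using c by (simp add: power_mult_distrib[symmetric])
    ultimately show ?thesis
      by (simp only: mult_scaleR_left integral_scaleR_right mult.assoc integral_mult_right_zero scaleR_scaleR scaleR_one)
  qed
  finally show ?thesis .
qed

text \<open>Let the cutoff of \<open>fourier_gaussian_average\<close> tend to 1: the left side converges because the transform is
  integrable, the right side because \<open>g\<close> is bounded and continuous.\<close>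

lemma fourier_inversion:
  fixes g :: "real ^ 'n::finite \<Rightarrow> complex"
  assumes cont: "continuous_on UNIV g" and int: "integrable lborel g" and bd: "\<And>x. norm (g x) \<le> B"
    and int': "integrable lborel (fourier g)"
  shows "(LINT z|lborel. exp (\<i> * complex_of_real (x \<bullet> z)) * fourier g (- z)) = of_real ((2 * pi) ^ CARD('n)) * g x"
proof -
  have [measurable]: "g \<in> borel_measurable borel" using int by simp
  define c where "c j = real (Suc j)" for j
  have c: "0 < c j" for j by (simp add: c_def)
  have inv: "(\<lambda>j. inverse (c j)) \<longlonglongrightarrow> 0"
    unfolding c_def by (rule LIMSEQ_inverse_real_of_nat)
  have scale: "(\<lambda>j. z /\<^sub>R c j) \<longlonglongrightarrow> 0" for z :: "real ^ 'n"
    using tendsto_scaleR[OF inv tendsto_const[of z]] by simp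
  have int'': "integrable lborel (\<lambda>z. fourier g (- z))"
    using integrable_reflect[OF int', of 0] by simp
  let ?J = "\<lambda>j. LINT z|lborel. exp (\<i> * complex_of_real (x \<bullet> z)) * (complex_of_real (gaussian (z /\<^sub>R c j)) * fourier g (- z))"
  have L1: "?J \<longlonglongrightarrow> (LINT z|lborel. exp (\<i> * complex_of_real (x \<bullet> z)) * (complex_of_real (gaussian (0 :: real ^ 'n)) * fourier g (- z)))"
  proof (rule integral_dominated_convergence[where w="\<lambda>z. norm (fourier g (- z))"])
    show "integrable lborel (\<lambda>z. norm (fourier g (- z)))" using int'' by simp
    show "AE z in lborel. (\<lambda>j. exp (\<i> * complex_of_real (x \<bullet> z)) * (complex_of_real (gaussian (z /\<^sub>R c j)) * fourier g (- z)))
        \<longlonglongrightarrow> exp (\<i> * complex_of_real (x \<bullet> z)) * (complex_of_real (gaussian (0 :: real ^ 'n)) * fourier g (- z))"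
    proof (rule AE_I2)
      fix z :: "real ^ 'n"
      have "isCont gaussian (0 :: real ^ 'n)" using continuous_on_gaussian[of "UNIV :: (real ^ 'n) set"] by (simp add: continuous_on_eq_continuous_at)
      then have "(\<lambda>j. gaussian (z /\<^sub>R c j)) \<longlonglongrightarrow> gaussian (0 :: real ^ 'n)"
        by (rule isCont_tendsto_compose[OF _ scale])
      then show "(\<lambda>j. exp (\<i> * complex_of_real (x \<bullet> z)) * (complex_of_real (gaussian (z /\<^sub>R c j)) * fourier g (- z)))
        \<longlonglongrightarrow> exp (\<i> * complex_of_real (x \<bullet> z)) * (complex_of_real (gaussian (0 :: real ^ 'n)) * fourier g (- z))"
        by (intro tendsto_intros)
    qed
    show "AE z in lborel. norm (exp (\<i> * complex_of_real (x \<bullet> z)) * (complex_of_real (gaussian (z /\<^sub>R c j)) * fourier g (- z)))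
        \<le> norm (fourier g (- z))" for j
      by (intro AE_I2) (simp add: norm_mult gaussian_le_1 mult_left_le_one_le)
  qed auto
  have J: "?J = (\<lambda>j. of_real (sqrt (2 * pi) ^ CARD('n)) * (LINT v|lborel. complex_of_real (gaussian v) * g (x - v /\<^sub>R c j)))"
    by (rule ext) (rule fourier_gaussian_average[OF int c])
  have L2: "(\<lambda>j. of_real (sqrt (2 * pi) ^ CARD('n)) * (LINT v|lborel. complex_of_real (gaussian v) * g (x - v /\<^sub>R c j)))
      \<longlonglongrightarrow> of_real (sqrt (2 * pi) ^ CARD('n)) * (LINT v :: real ^ 'n|lborel. complex_of_real (gaussian v) * g x)"
  proof (rule tendsto_mult_left, rule integral_dominated_convergence[where w="\<lambda>v. gaussian v * B"])
    show "integrable lborel (\<lambda>v :: real ^ 'n. gaussian v * B)"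
      by (intro integrable_mult_left integrable_gaussian)
    show "AE v in lborel. (\<lambda>j. complex_of_real (gaussian v) * g (x - v /\<^sub>R c j)) \<longlonglongrightarrow> complex_of_real (gaussian v) * g x"
    proof (rule AE_I2)
      fix v :: "real ^ 'n"
      have "isCont g x" using cont by (simp add: continuous_on_eq_continuous_at)
      moreover have "(\<lambda>j. x - v /\<^sub>R c j) \<longlonglongrightarrow> x" using tendsto_diff[OF tendsto_const[of x] scale[of v]] by simp
      ultimately have "(\<lambda>j. g (x - v /\<^sub>R c j)) \<longlonglongrightarrow> g x" by (rule isCont_tendsto_compose)
      then show "(\<lambda>j. complex_of_real (gaussian v) * g (x - v /\<^sub>R c j)) \<longlonglongrightarrow> complex_of_real (gaussian v) * g x"
        by (intro tendsto_intros)
    qed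
    show "AE v in lborel. norm (complex_of_real (gaussian v) * g (x - v /\<^sub>R c j)) \<le> gaussian v * B" for j
      by (intro AE_I2) (simp add: norm_mult bd mult_left_mono)
  qed auto
  let ?p = "sqrt (2 * pi) ^ CARD('n)"
  have "(LINT z|lborel. exp (\<i> * complex_of_real (x \<bullet> z)) * (complex_of_real (gaussian (0 :: real ^ 'n)) * fourier g (- z)))
      = of_real ?p * (LINT v :: real ^ 'n|lborel. complex_of_real (gaussian v) * g x)"
    by (rule LIMSEQ_unique[OF L1[unfolded J] L2])
  moreover have "complex_of_real (gaussian (0 :: real ^ 'n)) = 1" by (simp add: gaussian_def)
  ultimately have "(LINT z|lborel. exp (\<i> * complex_of_real (x \<bullet> z)) * fourier g (- z))
      = of_real ?p * ((LINT v :: real ^ 'n|lborel. complex_of_real (gaussian v)) * g x)"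
    by (simp only: mult_1 integral_mult_left_zero)
  also have "(LINT v :: real ^ 'n|lborel. complex_of_real (gaussian v)) = of_real ?p"
    using fourier_gaussian(2)[of "0 :: real ^ 'n"] by (simp add: fourier_def gaussian_def)
  also have "of_real ?p * (of_real ?p * g x) = of_real (?p * ?p) * g x"
    by (simp only: of_real_mult mult.assoc)
  also have "?p * ?p = (2 * pi) ^ CARD('n)"
    by (simp only: power_mult_distrib[symmetric] real_sqrt_mult_self) simp
  finally show ?thesis .
qed

section \<open>Smooth functions of compact support\<close>

lemma partials_Cons: "partials (k # ks) u = partial k (partials ks u)"
  by (simp add: partials_def)

lemma partials_Nil [simp]: "partials [] u = u"
  by (simp add: partials_def)

lemma partials_append: "partials (ks @ ks') u = partials ks (partials ks' u)"
  by (simp add: partials_def)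

lemma smooth_continuous: "smooth u \<Longrightarrow> continuous_on UNIV u"
  unfolding smooth_def by (metis partials_Nil)

lemma smooth_partial: "smooth u \<Longrightarrow> smooth (partial k u)"
  unfolding smooth_def using partials_append[of _ "[k]" u] by (metis partials_Cons partials_Nil)

lemma smooth_has_partial:
  assumes "smooth u"
  shows "((\<lambda>t. u (x + t *\<^sub>R axis k 1)) has_vector_derivative partial k u x) (at 0)"
proof -
  have "(\<lambda>t. partials [] u (x + t *\<^sub>R axis k 1)) differentiable (at 0)"
    using assms unfolding smooth_def by blast
  then show ?thesis unfolding partial_def vector_derivative_works[symmetric] by simp
qed

lemma scs_smooth: "smooth_compact_support u \<Longrightarrow> smooth u"
  by (simp add: smooth_compact_support_def)

lemma scs_partial:
  fixes u :: "real ^ 'n::finite \<Rightarrow> 'a::real_normed_vector"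
  assumes u: "smooth_compact_support u"
  shows "smooth_compact_support (partial k u)"
proof -
  let ?S = "closure {x. u x \<noteq> 0}"
  have "x \<in> ?S" if "partial k u x \<noteq> 0" for x
  proof (rule ccontr)
    assume "x \<notin> ?S"
    let ?T = "(\<lambda>t::real. x + t *\<^sub>R axis k 1) -` (- ?S)"
    have "((\<lambda>t. u (x + t *\<^sub>R axis k 1)) has_vector_derivative 0) (at 0)"
    proof (rule has_vector_derivative_transform_within_open)
      show "((\<lambda>t::real. 0) has_vector_derivative 0) (at 0)" by simp
      show "open ?T" by (intro open_vimage continuous_intros) auto
      show "0 \<in> ?T" using \<open>x \<notin> ?S\<close> by simp
      show "0 = u (x + t *\<^sub>R axis k 1)" if "t \<in> ?T" for t
        using that closure_subset[of "{x. u x \<noteq> 0}"] by auto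
    qed
    then show False using that vector_derivative_at unfolding partial_def by blast
  qed
  then have "closure {x. partial k u x \<noteq> 0} \<subseteq> ?S"
    by (intro closure_minimal) auto
  moreover have "compact ?S" using u by (simp add: smooth_compact_support_def)
  ultimately have "compact (closure {x. partial k u x \<noteq> 0})"
    by (metis closed_closure compact_Int_closed inf.absorb_iff2)
  then show ?thesis using u by (simp add: smooth_compact_support_def smooth_partial)
qed

lemma scs_partials: "smooth_compact_support u \<Longrightarrow> smooth_compact_support (partials ks u)"
  by (induction ks) (auto simp: partials_Cons intro: scs_partial)

lemma scs_bounds:
  fixes u :: "real ^ 'n::finite \<Rightarrow> 'a::real_normed_vector"
  assumes u: "smooth_compact_support u"
  obtains R B where "0 \<le> B" "\<And>x. norm (u x) \<le> B" "\<And>x. R < norm x \<Longrightarrow> u x = 0"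
proof -
  let ?S = "closure {x. u x \<noteq> 0}"
  have S: "compact ?S" using u by (simp add: smooth_compact_support_def)
  obtain R where R: "\<And>x. x \<in> ?S \<Longrightarrow> norm x \<le> R"
    using compact_imp_bounded[OF S] unfolding bounded_iff by blast
  have "compact (u ` ?S)"
    by (intro compact_continuous_image S continuous_on_subset[OF smooth_continuous[OF scs_smooth[OF u]]]) auto
  then have "bounded (u ` ?S)" by (rule compact_imp_bounded)
  then obtain B where B: "\<And>x. x \<in> ?S \<Longrightarrow> norm (u x) \<le> B"
    unfolding bounded_iff by blast
  have z: "u x = 0" if "x \<notin> ?S" for x using that closure_subset[of "{x. u x \<noteq> 0}"] by auto
  show ?thesis
  proof (rule that[of "max B 0" R])
    show "norm (u x) \<le> max B 0" for x using B[of x] z[of x] by (cases "x \<in> ?S") auto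
    show "u x = 0" if "R < norm x" for x using R[of x] z[of x] that by force
  qed simp
qed

lemma scs_integrable:
  fixes u :: "real ^ 'n::finite \<Rightarrow> 'a::{banach, second_countable_topology}"
  assumes u: "smooth_compact_support u"
  shows "integrable lborel u"
proof -
  obtain R B where B: "0 \<le> B" "\<And>x. norm (u x) \<le> B" and R: "\<And>x. R < norm x \<Longrightarrow> u x = 0"
    by (rule scs_bounds[OF u]) blast
  show ?thesis
  proof (rule Bochner_Integration.integrable_bound)
    have "emeasure lborel (cball 0 R :: (real ^ 'n) set) < \<infinity>" by (rule emeasure_bounded_finite) simp
    then show "integrable lborel (\<lambda>x :: real ^ 'n. indicator (cball 0 R) x *\<^sub>R B)"
      by (intro integrable_scaleR_left integrable_real_indicator) auto
    show "u \<in> borel_measurable lborel"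
      using borel_measurable_continuous_onI[OF smooth_continuous[OF scs_smooth[OF u]]] by simp
    show "AE x in lborel. norm (u x) \<le> norm (indicator (cball 0 R) x *\<^sub>R B)"
      using B R by (intro AE_I2) (auto simp: indicator_def not_le)
  qed
qed

lemma scs_partial_component_fourier:
  fixes u :: "real ^ 'n::finite \<Rightarrow> complex ^ 'm::finite"
  assumes u: "smooth_compact_support u"
  shows "fourier (\<lambda>y. partial k u y $ j) w = - (\<i> * complex_of_real (w $ k) * fourier (\<lambda>y. u y $ j) w)"
proof (rule fourier_partial)
  show "continuous_on UNIV (\<lambda>y. u y $ j)"
    by (intro continuous_intros smooth_continuous scs_smooth u)
  show "integrable lborel (\<lambda>y. u y $ j)"
    by (rule integrable_bounded_linear[OF bounded_linear_vec_nth scs_integrable[OF u]])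
  show "integrable lborel (\<lambda>y. partial k u y $ j)"
    by (rule integrable_bounded_linear[OF bounded_linear_vec_nth scs_integrable[OF scs_partial[OF u]]])
  show "((\<lambda>t. u (z + t *\<^sub>R axis k 1) $ j) has_vector_derivative partial k u z $ j) (at 0)" for z
    by (rule bounded_linear.has_vector_derivative[OF bounded_linear_vec_nth smooth_has_partial[OF scs_smooth[OF u]]])
qed

lemma prod_power_count_Cons:
  fixes g :: "'n::finite \<Rightarrow> 'a::comm_monoid_mult"
  shows "(\<Prod>k\<in>UNIV. g k ^ count_list (a # ks) k) = g a * (\<Prod>k\<in>UNIV. g k ^ count_list ks k)"
proof -
  have "(\<Prod>k\<in>UNIV. g k ^ count_list (a # ks) k) = (\<Prod>k\<in>UNIV. (if k = a then g k else 1) * g k ^ count_list ks k)"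
    by (intro prod.cong) auto
  then show ?thesis by (simp add: prod.distrib)
qed

lemma fourier_partials:
  fixes u :: "real ^ 'n::finite \<Rightarrow> complex ^ 'm::finite"
  assumes u: "smooth_compact_support u"
  shows "fourier (\<lambda>y. partials ks u y $ j) (- z)
    = (\<Prod>k\<in>UNIV. (\<i> * complex_of_real (z $ k)) ^ count_list ks k) * fourier (\<lambda>y. u y $ j) (- z)"
proof (induction ks)
  case (Cons a ks)
  have "fourier (\<lambda>y. partials (a # ks) u y $ j) (- z)
      = (\<i> * complex_of_real (z $ a)) * fourier (\<lambda>y. partials ks u y $ j) (- z)"
    using scs_partial_component_fourier[OF scs_partials[OF u]] by (simp add: partials_Cons)
  then show ?case unfolding Cons.IH by (simp only: prod_power_count_Cons mult.assoc)
qed simp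

text \<open>The choice of an order of differentiation in \<^const>\<open>multi_deriv\<close> disappears here, since the multiplier
  depends only on the number of derivatives in each direction.\<close>

lemma fourier_multi_deriv:
  fixes u :: "real ^ 'n::finite \<Rightarrow> complex ^ 'm::finite"
  assumes u: "smooth_compact_support u"
  shows "fourier (\<lambda>y. multi_deriv \<alpha> u y $ j) (- z)
    = (\<Prod>k\<in>UNIV. (\<i> * complex_of_real (z $ k)) ^ \<alpha> k) * fourier (\<lambda>y. u y $ j) (- z)"
  using someI_ex[OF ex_list_of_multi_index[of \<alpha>]] fourier_partials[OF u]
  by (simp add: multi_deriv_def)

text \<open>Differentiating \<open>r\<close> times in direction \<open>k\<close> multiplies the transform by the \<open>r\<close>-th power of
  \<open>w k\<close>, up to a unit factor, so all such products are bounded.\<close>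

lemma scs_fourier_integrable:
  fixes u :: "real ^ 'n::finite \<Rightarrow> complex ^ 'm::finite"
  assumes u: "smooth_compact_support u"
  shows "integrable lborel (fourier (\<lambda>y. u y $ j))"
proof (rule integrable_coordinate_decay)
  have i: "integrable lborel (\<lambda>y. partials ks u y $ j)" for ks
    by (rule integrable_bounded_linear[OF bounded_linear_vec_nth scs_integrable[OF scs_partials[OF u]]])
  show "fourier (\<lambda>y. u y $ j) \<in> borel_measurable borel"
    using i[of "[]"] by (intro measurable_fourier) simp
  show "norm (fourier (\<lambda>y. u y $ j) w) \<le> (LINT y|lborel. norm (u y $ j))" for w
    using i[of "[]"] by (intro norm_fourier_le) simp
  show "\<exists>C. \<forall>w. \<bar>w $ k\<bar> ^ (2 * CARD('n)) * norm (fourier (\<lambda>y. u y $ j) w) \<le> C" for k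
  proof -
    have "\<bar>w $ k\<bar> ^ r * norm (fourier (\<lambda>y. u y $ j) w) = norm (fourier (\<lambda>y. partials (replicate r k) u y $ j) w)" for r w
    proof (induction r)
      case (Suc r)
      then show ?case
        using scs_partial_component_fourier[OF scs_partials[OF u], of k "replicate r k" j w]
        by (simp add: partials_Cons norm_mult mult.assoc)
    qed simp
    then show ?thesis using norm_fourier_le[OF i] by metis
  qed
qed

section \<open>Convolution with a locally integrable kernel\<close>

lemma bounded_bilinear_matrix_vector_mult:
  "bounded_bilinear ((*v) :: complex ^ 'm::finite ^ 'k::finite \<Rightarrow> complex ^ 'm \<Rightarrow> complex ^ 'k)"
  unfolding bilinear_conv_bounded_bilinear[symmetric] bilinear_def
  by (auto intro!: linearI simp: vec_eq_iff matrix_vector_mult_def sum.distrib algebra_simps scaleR_sum_right)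

lemma measurable_matrix_vector_mult:
  fixes K :: "'a \<Rightarrow> complex ^ 'm::finite ^ 'k::finite"
  assumes "K \<in> borel_measurable M" "f \<in> borel_measurable M"
  shows "(\<lambda>x. K x *v f x) \<in> borel_measurable M"
  by (rule borel_measurable_continuous_Pair[OF assms])
     (intro bounded_bilinear.continuous_on[OF bounded_bilinear_matrix_vector_mult] continuous_intros)

definition convolve :: "(real ^ 'n::finite \<Rightarrow> complex ^ 'm::finite ^ 'k::finite) \<Rightarrow> (real ^ 'n \<Rightarrow> complex ^ 'm) \<Rightarrow> real ^ 'n \<Rightarrow> complex ^ 'k" where
  "convolve K f x = (LINT y|lborel. K (x - y) *v f y)"

text \<open>In terms of difference quotients a derivative can be computed along sequences, which is the form in
  which dominated convergence applies.\<close>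

lemma has_vector_derivative_at_0_iff:
  fixes f :: "real \<Rightarrow> 'a::real_normed_vector"
  shows "(f has_vector_derivative d) (at 0) \<longleftrightarrow> ((\<lambda>h. (f h - f 0) /\<^sub>R h) \<longlongrightarrow> d) (at 0)"
proof -
  have "norm (f (0 + h) - f 0 - h *\<^sub>R d) / norm h = norm ((f h - f 0) /\<^sub>R h - d)" if "h \<noteq> 0" for h :: real
  proof -
    have "(f h - f 0) /\<^sub>R h - d = (f h - f 0 - h *\<^sub>R d) /\<^sub>R h"
      using that by (simp add: scaleR_diff_right)
    then show ?thesis by (simp add: divide_inverse_commute)
  qed
  then have "((\<lambda>h. norm (f (0 + h) - f 0 - h *\<^sub>R d) / norm h) \<longlongrightarrow> 0) (at 0)
      \<longleftrightarrow> ((\<lambda>h. norm ((f h - f 0) /\<^sub>R h - d)) \<longlongrightarrow> 0) (at 0)"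
    by (intro tendsto_cong) (auto simp: eventually_at_filter)
  then show ?thesis
    unfolding has_vector_derivative_def has_derivative_at
    by (simp add: tendsto_norm_zero_iff LIM_zero_iff bounded_linear_scaleR_left)
qed

context
  fixes K :: "real ^ 'n::finite \<Rightarrow> complex ^ 'm::finite ^ 'k::finite"
  assumes K_meas [measurable]: "K \<in> borel_measurable borel"
    and K_int: "\<And>r. integrable lborel (\<lambda>x. indicator (cball 0 r) x *\<^sub>R K x)"
begin

lemma local_domination:
  obtains c where "0 \<le> c" "\<And>g B r y. \<lbrakk>\<And>y. norm (g y) \<le> B; \<And>y. r < norm y \<Longrightarrow> g y = 0\<rbrakk> \<Longrightarrow>
    norm (K y *v g y) \<le> c * B * norm (indicator (cball 0 r) y *\<^sub>R K y)"
proof -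
  obtain c where c: "0 < c" "\<And>M v. norm ((M :: complex ^ 'm ^ 'k) *v v) \<le> norm M * norm v * c"
    using bounded_bilinear.pos_bounded[OF bounded_bilinear_matrix_vector_mult] by blast
  show ?thesis
  proof (rule that[of c])
    fix g :: "real ^ 'n \<Rightarrow> complex ^ 'm" and B r y
    assume B: "\<And>y. norm (g y) \<le> B" and r: "\<And>y. r < norm y \<Longrightarrow> g y = 0"
    show "norm (K y *v g y) \<le> c * B * norm (indicator (cball 0 r) y *\<^sub>R K y)"
    proof (cases "r < norm y")
      case True
      then show ?thesis by (simp add: r matrix_vector_mult_0_right)
    next
      case False
      have "norm (K y *v g y) \<le> norm (K y) * norm (g y) * c" by (rule c)
      also have "\<dots> \<le> norm (K y) * B * c" using c(1) B by (intro mult_right_mono mult_left_mono) auto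
      finally show ?thesis using False by (simp add: mult_ac)
    qed
  qed (use c in simp)
qed

lemma integrable_mult_bounded_support:
  fixes g :: "real ^ 'n \<Rightarrow> complex ^ 'm"
  assumes [measurable]: "g \<in> borel_measurable borel"
    and B: "\<And>y. norm (g y) \<le> B" and r: "\<And>y. r < norm y \<Longrightarrow> g y = 0"
  shows "integrable lborel (\<lambda>y. K y *v g y)"
proof -
  obtain c where c: "0 \<le> c" "\<And>g B r y. \<lbrakk>\<And>y. norm (g y) \<le> B; \<And>y. r < norm y \<Longrightarrow> g y = 0\<rbrakk> \<Longrightarrow>
    norm (K y *v g y) \<le> c * B * norm (indicator (cball 0 r) y *\<^sub>R K y)"
    by (rule local_domination) blast
  show ?thesis
  proof (rule Bochner_Integration.integrable_bound)
    show "integrable lborel (\<lambda>y. c * B * norm (indicator (cball 0 r) y *\<^sub>R K y))"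
      by (intro integrable_mult_right integrable_norm K_int)
    show "(\<lambda>y. K y *v g y) \<in> borel_measurable lborel"
      by (intro measurable_matrix_vector_mult) auto
    show "AE y in lborel. norm (K y *v g y) \<le> norm (c * B * norm (indicator (cball 0 r) y *\<^sub>R K y))"
      by (intro AE_I2 order_trans[OF c(2)[OF B r]]) (auto intro: abs_ge_self)
  qed
qed

text \<open>A common bound and a common ball containing the supports give an integrable majorant.\<close>

lemma integral_mult_tendsto:
  fixes g :: "nat \<Rightarrow> real ^ 'n \<Rightarrow> complex ^ 'm"
  assumes m [measurable]: "\<And>j. g j \<in> borel_measurable borel" "g' \<in> borel_measurable borel"
    and B: "\<And>j y. norm (g j y) \<le> B" and r: "\<And>j y. r < norm y \<Longrightarrow> g j y = 0"
    and lim: "\<And>y. (\<lambda>j. g j y) \<longlonglongrightarrow> g' y"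
  shows "(\<lambda>j. LINT y|lborel. K y *v g j y) \<longlonglongrightarrow> (LINT y|lborel. K y *v g' y)"
proof -
  obtain c where c: "0 \<le> c" "\<And>g B r y. \<lbrakk>\<And>y. norm (g y) \<le> B; \<And>y. r < norm y \<Longrightarrow> g y = 0\<rbrakk> \<Longrightarrow>
    norm (K y *v g y) \<le> c * B * norm (indicator (cball 0 r) y *\<^sub>R K y)"
    by (rule local_domination) blast
  show ?thesis
  proof (rule integral_dominated_convergence)
    show "integrable lborel (\<lambda>y. c * B * norm (indicator (cball 0 r) y *\<^sub>R K y))"
      by (intro integrable_mult_right integrable_norm K_int)
    show "AE y in lborel. norm (K y *v g j y) \<le> c * B * norm (indicator (cball 0 r) y *\<^sub>R K y)" for j
      by (intro AE_I2 c(2) B r)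
    show "AE y in lborel. (\<lambda>j. K y *v g j y) \<longlonglongrightarrow> K y *v g' y"
      by (intro AE_I2 bounded_bilinear.tendsto[OF bounded_bilinear_matrix_vector_mult] tendsto_const lim)
  qed (auto intro!: measurable_matrix_vector_mult)
qed

context
  fixes f :: "real ^ 'n \<Rightarrow> complex ^ 'm"
  assumes f: "smooth_compact_support f"
begin

lemma f_measurable [measurable]: "f \<in> borel_measurable borel"
  by (intro borel_measurable_continuous_onI smooth_continuous scs_smooth f)

lemma convolve_eq: "convolve K f x = (LINT y|lborel. K y *v f (x - y))"
proof -
  have "(LINT y|lborel. K (x - (x - y)) *v f (x - y)) = (LINT y|lborel. K (x - y) *v f y)"
    by (rule integral_reflect) (intro measurable_matrix_vector_mult; measurable)
  then show ?thesis by (simp add: convolve_def)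
qed

lemma convolve_integrable: "integrable lborel (\<lambda>y. K (x - y) *v f y)"
proof -
  obtain R B where B: "\<And>x. norm (f x) \<le> B" and R: "\<And>x. R < norm x \<Longrightarrow> f x = 0"
    by (rule scs_bounds[OF f]) blast
  have "integrable lborel (\<lambda>y. K y *v f (x - y))"
  proof (rule integrable_mult_bounded_support)
    show "f (x - y) = 0" if "norm x + R < norm y" for y
      using norm_triangle_ineq2[of y x] that by (intro R) (simp add: norm_minus_commute)
  qed (use B in auto)
  from integrable_reflect[OF this, of x] show ?thesis by simp
qed

lemma continuous_on_convolve: "continuous_on UNIV (convolve K f)"
proof (rule continuous_at_imp_continuous_on, rule ballI, rule continuous_at_sequentiallyI)
  obtain R B where B: "\<And>x. norm (f x) \<le> B" and R: "\<And>x. R < norm x \<Longrightarrow> f x = 0"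
    by (rule scs_bounds[OF f]) blast
  fix x and u :: "nat \<Rightarrow> real ^ 'n" assume u: "u \<longlonglongrightarrow> x"
  obtain M where M: "\<And>j. norm (u j) \<le> M"
    using convergent_imp_Bseq[OF convergentI[OF u]] unfolding Bseq_def by blast
  show "(\<lambda>j. convolve K f (u j)) \<longlonglongrightarrow> convolve K f x"
    unfolding convolve_eq
  proof (rule integral_mult_tendsto)
    show "f (u j - y) = 0" if "M + R < norm y" for j y
      using norm_triangle_ineq2[of y "u j"] M[of j] that by (intro R) (simp add: norm_minus_commute)
    show "(\<lambda>j. f (u j - y)) \<longlonglongrightarrow> f (x - y)" for y
    proof -
      have "isCont f (x - y)"
        using smooth_continuous[OF scs_smooth[OF f]] by (simp add: continuous_on_eq_continuous_at)
      moreover have "(\<lambda>j. u j - y) \<longlonglongrightarrow> x - y" by (intro tendsto_intros u)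
      ultimately show ?thesis by (rule isCont_tendsto_compose)
    qed
  qed (use B in auto)
qed

text \<open>The difference quotients of \<open>f\<close> are bounded by the supremum of the partial derivative and, for a
  bounded sequence of increments, supported in a common ball.\<close>

lemma convolve_has_partial:
  "((\<lambda>t. convolve K f (x + t *\<^sub>R axis k 1)) has_vector_derivative convolve K (partial k f) x) (at 0)"
proof -
  let ?e = "axis k 1 :: real ^ 'n"
  note df = scs_partial[OF f, of k]
  have [measurable]: "partial k f \<in> borel_measurable borel"
    by (intro borel_measurable_continuous_onI smooth_continuous scs_smooth df)
  have conv_df: "convolve K (partial k f) x = (LINT y|lborel. K y *v partial k f (x - y))"
  proof -
    have "(LINT y|lborel. K (x - (x - y)) *v partial k f (x - y)) = (LINT y|lborel. K (x - y) *v partial k f y)"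
      by (rule integral_reflect) (intro measurable_matrix_vector_mult; measurable)
    then show ?thesis by (simp add: convolve_def)
  qed
  obtain R where R: "\<And>x. R < norm x \<Longrightarrow> f x = 0"
    by (rule scs_bounds[OF f]) blast
  obtain B where B0: "0 \<le> B" and B: "\<And>x. norm (partial k f x) \<le> B"
    by (rule scs_bounds[OF df]) blast
  have line: "((\<lambda>t. f (a + t *\<^sub>R ?e)) has_vector_derivative partial k f (a + s *\<^sub>R ?e)) (at s)" for a s
    by (rule has_vector_derivative_along_line) (rule smooth_has_partial[OF scs_smooth[OF f]])
  have lip: "norm (f (a + t *\<^sub>R ?e) - f a) \<le> B * \<bar>t\<bar>" for a t
  proof -
    have "norm (f (a + t *\<^sub>R ?e) - f (a + 0 *\<^sub>R ?e)) \<le> B * norm (t - 0)"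
    proof (rule differentiable_bound[of UNIV "\<lambda>t. f (a + t *\<^sub>R ?e)" "\<lambda>s h. h *\<^sub>R partial k f (a + s *\<^sub>R ?e)"])
      show "((\<lambda>t. f (a + t *\<^sub>R ?e)) has_derivative (\<lambda>h. h *\<^sub>R partial k f (a + s *\<^sub>R ?e))) (at s within UNIV)" for s
        using line[of a s] by (simp add: has_vector_derivative_def)
      show "onorm (\<lambda>h. h *\<^sub>R partial k f (a + s *\<^sub>R ?e)) \<le> B" for s
        by (rule onorm_le) (simp add: B mult.commute[of B] mult_left_mono)
    qed auto
    then show ?thesis by simp
  qed
  show ?thesis
    unfolding has_vector_derivative_at_0_iff tendsto_at_iff_sequentially
  proof (intro allI impI)
    fix u :: "nat \<Rightarrow> real" assume u0: "\<forall>j. u j \<in> UNIV - {0}" and u: "u \<longlonglongrightarrow> 0"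
    obtain M where M: "\<And>j. \<bar>u j\<bar> \<le> M"
      using convergent_imp_Bseq[OF convergentI[OF u]] unfolding Bseq_def by auto
    let ?g = "\<lambda>j y. (f (x + u j *\<^sub>R ?e - y) - f (x - y)) /\<^sub>R u j"
    have i: "integrable lborel (\<lambda>y. K y *v f (z - y))" for z
      using integrable_reflect[OF convolve_integrable[of z], of z] by simp
    have g: "(convolve K f (x + u j *\<^sub>R ?e) - convolve K f (x + 0 *\<^sub>R ?e)) /\<^sub>R u j = (LINT y|lborel. K y *v ?g j y)" for j
    proof -
      have "convolve K f (x + u j *\<^sub>R ?e) - convolve K f (x + 0 *\<^sub>R ?e)
          = (LINT y|lborel. K y *v f (x + u j *\<^sub>R ?e - y) - K y *v f (x - y))"
        unfolding convolve_eq using i by simp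
      also have "\<dots> = (LINT y|lborel. K y *v (f (x + u j *\<^sub>R ?e - y) - f (x - y)))"
        by (simp add: matrix_vector_mult_diff_distrib)
      finally show ?thesis
        by (simp add: bounded_bilinear.scaleR_right[OF bounded_bilinear_matrix_vector_mult])
    qed
    have "(\<lambda>j. LINT y|lborel. K y *v ?g j y) \<longlonglongrightarrow> (LINT y|lborel. K y *v partial k f (x - y))"
    proof (rule integral_mult_tendsto)
      show "?g j \<in> borel_measurable borel" for j by measurable
      show "norm (?g j y) \<le> B" for j y
      proof -
        have "x - y + u j *\<^sub>R ?e = x + u j *\<^sub>R ?e - y" by simp
        then have "norm (f (x + u j *\<^sub>R ?e - y) - f (x - y)) \<le> B * \<bar>u j\<bar>"
          using lip[of "x - y" "u j"] by (simp only:)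
        moreover have "u j \<noteq> 0" using u0 by auto
        ultimately show ?thesis by (simp add: divide_inverse_commute[symmetric] divide_le_eq)
      qed
      show "?g j y = 0" if "norm x + M + R < norm y" for j y
      proof -
        have "norm (x + u j *\<^sub>R ?e) \<le> norm x + M"
          using norm_triangle_ineq[of x "u j *\<^sub>R ?e"] M[of j] by simp
        then have "R < norm (x + u j *\<^sub>R ?e - y)"
          using norm_triangle_ineq2[of y "x + u j *\<^sub>R ?e"] that by (simp add: norm_minus_commute)
        moreover have "R < norm (x - y)"
          using norm_triangle_ineq2[of y x] that order_trans[OF abs_ge_zero M[of 0]] by (simp add: norm_minus_commute)
        ultimately show ?thesis by (simp add: R)
      qed
      show "(\<lambda>j. ?g j y) \<longlonglongrightarrow> partial k f (x - y)" for y
      proof -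
        have "((\<lambda>h. (f (x - y + h *\<^sub>R ?e) - f (x - y + 0 *\<^sub>R ?e)) /\<^sub>R h) \<longlongrightarrow> partial k f (x - y)) (at 0)"
          using smooth_has_partial[OF scs_smooth[OF f], of "x - y" k]
          unfolding has_vector_derivative_at_0_iff .
        then have "((\<lambda>h. (f (x - y + h *\<^sub>R ?e) - f (x - y + 0 *\<^sub>R ?e)) /\<^sub>R h) \<circ> u) \<longlonglongrightarrow> partial k f (x - y)"
          using u u0 unfolding tendsto_at_iff_sequentially by blast
        then show ?thesis by (simp add: o_def algebra_simps)
      qed
    qed measurable
    then show "((\<lambda>h. (convolve K f (x + h *\<^sub>R ?e) - convolve K f (x + 0 *\<^sub>R ?e)) /\<^sub>R h) \<circ> u)
        \<longlonglongrightarrow> convolve K (partial k f) x"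
      unfolding o_def g conv_df .
  qed
qed

end

lemma partials_convolve:
  "smooth_compact_support f \<Longrightarrow> partials ks (convolve K f) = convolve K (partials ks f)"
proof (induction ks)
  case (Cons k ks)
  have "partial k (convolve K (partials ks f)) x = convolve K (partial k (partials ks f)) x" for x
    unfolding partial_def[of k "convolve K (partials ks f)"]
    by (rule vector_derivative_at) (rule convolve_has_partial[OF scs_partials[OF Cons.prems]])
  then have "partial k (convolve K (partials ks f)) = convolve K (partial k (partials ks f))" ..
  then show ?case using Cons by (simp add: partials_Cons)
qed simp

lemma smooth_convolve:
  assumes f: "smooth_compact_support f"
  shows "smooth (convolve K f)"
  unfolding smooth_def partials_convolve[OF f]
  using continuous_on_convolve[OF scs_partials[OF f]]
    differentiableI_vector[OF convolve_has_partial[OF scs_partials[OF f]]]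
  by blast

lemma multi_deriv_convolve:
  "smooth_compact_support f \<Longrightarrow> multi_deriv \<alpha> (convolve K f) = convolve K (multi_deriv \<alpha> f)"
  unfolding multi_deriv_def by (rule partials_convolve)

end

lemma scs_multi_deriv: "smooth_compact_support f \<Longrightarrow> smooth_compact_support (multi_deriv \<alpha> f)"
  unfolding multi_deriv_def by (rule scs_partials)

section \<open>Potentials of a scalar symbol\<close>

definition heat_kernel :: "('n::finite \<Rightarrow> nat) \<Rightarrow> (real ^ 'n \<Rightarrow> complex) \<Rightarrow> real \<Rightarrow> real ^ 'n \<Rightarrow> complex" where
  "heat_kernel ls q t = fourier (\<lambda>z. of_real (sigma ls z * exp (- t * sigma ls z)) * q z)"

text \<open>The normalisation that makes the time integral of \<open>\<sigma> exp (- t \<sigma>)\<close> a resolution of the constant 1.\<close>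

lemma has_bochner_integral_sigma_exp:
  assumes "z \<noteq> 0"
  shows "has_bochner_integral lborel (\<lambda>t. indicator {0<..} t * (sigma ls z * exp (- t * sigma ls z))) 1"
proof -
  note p = sigma_pos[OF assms, of ls]
  have "has_bochner_integral lborel (\<lambda>t. sigma ls z * (indicator {0..} t * exp (- t * sigma ls z))) 1"
    using has_bochner_integral_mult_right[OF has_bochner_integral_exp_tail[OF p, of 0], of "sigma ls z"] p by simp
  moreover have "AE t in lborel. sigma ls z * (indicator {0..} t * exp (- t * sigma ls z))
      = indicator {0<..} t * (sigma ls z * exp (- t * sigma ls z))"
    using AE_lborel_singleton[of 0] by eventually_elim (auto simp: indicator_def)
  ultimately show ?thesis
    by (subst has_bochner_integral_cong_AE[symmetric]) auto
qed

text \<open>The factor \<open>\<sigma> exp (- t \<sigma>)\<close> is nonnegative with time integral 1, so the double integral converges absolutely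
  as soon as \<open>\<phi>\<close> is integrable, and Fubini applies.\<close>

lemma iterated_integral_regularization:
  fixes \<phi> :: "real ^ 'n::finite \<Rightarrow> complex"
  assumes int: "integrable lborel \<phi>"
  shows "(LINT t|lborel. indicator {0<..} t *\<^sub>R (LINT z|lborel.
      of_real (sigma ls z * exp (- t * sigma ls z)) * \<phi> z)) = (LINT z|lborel. \<phi> z)"
proof -
  have [measurable]: "\<phi> \<in> borel_measurable borel" using int by simp
  let ?w = "\<lambda>z t. indicator {0<..} t * (sigma ls z * exp (- t * sigma ls z))"
  let ?G = "\<lambda>z t. ?w z t *\<^sub>R \<phi> z"
  have hb: "has_bochner_integral lborel (?w z) 1" if "z \<noteq> 0" for z :: "real ^ 'n"
    by (rule has_bochner_integral_sigma_exp[OF that])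
  have hb': "has_bochner_integral lborel (\<lambda>t. ?w z t *\<^sub>R c) c" if "z \<noteq> 0" for z :: "real ^ 'n" and c :: "'b::{banach, second_countable_topology}"
    using has_bochner_integral_scaleR_left[OF hb[OF that], of c] by simp
  have w0: "norm (?G z t) = ?w z t *\<^sub>R norm (\<phi> z)" for z t
    by (simp add: abs_mult)
  have joint: "integrable (lborel \<Otimes>\<^sub>M lborel) (case_prod ?G)"
  proof (rule lborel_pair.Fubini_integrable)
    show "case_prod ?G \<in> borel_measurable (lborel \<Otimes>\<^sub>M lborel)" by measurable
    have "AE z in lborel. norm (\<phi> z) = (LINT t|lborel. norm (?G z t))"
      using AE_lborel_singleton[of 0]
    proof eventually_elim
      fix z :: "real ^ 'n" assume "z \<noteq> 0"
      from has_bochner_integral_integral_eq[OF hb'[OF this, of "norm (\<phi> z)"]]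
      show "norm (\<phi> z) = (LINT t|lborel. norm (?G z t))" unfolding w0 by simp
    qed
    then show "integrable lborel (\<lambda>z. LINT t|lborel. norm (case (z, t) of (z, t) \<Rightarrow> ?G z t))"
      using integrable_norm[OF int] by (subst integrable_cong_AE[symmetric]) auto
    show "AE z in lborel. integrable lborel (\<lambda>t. case (z, t) of (z, t) \<Rightarrow> ?G z t)"
      using AE_lborel_singleton[of 0]
    proof eventually_elim
      fix z :: "real ^ 'n" assume "z \<noteq> 0"
      from hb'[OF this, of "\<phi> z"]
      show "integrable lborel (\<lambda>t. case (z, t) of (z, t) \<Rightarrow> ?G z t)"
        unfolding has_bochner_integral_iff by simp
    qed
  qed
  have "(LINT t|lborel. indicator {0<..} t *\<^sub>R (LINT z|lborel. of_real (sigma ls z * exp (- t * sigma ls z)) * \<phi> z))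
      = (LINT t|lborel. LINT z|lborel. ?G z t)"
  proof (rule Bochner_Integration.integral_cong[OF refl])
    fix t :: real
    have "?G z t = indicator {0<..} t *\<^sub>R (of_real (sigma ls z * exp (- t * sigma ls z)) * \<phi> z)" for z
      by (simp add: scaleR_conv_of_real)
    then show "indicator {0<..} t *\<^sub>R (LINT z|lborel. of_real (sigma ls z * exp (- t * sigma ls z)) * \<phi> z)
        = (LINT z|lborel. ?G z t)" by (simp only: integral_scaleR_right)
  qed
  also have "\<dots> = (LINT z|lborel. LINT t|lborel. ?G z t)"
    by (rule lborel_pair.Fubini_integral[OF joint])
  also have "\<dots> = (LINT z|lborel. \<phi> z)"
  proof (rule integral_cong_AE)
    show "AE z in lborel. (LINT t|lborel. ?G z t) = \<phi> z"
      using AE_lborel_singleton[of 0]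
    proof eventually_elim
      fix z :: "real ^ 'n" assume "z \<noteq> 0"
      from has_bochner_integral_integral_eq[OF hb'[OF this, of "\<phi> z"]]
      show "(LINT t|lborel. ?G z t) = \<phi> z" .
    qed
  qed measurable
  finally show ?thesis .
qed

context quasihomogeneous_quotient
begin

lemma heat_deriv_0_eq: "heat_deriv 0 t = heat_kernel ls q t"
  by (simp add: heat_deriv_def heat_kernel_def heat_symbol_def[abs_def])

lemma measurable_heat_kernel: "(\<lambda>p. heat_kernel ls q (fst p) (snd p)) \<in> borel_measurable (borel \<Otimes>\<^sub>M borel)"
  using measurable_heat_deriv[of 0] by (simp add: heat_deriv_0_eq)

lemma measurable_heat_kernel_lborel:
  "(\<lambda>(t, y). ennreal (indicator {0<..} t * indicator (cball 0 r) y * norm (heat_kernel ls q t y))) \<in> borel_measurable (lborel \<Otimes>\<^sub>M lborel)"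
proof -
  have "(\<lambda>p. heat_kernel ls q (fst p) (snd p)) \<in> borel_measurable (lborel \<Otimes>\<^sub>M lborel)"
    using measurable_heat_kernel by (simp cong: measurable_cong_sets sets_pair_measure_cong)
  moreover have "(\<lambda>p. indicat_real (cball (0 :: real ^ 'n) r) (snd p)) \<in> borel_measurable (lborel \<Otimes>\<^sub>M lborel)"
    by (rule measurable_compose[OF measurable_snd], rule borel_measurable_indicator) simp
  moreover have "(\<lambda>p. indicat_real {0::real<..} (fst p)) \<in> borel_measurable (lborel \<Otimes>\<^sub>M (lborel :: (real ^ 'n) measure))"
    by (rule measurable_compose[OF measurable_fst], rule borel_measurable_indicator) simp
  ultimately show ?thesis
    unfolding case_prod_beta'
    by (intro measurable_compose[OF _ measurable_ennreal] borel_measurable_times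
        measurable_compose[OF _ borel_measurable_norm])
qed

lemma heat_kernel_locally_integrable:
  "homdim > 1 \<Longrightarrow> (\<integral>\<^sup>+t. (\<integral>\<^sup>+y. ennreal (indicator {0<..} t * indicator (cball 0 r) y * norm (heat_kernel ls q t y)) \<partial>lborel) \<partial>lborel) < \<infinity>"
  using heat_deriv_locally_integrable[of r] by (simp add: heat_deriv_0_eq)

lemma heat_integrable:
  "0 < t \<Longrightarrow> integrable lborel (\<lambda>z. exp (\<i> * complex_of_real (x \<bullet> z)) * (of_real (sigma ls z * exp (- t * sigma ls z)) * q z))"
  using integrable_fourier_integrand[OF heat_symbol_integrable[of t 0], of x] by (simp add: heat_symbol_def)

lemma heat_convolve:
  assumes t: "0 < t" and g: "integrable lborel g"
  shows "(LINT y|lborel. heat_kernel ls q t (x - y) * g y)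
    = (LINT z|lborel. of_real (sigma ls z * exp (- t * sigma ls z)) * (exp (\<i> * complex_of_real (x \<bullet> z)) * q z * fourier g (- z)))"
proof -
  have [measurable]: "g \<in> borel_measurable borel" using g by simp
  let ?G = "\<lambda>z y. exp (\<i> * complex_of_real ((x - y) \<bullet> z)) * heat_symbol 0 t z * g y"
  have joint: "integrable (lborel \<Otimes>\<^sub>M lborel) (case_prod ?G)"
  proof (rule lborel_pair.Fubini_integrable)
    show "case_prod ?G \<in> borel_measurable (lborel \<Otimes>\<^sub>M lborel)" by measurable
    have "(LINT y|lborel. norm (?G z y)) = norm (heat_symbol 0 t z) * (LINT y|lborel. norm (g y))" for z
      by (simp add: norm_mult)
    then show "integrable lborel (\<lambda>z. LINT y|lborel. norm (case (z, y) of (z, y) \<Rightarrow> ?G z y))"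
      using heat_symbol_integrable[OF t] by simp
    have "integrable lborel (\<lambda>y. ?G z y)" for z
      by (rule Bochner_Integration.integrable_bound[OF integrable_mult_right[OF g, of "heat_symbol 0 t z"]])
         (auto simp: norm_mult)
    then show "AE z in lborel. integrable lborel (\<lambda>y. case (z, y) of (z, y) \<Rightarrow> ?G z y)" by simp
  qed
  have "(LINT y|lborel. heat_kernel ls q t (x - y) * g y) = (LINT y|lborel. LINT z|lborel. ?G z y)"
    by (simp add: heat_deriv_0_eq[symmetric] heat_deriv_def fourier_def)
  also have "\<dots> = (LINT z|lborel. LINT y|lborel. ?G z y)"
    by (rule lborel_pair.Fubini_integral[OF joint])
  also have "\<dots> = (LINT z|lborel. of_real (sigma ls z * exp (- t * sigma ls z)) * (exp (\<i> * complex_of_real (x \<bullet> z)) * q z * fourier g (- z)))"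
  proof (rule Bochner_Integration.integral_cong[OF refl])
    fix z :: "real ^ 'n"
    have e: "exp (\<i> * complex_of_real ((x - y) \<bullet> z)) = exp (\<i> * complex_of_real (x \<bullet> z)) * exp (\<i> * complex_of_real ((- z) \<bullet> y))" for y
      by (simp add: inner_diff_left inner_commute[of z] right_diff_distrib exp_diff exp_minus divide_inverse)
    have eq: "?G z y = of_real (sigma ls z * exp (- t * sigma ls z)) * (exp (\<i> * complex_of_real (x \<bullet> z)) * q z)
        * (exp (\<i> * complex_of_real ((- z) \<bullet> y)) * g y)" for y
      unfolding e by (simp add: heat_symbol_def mult_ac)
    show "(LINT y|lborel. ?G z y) = of_real (sigma ls z * exp (- t * sigma ls z)) * (exp (\<i> * complex_of_real (x \<bullet> z)) * q z * fourier g (- z))"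
      unfolding eq fourier_def by (simp only: integral_mult_right_zero mult.assoc)
  qed
  finally show ?thesis .
qed

text \<open>Local integrability of the heat kernel in space and time, together with the bounded support of \<open>g\<close>,
  permits integrating over space before time; for each fixed time, \<open>heat_convolve\<close> applies.\<close>

lemma potential_formula:
  assumes N: "homdim > 1" and g: "integrable lborel g" "\<And>y. norm (g y) \<le> B" "\<And>y. R < norm y \<Longrightarrow> g y = 0"
  shows "integrable lborel (\<lambda>y. (LINT t|lborel. indicator {0<..} t *\<^sub>R heat_kernel ls q t (x - y)) * g y)"
    and "integrable lborel (\<lambda>t. indicator {0<..} t *\<^sub>R (LINT z|lborel. of_real (sigma ls z * exp (- t * sigma ls z)) *
        (exp (\<i> * complex_of_real (x \<bullet> z)) * q z * fourier g (- z))))"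
    and "(LINT y|lborel. (LINT t|lborel. indicator {0<..} t *\<^sub>R heat_kernel ls q t (x - y)) * g y)
      = (LINT t|lborel. indicator {0<..} t *\<^sub>R (LINT z|lborel. of_real (sigma ls z * exp (- t * sigma ls z)) *
        (exp (\<i> * complex_of_real (x \<bullet> z)) * q z * fourier g (- z))))"
proof -
  have [measurable]: "g \<in> borel_measurable borel" using g by simp
  note [measurable] = measurable_heat_kernel
  have B0: "0 \<le> B" using g(2)[of 0] norm_ge_zero order_trans by blast
  let ?r = "norm x + R"
  let ?G = "\<lambda>t y. (indicator {0<..} t *\<^sub>R heat_kernel ls q t (x - y)) * g y"
  have hm: "(\<lambda>(t, y). heat_kernel ls q t (x - y)) \<in> borel_measurable (lborel \<Otimes>\<^sub>M lborel)"
  proof -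
    have "(\<lambda>p. heat_kernel ls q (fst (fst p, x - snd p)) (snd (fst p, x - snd p))) \<in> borel_measurable (lborel \<Otimes>\<^sub>M lborel)"
      by (rule measurable_compose[OF _ measurable_heat_kernel]) measurable
    then show ?thesis by (simp add: case_prod_beta')
  qed
  note [measurable] = hm[unfolded case_prod_beta']
  have Gm: "case_prod ?G \<in> borel_measurable (lborel \<Otimes>\<^sub>M lborel)" by measurable
  have hmt [measurable]: "heat_kernel ls q t \<in> borel_measurable borel" for t
    using measurable_heat_deriv'[of 0 t] by (simp add: heat_deriv_0_eq)
  have joint: "integrable (lborel \<Otimes>\<^sub>M lborel) (case_prod ?G)"
  proof (rule integrableI_bounded[OF Gm])
    have "(\<integral>\<^sup>+p. ennreal (norm (case_prod ?G p)) \<partial>(lborel \<Otimes>\<^sub>M lborel)) = (\<integral>\<^sup>+t. (\<integral>\<^sup>+y. ennreal (norm (?G t y)) \<partial>lborel) \<partial>lborel)"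
      using Gm by (subst lborel.nn_integral_fst[symmetric]) auto
    also have "\<dots> \<le> (\<integral>\<^sup>+t. ennreal B * (\<integral>\<^sup>+y. ennreal (indicator {0<..} t * indicator (cball 0 ?r) y * norm (heat_kernel ls q t y)) \<partial>lborel) \<partial>lborel)"
    proof (rule nn_integral_mono)
      fix t :: real
      let ?h = "\<lambda>y. ennreal (indicator {0<..} t * indicator (cball 0 ?r) y * norm (heat_kernel ls q t y))"
      have "ennreal (norm (?G t y)) \<le> ennreal B * ?h (x - y)" for y
      proof (cases "R < norm y")
        case False
        then have "norm (x - y) \<le> ?r" using norm_triangle_ineq4[of x y] by simp
        then have "norm (?G t y) \<le> B * (indicator {0<..} t * indicator (cball 0 ?r) (x - y) * norm (heat_kernel ls q t (x - y)))"
          using g(2)[of y] by (simp add: norm_mult mult_ac mult_left_mono mult_right_mono)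
        then show ?thesis using B0 by (simp add: ennreal_mult[symmetric] ennreal_leI)
      qed (simp add: g(3))
      then have "(\<integral>\<^sup>+y. ennreal (norm (?G t y)) \<partial>lborel) \<le> (\<integral>\<^sup>+y. ennreal B * ?h (x - y) \<partial>lborel)"
        by (intro nn_integral_mono)
      also have "\<dots> = ennreal B * (\<integral>\<^sup>+y. ?h y \<partial>lborel)"
      proof -
        have h: "?h \<in> borel_measurable borel"
          by (intro measurable_compose[OF _ measurable_ennreal] borel_measurable_times borel_measurable_norm hmt
              borel_measurable_indicator) auto
        have "(\<integral>\<^sup>+y. ennreal B * ?h (x - y) \<partial>lborel) = (\<integral>\<^sup>+y. ennreal B * ?h y \<partial>lborel)"
          by (intro nn_integral_reflect borel_measurable_times_ennreal h) simp
        then show ?thesis using h by (simp add: nn_integral_cmult)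
      qed
      finally show "(\<integral>\<^sup>+y. ennreal (norm (?G t y)) \<partial>lborel) \<le> ennreal B * (\<integral>\<^sup>+y. ?h y \<partial>lborel)" .
    qed
    also have "\<dots> = ennreal B * (\<integral>\<^sup>+t. (\<integral>\<^sup>+y. ennreal (indicator {0<..} t * indicator (cball 0 ?r) y * norm (heat_kernel ls q t y)) \<partial>lborel) \<partial>lborel)"
      by (rule nn_integral_cmult lborel.borel_measurable_nn_integral measurable_heat_kernel_lborel)+
    also have "\<dots> < \<infinity>" using heat_kernel_locally_integrable[OF N, of ?r] by (simp add: ennreal_mult_less_top)
    finally show "(\<integral>\<^sup>+p. ennreal (norm (case_prod ?G p)) \<partial>(lborel \<Otimes>\<^sub>M lborel)) < \<infinity>" .
  qed
  have 1: "(LINT t|lborel. ?G t y) = (LINT t|lborel. indicator {0<..} t *\<^sub>R heat_kernel ls q t (x - y)) * g y" for y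
    by (rule integral_mult_left_zero)
  have 2: "(LINT y|lborel. ?G t y) = indicator {0<..} t *\<^sub>R (LINT z|lborel. of_real (sigma ls z * exp (- t * sigma ls z)) *
        (exp (\<i> * complex_of_real (x \<bullet> z)) * q z * fourier g (- z)))" for t
    using heat_convolve[OF _ g(1), of t x] by (cases "0 < t") simp_all
  show "integrable lborel (\<lambda>y. (LINT t|lborel. indicator {0<..} t *\<^sub>R heat_kernel ls q t (x - y)) * g y)"
    using lborel_pair.integrable_snd[OF joint] unfolding 1 .
  show "integrable lborel (\<lambda>t. indicator {0<..} t *\<^sub>R (LINT z|lborel. of_real (sigma ls z * exp (- t * sigma ls z)) *
        (exp (\<i> * complex_of_real (x \<bullet> z)) * q z * fourier g (- z))))"
    using lborel_pair.integrable_fst[OF joint] unfolding 2 .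
  show "(LINT y|lborel. (LINT t|lborel. indicator {0<..} t *\<^sub>R heat_kernel ls q t (x - y)) * g y)
      = (LINT t|lborel. indicator {0<..} t *\<^sub>R (LINT z|lborel. of_real (sigma ls z * exp (- t * sigma ls z)) *
        (exp (\<i> * complex_of_real (x \<bullet> z)) * q z * fourier g (- z))))"
    using lborel_pair.Fubini_integral[OF joint] unfolding 1 2 .
qed

end

section \<open>The symbol and its inverse matrix\<close>

lemma cpoly_det:
  fixes M :: "real ^ 'n::finite \<Rightarrow> complex ^ 'm::finite ^ 'm"
  assumes "\<And>i j. cpoly (\<lambda>x. M x $ i $ j)"
  shows "cpoly (\<lambda>x. det (M x))"
  unfolding det_def by (intro cpoly_intros assms)

lemma symbol_nth:
  "symbol l ls A x $ i $ j = (\<Sum>\<alpha>\<in>indices l ls. (\<Prod>k\<in>UNIV. (\<i> * complex_of_real (x $ k)) ^ \<alpha> k) * A \<alpha> $ i $ j)"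
  by (simp add: symbol_def sum_component cscale_def)

lemma cpoly_symbol: "cpoly (\<lambda>x. symbol l ls A x $ i $ j)"
  unfolding symbol_nth by (intro cpoly_intros)

text \<open>For a multi-index of the operator, \<open>(\<Sum>k. \<alpha> k / ls k) = 1\<close>, so each monomial is homogeneous of
  degree 1.\<close>

lemma symbol_dilate:
  fixes A :: "('n::finite \<Rightarrow> nat) \<Rightarrow> complex ^ 'm::finite ^ 'm"
  assumes l: "0 < l" and c: "0 < c"
  shows "symbol l ls A (dilate ls c x) = cscale (of_real c) (symbol l ls A x)"
proof -
  have "(\<Prod>k\<in>UNIV. (\<i> * complex_of_real (dilate ls c x $ k)) ^ \<alpha> k)
      = of_real c * (\<Prod>k\<in>UNIV. (\<i> * complex_of_real (x $ k)) ^ \<alpha> k)" if \<alpha>: "\<alpha> \<in> indices l ls" for \<alpha>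
  proof -
    have "real l * (\<Sum>k\<in>UNIV. real (\<alpha> k) / real (ls k)) = real l"
      using \<alpha> by (simp add: indices_def weight_def sum_distrib_left mult.commute)
    then have s: "(\<Sum>k\<in>UNIV. real (\<alpha> k) / real (ls k)) = 1" using l by simp
    have "(\<Prod>k\<in>UNIV. (c powr (1 / real (ls k))) ^ \<alpha> k) = (\<Prod>k\<in>UNIV. c powr (real (\<alpha> k) / real (ls k)))"
      using c by (intro prod.cong refl) (simp add: powr_realpow[symmetric] powr_powr)
    also have "\<dots> = c" using c s by (simp add: powr_sum[symmetric])
    finally have p: "(\<Prod>k\<in>UNIV. (c powr (1 / real (ls k))) ^ \<alpha> k) = c" .
    have "(\<Prod>k\<in>UNIV. (\<i> * complex_of_real (dilate ls c x $ k)) ^ \<alpha> k)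
        = (\<Prod>k\<in>UNIV. complex_of_real ((c powr (1 / real (ls k))) ^ \<alpha> k) * (\<i> * complex_of_real (x $ k)) ^ \<alpha> k)"
      by (simp add: dilate_nth power_mult_distrib mult_ac)
    also have "\<dots> = of_real (\<Prod>k\<in>UNIV. (c powr (1 / real (ls k))) ^ \<alpha> k) * (\<Prod>k\<in>UNIV. (\<i> * complex_of_real (x $ k)) ^ \<alpha> k)"
      by (simp only: prod.distrib of_real_prod)
    finally show ?thesis unfolding p .
  qed
  then show ?thesis
    by (simp add: vec_eq_iff symbol_nth cscale_def sum_distrib_left mult.assoc)
qed

lemma det_cscale: "det (cscale c M) = c ^ CARD('m) * det (M :: complex ^ 'm::finite ^ 'm)"
proof -
  have "cscale c M = (\<chi> i. c *s M $ i)" by (simp add: cscale_def vec_eq_iff)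
  then show ?thesis using det_rows_mul[of "\<lambda>_. c" "\<lambda>i. M $ i"] by simp
qed

lemma
  fixes M :: "'a::semiring_1 ^ 'm::finite ^ 'k::finite"
  assumes "invertible M"
  shows matrix_inv_right: "M ** matrix_inv M = mat 1" and matrix_inv_left: "matrix_inv M ** M = mat 1"
  using someI_ex[OF assms[unfolded invertible_def]] unfolding matrix_inv_def by auto

lemma matrix_inv_unique:
  fixes M :: "'a::semiring_1 ^ 'm::finite ^ 'm"
  assumes "M ** N = mat 1" "N ** M = mat 1"
  shows "matrix_inv M = N"
proof -
  have "invertible M" using assms unfolding invertible_def by blast
  then have "matrix_inv M = matrix_inv M ** (M ** N)" by (simp add: assms)
  also have "\<dots> = N" using \<open>invertible M\<close> by (simp add: matrix_mul_assoc matrix_inv_left)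
  finally show ?thesis .
qed

lemma matrix_inv_cscale:
  fixes M :: "complex ^ 'm::finite ^ 'm"
  assumes M: "invertible M" and c: "c \<noteq> 0"
  shows "matrix_inv (cscale c M) = cscale (inverse c) (matrix_inv M)"
proof (rule matrix_inv_unique)
  have mult: "cscale a X ** cscale b Y = cscale (a * b) (X ** Y)" for a b and X Y :: "complex ^ 'm ^ 'm"
    by (simp add: vec_eq_iff cscale_def matrix_matrix_mult_def sum_distrib_left mult_ac)
  have one: "cscale 1 X = X" for X :: "complex ^ 'm ^ 'm" by (simp add: vec_eq_iff cscale_def)
  show "cscale c M ** cscale (inverse c) (matrix_inv M) = mat 1"
    using c matrix_inv_right[OF M] by (simp add: mult one)
  show "cscale (inverse c) (matrix_inv M) ** cscale c M = mat 1"
    using c matrix_inv_left[OF M] by (simp add: mult one)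
qed

text \<open>Cramer's rule for the columns of the inverse.\<close>

lemma matrix_inv_nth:
  fixes M :: "complex ^ 'm::finite ^ 'm"
  assumes M: "invertible M"
  shows "matrix_inv M $ i $ j = det (\<chi> p q. if q = i then (if p = j then 1 else 0) else M $ p $ q) / det M"
proof -
  have "M *v column j (matrix_inv M) = column j (M ** matrix_inv M)"
    by (simp add: vec_eq_iff column_def matrix_vector_mult_def matrix_matrix_mult_def)
  also have "\<dots> = (\<chi> p. if p = j then 1 else 0)"
    using matrix_inv_right[OF M] by (simp add: vec_eq_iff column_def mat_def)
  finally have "column j (matrix_inv M) = (\<chi> k. det (\<chi> p q. if q = k then (\<chi> p. if p = j then 1 else 0) $ p else M $ p $ q) / det M)"
    using cramer[of M] M by (simp add: invertible_det_nz)
  then have "column j (matrix_inv M) $ i = (\<chi> k. det (\<chi> p q. if q = k then (\<chi> p. if p = j then 1 else 0) $ p else M $ p $ q) / det M) $ i"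
    by simp
  then show ?thesis by (simp add: column_def cong: if_cong)
qed

lemma quasihomogeneous_quotient_symbol:
  fixes A :: "('n::finite \<Rightarrow> nat) \<Rightarrow> complex ^ 'm::finite ^ 'm"
  assumes A: "semielliptic l ls A"
  shows "quasihomogeneous_quotient ls (\<lambda>z. det (symbol l ls A z)) CARD('m)
    (\<lambda>z. det (\<chi> p q. if q = i then (if p = j then 1 else 0) else symbol l ls A z $ p $ q))
    (\<lambda>z. matrix_inv (symbol l ls A z) $ i $ j)"
proof
  have l: "0 < l" and ls: "\<And>k. 0 < ls k" and inv: "\<And>x. x \<noteq> 0 \<Longrightarrow> invertible (symbol l ls A x)"
    using A by (auto simp: semielliptic_def)
  show "0 < ls k" for k by (rule ls)
  show "cpoly (\<lambda>z. det (symbol l ls A z))" by (intro cpoly_det cpoly_symbol)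
  show "det (symbol l ls A z) \<noteq> 0" if "z \<noteq> 0" for z
    using inv[OF that] by (simp add: invertible_det_nz)
  show "det (symbol l ls A (dilate ls c z)) = of_real (c ^ CARD('m)) * det (symbol l ls A z)" if "0 < c" for c z
    by (simp add: symbol_dilate[OF l that] det_cscale)
  show "cpoly (\<lambda>z. det (\<chi> p q. if q = i then (if p = j then 1 else 0) else symbol l ls A z $ p $ q))"
  proof (rule cpoly_det)
    show "cpoly (\<lambda>z. (\<chi> p q. if q = i then (if p = j then 1 else 0) else symbol l ls A z $ p $ q) $ p $ q)" for p q
      by (cases "q = i") (simp_all add: cpoly_const cpoly_symbol)
  qed
  show "matrix_inv (symbol l ls A z) $ i $ j
      = det (\<chi> p q. if q = i then (if p = j then 1 else 0) else symbol l ls A z $ p $ q) / det (symbol l ls A z)" if "z \<noteq> 0" for z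
    by (rule matrix_inv_nth[OF inv[OF that]])
  show "matrix_inv (symbol l ls A (dilate ls c z)) $ i $ j = matrix_inv (symbol l ls A z) $ i $ j / of_real c"
    if "0 < c" "z \<noteq> 0" for c z
  proof -
    have "matrix_inv (symbol l ls A (dilate ls c z)) = cscale (inverse (of_real c)) (matrix_inv (symbol l ls A z))"
      unfolding symbol_dilate[OF l that(1)] using that by (intro matrix_inv_cscale inv) auto
    then show ?thesis by (simp add: cscale_def divide_inverse mult.commute)
  qed
qed

section \<open>The fundamental solution\<close>

lemma bounded_linear_axis: "bounded_linear (axis j :: 'b::euclidean_space \<Rightarrow> 'b ^ 'm::finite)"
  unfolding linear_conv_bounded_linear[symmetric] by (rule linearI) (simp_all add: vec_eq_iff axis_def)

lemma vec_eq_sum_axis: "v = (\<Sum>j\<in>UNIV. axis j (v $ j))" for v :: "'b::euclidean_space ^ 'm::finite"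
  by (simp add: vec_eq_iff sum_component axis_def if_distrib cong: if_cong)

lemma measurable_vecI:
  fixes h :: "'a \<Rightarrow> 'b::euclidean_space ^ 'm::finite"
  assumes "\<And>j. (\<lambda>x. h x $ j) \<in> borel_measurable M"
  shows "h \<in> borel_measurable M"
proof -
  have "(\<lambda>x. \<Sum>j\<in>UNIV. axis j (h x $ j)) \<in> borel_measurable M"
    by (intro borel_measurable_sum measurable_compose[OF assms] borel_measurable_continuous_onI
        linear_continuous_on bounded_linear_axis)
  then show ?thesis using vec_eq_sum_axis[of "h _"] by simp
qed

lemma integrable_vecI:
  fixes h :: "'a \<Rightarrow> 'b::euclidean_space ^ 'm::finite"
  assumes "\<And>j. integrable M (\<lambda>x. h x $ j)"
  shows "integrable M h"
proof -
  have "integrable M (\<lambda>x. \<Sum>j\<in>UNIV. axis j (h x $ j))"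
    by (intro Bochner_Integration.integrable_sum integrable_bounded_linear[OF bounded_linear_axis] assms)
  then show ?thesis using vec_eq_sum_axis[of "h _"] by simp
qed

lemma integral_vec_nth:
  fixes h :: "'a \<Rightarrow> 'b::euclidean_space ^ 'm::finite"
  shows "integrable M h \<Longrightarrow> (LINT x|M. h x) $ j = (LINT x|M. h x $ j)"
  using integral_bounded_linear[OF bounded_linear_vec_nth, of M h j] by simp

lemma norm_matrix_le: "norm M \<le> (\<Sum>i\<in>UNIV. \<Sum>j\<in>UNIV. norm (M $ i $ j))" for M :: "complex ^ 'm::finite ^ 'k::finite"
proof -
  have "norm M \<le> (\<Sum>i\<in>UNIV. norm (M $ i))" unfolding norm_vec_def by (rule L2_set_le_sum) simp
  also have "\<dots> \<le> (\<Sum>i\<in>UNIV. \<Sum>j\<in>UNIV. norm (M $ i $ j))"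
  proof (rule sum_mono)
    show "norm (M $ i) \<le> (\<Sum>j\<in>UNIV. norm (M $ i $ j))" for i
      unfolding norm_vec_def[of "M $ i"] by (rule L2_set_le_sum) simp
  qed
  finally show ?thesis .
qed

context quasihomogeneous_quotient
begin

lemma heat_kernel_locally_integrable':
  assumes "homdim > 1"
  shows "(\<integral>\<^sup>+y. (\<integral>\<^sup>+t. ennreal (indicator {0<..} t * indicator (cball 0 r) y * norm (heat_kernel ls q t y)) \<partial>lborel) \<partial>lborel) < \<infinity>"
  using heat_kernel_locally_integrable[OF assms, of r] lborel_pair.Fubini'[OF measurable_heat_kernel_lborel[of r]]
  by simp

lemma measurable_heat_kernel_time: "(\<lambda>t. heat_kernel ls q t y) \<in> borel_measurable borel"
  using measurable_compose[OF measurable_Pair2'[of y borel borel] measurable_heat_kernel] by simp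

lemma measurable_time_integral:
  "(\<lambda>y. \<integral>\<^sup>+t. ennreal (indicator {0<..} t * indicator (cball 0 r) y * norm (heat_kernel ls q t y)) \<partial>lborel) \<in> borel_measurable lborel"
proof -
  have "(\<lambda>(y, t). ennreal (indicator {0<..} t * indicator (cball 0 r) y * norm (heat_kernel ls q t y))) \<in> borel_measurable (lborel \<Otimes>\<^sub>M lborel)"
    using measurable_compose[OF measurable_pair_swap' measurable_heat_kernel_lborel[of r]]
    by (simp add: case_prod_beta')
  then show ?thesis by (rule lborel.borel_measurable_nn_integral)
qed

text \<open>Only almost everywhere: this is what Fubini extracts from local integrability, and it is enough
  because the fundamental solution is used only under integrals.\<close>

lemma AE_heat_kernel_integrable:
  assumes N: "homdim > 1"
  shows "AE x in lborel. integrable lborel (\<lambda>t. indicator {0<..} t *\<^sub>R heat_kernel ls q t x)"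
proof -
  have "AE x in lborel. \<forall>j::nat. (\<integral>\<^sup>+t. ennreal (indicator {0<..} t * indicator (cball 0 (real j)) x * norm (heat_kernel ls q t x)) \<partial>lborel) \<noteq> \<infinity>"
    unfolding AE_all_countable
    by (intro allI nn_integral_PInf_AE measurable_time_integral) (use heat_kernel_locally_integrable'[OF N] in \<open>simp add: less_top\<close>)
  then show ?thesis
  proof eventually_elim
    fix x assume fin: "\<forall>j::nat. (\<integral>\<^sup>+t. ennreal (indicator {0<..} t * indicator (cball 0 (real j)) x * norm (heat_kernel ls q t x)) \<partial>lborel) \<noteq> \<infinity>"
    obtain j :: nat where "norm x \<le> real j" using real_arch_simple by blast
    then have "(\<integral>\<^sup>+t. ennreal (norm (indicator {0<..} t *\<^sub>R heat_kernel ls q t x)) \<partial>lborel) < \<infinity>"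
      using spec[OF fin, of j] by (simp add: less_top)
    then show "integrable lborel (\<lambda>t. indicator {0<..} t *\<^sub>R heat_kernel ls q t x)"
      using measurable_heat_kernel_time[of x] by (intro integrableI_bounded) auto
  qed
qed

end

lemma potential_eq_convolve: "potential l ls A f = convolve (fundamental_solution l ls A) f"
  by (simp add: fun_eq_iff potential_def convolve_def)

context
  fixes l :: nat and ls :: "'n::finite \<Rightarrow> nat" and A :: "('n \<Rightarrow> nat) \<Rightarrow> complex ^ 'm::finite ^ 'm" and \<kappa> :: real
  assumes A: "semielliptic l ls A" and N: "(\<Sum>k\<in>UNIV. 1 / real (ls k)) > 1"
  defines "\<kappa> \<equiv> 1 / (2 * pi) ^ CARD('n)"
begin

text \<open>The entries of the matrix heat kernel of the operator.\<close>

definition entry_kernel :: "'m \<Rightarrow> 'm \<Rightarrow> real \<Rightarrow> real ^ 'n \<Rightarrow> complex" where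
  "entry_kernel i j = heat_kernel ls (\<lambda>z. matrix_inv (symbol l ls A z) $ i $ j)"

lemmas entry = quasihomogeneous_quotient_symbol[OF A]

lemma \<kappa>_nonneg [simp]: "0 \<le> \<kappa>"
  by (simp add: \<kappa>_def)

lemma fundamental_solution_eq:
  "fundamental_solution l ls A x = \<kappa> *\<^sub>R (LINT t|lborel. indicator {0<..} t *\<^sub>R (\<chi> i j. entry_kernel i j t x))"
proof -
  let ?M = "\<lambda>t z. cscale (exp (\<i> * complex_of_real (x \<bullet> z)) * complex_of_real (sigma ls z * exp (- t * sigma ls z)))
          (matrix_inv (symbol l ls A z))"
  have "(LINT z|lborel. ?M t z) = (\<chi> i j. entry_kernel i j t x)" if t: "0 < t" for t
  proof -
    have nth: "?M t z $ i $ j = exp (\<i> * complex_of_real (x \<bullet> z)) * (of_real (sigma ls z * exp (- t * sigma ls z)) * matrix_inv (symbol l ls A z) $ i $ j)" for z i j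
      by (simp add: cscale_def)
    have 1: "integrable lborel (\<lambda>z. ?M t z $ i $ j)" for i j
      unfolding nth by (rule quasihomogeneous_quotient.heat_integrable[OF entry t])
    have 2: "integrable lborel (\<lambda>z. ?M t z $ i)" for i by (intro integrable_vecI 1)
    have 3: "integrable lborel (?M t)" by (intro integrable_vecI 2)
    have "(LINT z|lborel. ?M t z) $ i $ j = entry_kernel i j t x" for i j
      by (simp only: integral_vec_nth[OF 3] integral_vec_nth[OF 2] nth entry_kernel_def heat_kernel_def fourier_def)
    then show ?thesis by (simp add: vec_eq_iff)
  qed
  then have eq: "indicator {0<..} t *\<^sub>R (LINT z|lborel. ?M t z) = indicator {0<..} t *\<^sub>R (\<chi> i j. entry_kernel i j t x)" for t
    by (cases "0 < t") simp_all
  show ?thesis unfolding fundamental_solution_def set_lebesgue_integral_def \<kappa>_def by (simp only: eq)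
qed

lemma measurable_fundamental_solution: "fundamental_solution l ls A \<in> borel_measurable borel"
proof -
  have e: "(\<lambda>p. entry_kernel i j (fst p) (snd p)) \<in> borel_measurable (borel \<Otimes>\<^sub>M borel)" for i j
    unfolding entry_kernel_def by (rule quasihomogeneous_quotient.measurable_heat_kernel[OF entry])
  have "(\<lambda>p. entry_kernel i j (snd p) (fst p)) \<in> borel_measurable (borel \<Otimes>\<^sub>M lborel)" for i j
    using measurable_compose[OF measurable_pair_swap' e[of i j]]
    by (simp add: case_prod_beta' cong: measurable_cong_sets sets_pair_measure_cong)
  then have "(\<lambda>p. \<chi> i j. entry_kernel i j (snd p) (fst p)) \<in> borel_measurable (borel \<Otimes>\<^sub>M lborel)"
    by (intro measurable_vecI) simp
  then have "(\<lambda>p. indicator {0<..} (snd p) *\<^sub>R (\<chi> i j. entry_kernel i j (snd p) (fst p))) \<in> borel_measurable (borel \<Otimes>\<^sub>M lborel)"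
    by (intro borel_measurable_scaleR measurable_compose[OF measurable_snd] borel_measurable_indicator) auto
  then have "(\<lambda>x. LINT t|lborel. indicator {0<..} t *\<^sub>R (\<chi> i j. entry_kernel i j t x)) \<in> borel_measurable borel"
    by (intro lborel.borel_measurable_lebesgue_integral) (simp add: case_prod_beta')
  then have "(\<lambda>x. \<kappa> *\<^sub>R (LINT t|lborel. indicator {0<..} t *\<^sub>R (\<chi> i j. entry_kernel i j t x))) \<in> borel_measurable borel"
    by (intro borel_measurable_scaleR borel_measurable_const)
  then show ?thesis unfolding fundamental_solution_eq[symmetric] .
qed

lemma fundamental_solution_locally_integrable:
  "integrable lborel (\<lambda>x. indicator (cball 0 r) x *\<^sub>R fundamental_solution l ls A x)"
proof (rule integrableI_bounded)
  show "(\<lambda>x. indicator (cball 0 r) x *\<^sub>R fundamental_solution l ls A x) \<in> borel_measurable lborel"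
    using measurable_fundamental_solution by (intro borel_measurable_scaleR borel_measurable_indicator) auto
  let ?h = "\<lambda>i j x t. ennreal (indicator {0<..} t * indicator (cball 0 r) x * norm (entry_kernel i j t x))"
  have mt: "(\<lambda>t. ?h i j x t) \<in> borel_measurable lborel" for i j x
    using quasihomogeneous_quotient.measurable_heat_kernel_time[OF entry, of i j x]
    unfolding entry_kernel_def[symmetric] by measurable
  have mx: "(\<lambda>x. \<integral>\<^sup>+t. ?h i j x t \<partial>lborel) \<in> borel_measurable lborel" for i j
    unfolding entry_kernel_def by (rule quasihomogeneous_quotient.measurable_time_integral[OF entry])
  have "ennreal (norm (indicator (cball 0 r) x *\<^sub>R fundamental_solution l ls A x))
      \<le> ennreal \<kappa> * (\<Sum>i\<in>UNIV. \<Sum>j\<in>UNIV. \<integral>\<^sup>+t. ?h i j x t \<partial>lborel)" for x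
  proof -
    have "ennreal (norm (indicator (cball 0 r) x *\<^sub>R fundamental_solution l ls A x))
        = ennreal \<kappa> * ennreal (norm (LINT t|lborel. indicator (cball 0 r) x *\<^sub>R (indicator {0<..} t *\<^sub>R (\<chi> i j. entry_kernel i j t x))))"
      unfolding integral_scaleR_right by (simp add: fundamental_solution_eq ennreal_mult[symmetric] mult_ac)
    also have "\<dots> \<le> ennreal \<kappa> * (\<integral>\<^sup>+t. ennreal (norm (indicator (cball 0 r) x *\<^sub>R (indicator {0<..} t *\<^sub>R (\<chi> i j. entry_kernel i j t x)))) \<partial>lborel)"
      by (intro mult_left_mono norm_integral_le_nn_integral) simp
    also have "\<dots> \<le> ennreal \<kappa> * (\<integral>\<^sup>+t. (\<Sum>i\<in>UNIV. \<Sum>j\<in>UNIV. ?h i j x t) \<partial>lborel)"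
    proof (intro mult_left_mono nn_integral_mono)
      fix t
      have "norm (indicator (cball 0 r) x *\<^sub>R (indicator {0<..} t *\<^sub>R (\<chi> i j. entry_kernel i j t x)))
        \<le> indicator {0<..} t * indicator (cball 0 r) x * (\<Sum>i\<in>UNIV. \<Sum>j\<in>UNIV. norm (entry_kernel i j t x))"
        using norm_matrix_le[of "\<chi> i j. entry_kernel i j t x"] by (simp add: indicator_def)
      also have "\<dots> = (\<Sum>i\<in>UNIV. \<Sum>j\<in>UNIV. indicator {0<..} t * indicator (cball 0 r) x * norm (entry_kernel i j t x))"
        by (simp add: sum_distrib_left)
      finally show "ennreal (norm (indicator (cball 0 r) x *\<^sub>R (indicator {0<..} t *\<^sub>R (\<chi> i j. entry_kernel i j t x))))
        \<le> (\<Sum>i\<in>UNIV. \<Sum>j\<in>UNIV. ?h i j x t)"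
        by (simp add: sum_ennreal sum_nonneg ennreal_leI)
    qed simp
    also have "\<dots> = ennreal \<kappa> * (\<Sum>i\<in>UNIV. \<Sum>j\<in>UNIV. \<integral>\<^sup>+t. ?h i j x t \<partial>lborel)"
      using mt by (simp add: nn_integral_sum borel_measurable_sum del: sum_ennreal)
    finally show ?thesis .
  qed
  then have "(\<integral>\<^sup>+x. ennreal (norm (indicator (cball 0 r) x *\<^sub>R fundamental_solution l ls A x)) \<partial>lborel)
      \<le> (\<integral>\<^sup>+x. ennreal \<kappa> * (\<Sum>i\<in>UNIV. \<Sum>j\<in>UNIV. \<integral>\<^sup>+t. ?h i j x t \<partial>lborel) \<partial>lborel)"
    by (intro nn_integral_mono)
  also have "\<dots> = ennreal \<kappa> * (\<Sum>i\<in>UNIV. \<Sum>j\<in>UNIV. \<integral>\<^sup>+x. \<integral>\<^sup>+t. ?h i j x t \<partial>lborel \<partial>lborel)"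
    using mx by (simp add: nn_integral_cmult nn_integral_sum borel_measurable_sum)
  also have "\<dots> < \<infinity>"
    using quasihomogeneous_quotient.heat_kernel_locally_integrable'[OF entry N, of r]
    by (simp add: entry_kernel_def ennreal_mult_less_top)
  finally show "(\<integral>\<^sup>+x. ennreal (norm (indicator (cball 0 r) x *\<^sub>R fundamental_solution l ls A x)) \<partial>lborel) < \<infinity>" .
qed

text \<open>At a point where the matrix heat kernel fails to be integrable in time the integral of matrices is 0
  by convention, while single entries could still be integrable; hence the exceptional null set.\<close>

lemma fundamental_solution_nth:
  "AE x in lborel. \<forall>i j. fundamental_solution l ls A x $ i $ j
    = of_real \<kappa> * (LINT t|lborel. indicator {0<..} t *\<^sub>R entry_kernel i j t x)"
proof -
  have "AE x in lborel. \<forall>i j. integrable lborel (\<lambda>t. indicator {0<..} t *\<^sub>R entry_kernel i j t x)"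
    unfolding AE_all_countable entry_kernel_def
    by (intro allI quasihomogeneous_quotient.AE_heat_kernel_integrable[OF entry N])
  then show ?thesis
  proof eventually_elim
    fix x assume int: "\<forall>i j. integrable lborel (\<lambda>t. indicator {0<..} t *\<^sub>R entry_kernel i j t x)"
    let ?M = "\<lambda>t. indicator {0<..} t *\<^sub>R (\<chi> i j. entry_kernel i j t x)"
    have 1: "integrable lborel (\<lambda>t. ?M t $ i $ j)" for i j using int by simp
    have 2: "integrable lborel (\<lambda>t. ?M t $ i)" for i by (intro integrable_vecI 1)
    have 3: "integrable lborel ?M" by (intro integrable_vecI 2)
    show "\<forall>i j. fundamental_solution l ls A x $ i $ j
        = of_real \<kappa> * (LINT t|lborel. indicator {0<..} t *\<^sub>R entry_kernel i j t x)"
    proof (intro allI)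
      fix i j
      have "(LINT t|lborel. ?M t) $ i $ j = (LINT t|lborel. ?M t $ i $ j)"
        by (simp only: integral_vec_nth[OF 3] integral_vec_nth[OF 2])
      then show "fundamental_solution l ls A x $ i $ j
          = of_real \<kappa> * (LINT t|lborel. indicator {0<..} t *\<^sub>R entry_kernel i j t x)"
        by (simp add: fundamental_solution_eq scaleR_conv_of_real[where 'a=complex])
    qed
  qed
qed

text \<open>The contribution of time \<open>t\<close> to the potential of \<open>g\<close>, written on the Fourier side.\<close>

definition slice_potential :: "'m \<Rightarrow> 'm \<Rightarrow> (real ^ 'n \<Rightarrow> complex) \<Rightarrow> real ^ 'n \<Rightarrow> real \<Rightarrow> complex" where
  "slice_potential i j g x t = (LINT z|lborel. of_real (sigma ls z * exp (- t * sigma ls z)) *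
     (exp (\<i> * complex_of_real (x \<bullet> z)) * matrix_inv (symbol l ls A z) $ i $ j * fourier g (- z)))"

lemma
  assumes g: "smooth_compact_support g"
  shows slice_potential_integrable:
      "integrable lborel (\<lambda>t. indicator {0<..} t *\<^sub>R slice_potential i j (\<lambda>y. g y $ j) x t)" (is ?int)
    and potential_nth: "potential l ls A g x $ i
      = of_real \<kappa> * (\<Sum>j\<in>UNIV. LINT t|lborel. indicator {0<..} t *\<^sub>R slice_potential i j (\<lambda>y. g y $ j) x t)" (is ?eq)
proof -
  obtain R B where B: "\<And>x. norm (g x) \<le> B" and R: "\<And>x. R < norm x \<Longrightarrow> g x = 0"
    by (rule scs_bounds[OF g]) blast
  have gj: "integrable lborel (\<lambda>y. g y $ j)" "\<And>y. norm (g y $ j) \<le> B" "\<And>y. R < norm y \<Longrightarrow> g y $ j = 0" for j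
    using integrable_bounded_linear[OF bounded_linear_vec_nth scs_integrable[OF g]] order_trans[OF Finite_Cartesian_Product.norm_nth_le B]
    by (auto simp: R)
  note formula = quasihomogeneous_quotient.potential_formula[OF entry N gj, folded entry_kernel_def slice_potential_def]
  show ?int by (rule formula)
  let ?I = "\<lambda>i j y. LINT t|lborel. indicator {0<..} t *\<^sub>R entry_kernel i j t (x - y)"
  have int: "integrable lborel (\<lambda>y. fundamental_solution l ls A (x - y) *v g y)"
    by (rule convolve_integrable[OF measurable_fundamental_solution fundamental_solution_locally_integrable g])
  \<comment> \<open>The exceptional null set of \<open>fundamental_solution_nth\<close> is reflected and translated.\<close>
  have "AE y in distr lborel borel (\<lambda>y. x - y). \<forall>i j. fundamental_solution l ls A y $ i $ j
      = of_real \<kappa> * (LINT t|lborel. indicator {0<..} t *\<^sub>R entry_kernel i j t y)"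
    unfolding distr_lborel_diff by (rule fundamental_solution_nth)
  then have ae: "AE y in lborel. \<forall>i j. fundamental_solution l ls A (x - y) $ i $ j = of_real \<kappa> * ?I i j y"
    by (rule AE_distrD[rotated]) measurable
  have "potential l ls A g x $ i = (LINT y|lborel. (fundamental_solution l ls A (x - y) *v g y) $ i)"
    unfolding potential_def by (rule integral_vec_nth[OF int])
  also have "\<dots> = (LINT y|lborel. (\<Sum>j\<in>UNIV. of_real \<kappa> * (?I i j y * g y $ j)))"
  proof (rule integral_cong_AE)
    show "(\<lambda>y. (fundamental_solution l ls A (x - y) *v g y) $ i) \<in> borel_measurable lborel"
      using integrable_bounded_linear[OF bounded_linear_vec_nth int] by (rule borel_measurable_integrable)
    show "(\<lambda>y. \<Sum>j\<in>UNIV. of_real \<kappa> * (?I i j y * g y $ j)) \<in> borel_measurable lborel"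
      by (intro borel_measurable_integrable Bochner_Integration.integrable_sum integrable_mult_right formula)
    show "AE y in lborel. (fundamental_solution l ls A (x - y) *v g y) $ i = (\<Sum>j\<in>UNIV. of_real \<kappa> * (?I i j y * g y $ j))"
      using ae by eventually_elim (simp add: matrix_vector_mult_def mult.assoc)
  qed
  also have "\<dots> = (\<Sum>j\<in>UNIV. of_real \<kappa> * (LINT y|lborel. ?I i j y * g y $ j))"
    using formula(1) by (subst Bochner_Integration.integral_sum) auto
  also have "\<dots> = of_real \<kappa> * (\<Sum>j\<in>UNIV. LINT t|lborel. indicator {0<..} t *\<^sub>R slice_potential i j (\<lambda>y. g y $ j) x t)"
    by (simp only: formula(3) sum_distrib_left)
  finally show ?eq .
qed

text \<open>On the Fourier side the operator contributes \<open>\<Sum>\<alpha>. A \<alpha> (i z)^\<alpha>\<close>, the symbol, to the left of its own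
  inverse.  What is left is the regularised inversion integral of \<open>f\<close>, slice by slice in time.\<close>

lemma operator_potential:
  assumes f: "smooth_compact_support f"
  shows "operator l ls A (potential l ls A f) x = f x"
proof -
  let ?R = "\<lambda>z. matrix_inv (symbol l ls A z)"
  let ?mon = "\<lambda>\<alpha> z. \<Prod>k\<in>UNIV. (\<i> * complex_of_real (z $ k)) ^ \<alpha> k"
  let ?w = "\<lambda>t z. complex_of_real (sigma ls z * exp (- t * sigma ls z))"
  let ?E = "\<lambda>z. exp (\<i> * complex_of_real (x \<bullet> z))"
  have l: "0 < l" and ls: "\<And>k. 0 < ls k" and inv: "\<And>x. x \<noteq> 0 \<Longrightarrow> invertible (symbol l ls A x)"
    using A by (auto simp: semielliptic_def)
  note fin = finite_indices[OF l ls]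
  have "(operator l ls A (potential l ls A f) x) $ i = f x $ i" for i
  proof -
    define \<phi> where "\<phi> j z = fourier (\<lambda>y. f y $ j) (- z)" for j z
    \<comment> \<open>The three sums over the multi-index, the matrix product and the potential are treated as one.\<close>
    define S where "S = indices l ls \<times> (UNIV :: 'm set) \<times> (UNIV :: 'm set)"
    have finS: "finite S" unfolding S_def using fin by (intro finite_cartesian_product) auto
    define b where "b s t = (case s of (\<alpha>, p, j) \<Rightarrow> A \<alpha> $ i $ p * slice_potential p j (\<lambda>y. multi_deriv \<alpha> f y $ j) x t)" for s t
    define c where "c s z = (case s of (\<alpha>, p, j) \<Rightarrow> A \<alpha> $ i $ p * (?mon \<alpha> z * ?R z $ p $ j * \<phi> j z))" for s z
    \<comment> \<open>The derivatives fall on \<open>f\<close>, so the coefficient matrices multiply potentials of derivatives.\<close>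
    have md: "multi_deriv \<alpha> (potential l ls A f) = potential l ls A (multi_deriv \<alpha> f)" for \<alpha>
      unfolding potential_eq_convolve
      by (rule multi_deriv_convolve[OF measurable_fundamental_solution fundamental_solution_locally_integrable f])
    have b_int: "integrable lborel (\<lambda>t. indicator {0<..} t *\<^sub>R b s t)" for s
    proof -
      obtain \<alpha> p j where s: "s = (\<alpha>, p, j)" by (cases s) auto
      have eq: "indicator {0<..} t *\<^sub>R b s t = A \<alpha> $ i $ p * (indicator {0<..} t *\<^sub>R slice_potential p j (\<lambda>y. multi_deriv \<alpha> f y $ j) x t)" for t
        by (simp add: b_def s)
      show ?thesis
        unfolding eq by (intro integrable_mult_right slice_potential_integrable scs_multi_deriv f)
    qed
    have "(operator l ls A (potential l ls A f) x) $ i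
        = (\<Sum>\<alpha>\<in>indices l ls. \<Sum>p\<in>UNIV. A \<alpha> $ i $ p * (of_real \<kappa> * (\<Sum>j\<in>UNIV. LINT t|lborel. indicator {0<..} t *\<^sub>R
            slice_potential p j (\<lambda>y. multi_deriv \<alpha> f y $ j) x t)))"
      unfolding operator_def md sum_component matrix_vector_mult_def
      by (simp only: vec_lambda_beta potential_nth[OF scs_multi_deriv[OF f]])
    also have "\<dots> = of_real \<kappa> * (\<Sum>\<alpha>\<in>indices l ls. \<Sum>p\<in>UNIV. \<Sum>j\<in>UNIV. LINT t|lborel. indicator {0<..} t *\<^sub>R b (\<alpha>, p, j) t)"
    proof -
      have b_lint: "(LINT t|lborel. indicator {0<..} t *\<^sub>R b (\<alpha>, p, j) t)
          = A \<alpha> $ i $ p * (LINT t|lborel. indicator {0<..} t *\<^sub>R slice_potential p j (\<lambda>y. multi_deriv \<alpha> f y $ j) x t)" for \<alpha> p j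
        unfolding b_def prod.case mult_scaleR_right[symmetric] by (rule integral_mult_right_zero)
      show ?thesis unfolding b_lint by (simp add: sum_distrib_left mult.left_commute)
    qed
    also have "(\<Sum>\<alpha>\<in>indices l ls. \<Sum>p\<in>UNIV. \<Sum>j\<in>UNIV. LINT t|lborel. indicator {0<..} t *\<^sub>R b (\<alpha>, p, j) t)
        = (\<Sum>s\<in>S. LINT t|lborel. indicator {0<..} t *\<^sub>R b s t)"
      unfolding S_def by (simp add: sum.cartesian_product split_def)
    also have "\<dots> = (LINT t|lborel. (\<Sum>s\<in>S. indicator {0<..} t *\<^sub>R b s t))"
      using b_int by (simp add: Bochner_Integration.integral_sum)
    also have "\<dots> = (LINT t|lborel. indicator {0<..} t *\<^sub>R (LINT z|lborel. ?w t z * (?E z * \<phi> i z)))"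
    proof (rule Bochner_Integration.integral_cong[OF refl])
      fix t :: real
      show "(\<Sum>s\<in>S. indicator {0<..} t *\<^sub>R b s t) = indicator {0<..} t *\<^sub>R (LINT z|lborel. ?w t z * (?E z * \<phi> i z))"
      proof (cases "0 < t")
        case True
        have b_eq: "b s t = (LINT z|lborel. ?w t z * (?E z * c s z))" for s
        proof -
          obtain \<alpha> p j where s: "s = (\<alpha>, p, j)" by (cases s) auto
          have eq: "A \<alpha> $ i $ p * (?w t z * (?E z * ?R z $ p $ j * (?mon \<alpha> z * \<phi> j z))) = ?w t z * (?E z * c s z)" for z
            by (simp add: c_def s mult_ac)
          show ?thesis
            unfolding b_def s slice_potential_def fourier_multi_deriv[OF f] \<phi>_def[symmetric] prod.case
            by (simp only: integral_mult_right_zero[symmetric] eq s[symmetric])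
        qed
        have c_int: "integrable lborel (\<lambda>z. ?w t z * (?E z * c s z))" for s
        proof -
          obtain \<alpha> p j where s: "s = (\<alpha>, p, j)" by (cases s) auto
          let ?g = "\<lambda>y. multi_deriv \<alpha> f y $ j"
          note scs = scs_multi_deriv[OF f, of \<alpha>]
          have gi: "integrable lborel ?g" by (rule integrable_bounded_linear[OF bounded_linear_vec_nth scs_integrable[OF scs]])
          have 1: "integrable lborel (\<lambda>z. ?E z * (?w t z * ?R z $ p $ j))"
            by (rule quasihomogeneous_quotient.heat_integrable[OF entry True])
          have "integrable lborel (\<lambda>z. (?E z * (?w t z * ?R z $ p $ j)) * fourier ?g (- z))"
          proof (rule Bochner_Integration.integrable_bound)
            show "integrable lborel (\<lambda>z. (?E z * (?w t z * ?R z $ p $ j)) * of_real (LINT y|lborel. norm (?g y)))"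
              by (intro integrable_mult_left 1)
            have "(\<lambda>z. fourier ?g (- z)) \<in> borel_measurable borel"
              by (rule measurable_compose[OF _ measurable_fourier]) (use gi in auto)
            then show "(\<lambda>z. (?E z * (?w t z * ?R z $ p $ j)) * fourier ?g (- z)) \<in> borel_measurable lborel"
              by (intro borel_measurable_times[OF borel_measurable_integrable[OF 1]]) simp
            show "AE z in lborel. norm ((?E z * (?w t z * ?R z $ p $ j)) * fourier ?g (- z))
                \<le> norm ((?E z * (?w t z * ?R z $ p $ j)) * complex_of_real (LINT y|lborel. norm (?g y)))"
              unfolding norm_mult[of "?E _ * _"]
              by (intro AE_I2 mult_left_mono order_trans[OF norm_fourier_le[OF gi]]) (auto intro: abs_ge_self)
          qed
          from integrable_mult_right[OF this, of "A \<alpha> $ i $ p"] show ?thesis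
            unfolding fourier_multi_deriv[OF f] c_def s \<phi>_def by (simp add: mult_ac)
        qed
        \<comment> \<open>The matrix identity \<open>L ** inverse L = mat 1\<close>, summed against the transform of \<open>f\<close>.\<close>
        have c_sum: "?w t z * (?E z * (\<Sum>s\<in>S. c s z)) = ?w t z * (?E z * \<phi> i z)" for z
        proof (cases "z = 0")
          case True
          then show ?thesis using sigma_0[of ls, OF ls] by simp
        next
          case False
          have "(\<Sum>s\<in>S. c s z) = (\<Sum>\<alpha>\<in>indices l ls. \<Sum>p\<in>UNIV. \<Sum>j\<in>UNIV. A \<alpha> $ i $ p * (?mon \<alpha> z * ?R z $ p $ j * \<phi> j z))"
            unfolding S_def c_def by (simp add: sum.cartesian_product split_def)
          also have "\<dots> = (\<Sum>j\<in>UNIV. \<Sum>p\<in>UNIV. \<Sum>\<alpha>\<in>indices l ls. A \<alpha> $ i $ p * (?mon \<alpha> z * ?R z $ p $ j * \<phi> j z))"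
            by (subst sum.swap, subst sum.swap[of _ "indices l ls"], subst sum.swap, rule refl)
          also have "\<dots> = (\<Sum>j\<in>UNIV. (symbol l ls A z ** ?R z) $ i $ j * \<phi> j z)"
            by (simp add: matrix_matrix_mult_def symbol_nth sum_distrib_right sum_distrib_left mult_ac)
          also have "\<dots> = \<phi> i z"
            unfolding matrix_inv_right[OF inv[OF False]] by (simp add: mat_def if_distrib[of "\<lambda>x. x * _"] cong: if_cong)
          finally show ?thesis by simp
        qed
        have "(\<Sum>s\<in>S. b s t) = (LINT z|lborel. (\<Sum>s\<in>S. ?w t z * (?E z * c s z)))"
          unfolding b_eq using c_int by (simp add: Bochner_Integration.integral_sum)
        also have "\<dots> = (LINT z|lborel. ?w t z * (?E z * \<phi> i z))"
          by (simp only: sum_distrib_left[symmetric] c_sum)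
        finally show ?thesis using True by simp
      qed simp
    qed
    also have "\<dots> = (LINT z|lborel. ?E z * \<phi> i z)"
    proof (rule iterated_integral_regularization)
      have "integrable lborel (\<phi> i)"
        using integrable_reflect[OF scs_fourier_integrable[OF f, of i], of 0] by (simp add: \<phi>_def[abs_def])
      then show "integrable lborel (\<lambda>z. ?E z * \<phi> i z)" by (rule integrable_fourier_integrand)
    qed
    also have "\<dots> = of_real ((2 * pi) ^ CARD('n)) * f x $ i"
    proof -
      obtain R B where B: "\<And>x. norm (f x) \<le> B" by (rule scs_bounds[OF f]) blast
      show ?thesis unfolding \<phi>_def
      proof (rule fourier_inversion)
        show "continuous_on UNIV (\<lambda>y. f y $ i)" by (intro continuous_intros smooth_continuous scs_smooth f)
        show "integrable lborel (\<lambda>y. f y $ i)" by (rule integrable_bounded_linear[OF bounded_linear_vec_nth scs_integrable[OF f]])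
        show "norm (f y $ i) \<le> B" for y by (rule order_trans[OF Finite_Cartesian_Product.norm_nth_le B])
        show "integrable lborel (fourier (\<lambda>y. f y $ i))" by (rule scs_fourier_integrable[OF f])
      qed
    qed
    finally show ?thesis by (simp add: \<kappa>_def)
  qed
  then show ?thesis by (simp add: vec_eq_iff)
qed

end

theorem theorem3p5:
  fixes l :: nat
    and ls :: "'n::finite \<Rightarrow> nat"
    and A :: "('n \<Rightarrow> nat) \<Rightarrow> complex ^ 'm ^ 'm::finite"
    and f :: "real ^ 'n \<Rightarrow> complex ^ 'm"
  assumes "semielliptic l ls A"
    and "(\<Sum>k\<in>UNIV. weight l ls k) > real l"
    and "smooth_compact_support f"
  shows "(\<forall>x. integrable lborel (\<lambda>y. fundamental_solution l ls A (x - y) *v f y)) \<and>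
         smooth (potential l ls A f) \<and>
         operator l ls A (potential l ls A f) = f"
proof -
  have l: "0 < l" using assms(1) by (simp add: semielliptic_def)
  have "(\<Sum>k\<in>UNIV. weight l ls k) = real l * (\<Sum>k\<in>UNIV. 1 / real (ls k))"
    by (simp add: weight_def sum_distrib_left)
  then have N: "(\<Sum>k\<in>UNIV. 1 / real (ls k)) > 1"
    using assms(2) l by simp
  note K = measurable_fundamental_solution[OF assms(1) N] fundamental_solution_locally_integrable[OF assms(1) N]
  show ?thesis
    using convolve_integrable[OF K assms(3)] smooth_convolve[OF K assms(3)] operator_potential[OF assms(1) N assms(3)]
    by (auto simp: potential_eq_convolve fun_eq_iff)
qed

end
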